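(* Let $I\subset S$ be a homogeneous ideal such that $V_X(I)$ is zero-dimensional, let $\mathrm{Var}_X(I)=\{\zeta_1,\dots,\zeta_\delta\}$, and let $\mu_i$ be the multiplicity of $\zeta_i$ in $V_X(I)$. Let $(\alpha,\alpha_0)\in \mathrm{Cl}(X)^2$ be a regularity pair for $I$. Let $g\in S_{\alpha_0}$ and let $h_0\in S_{\alpha_0}$ be such that $\mathrm{Var}_X(I)\cap \mathrm{Var}_X(h_0)=\emptyset$. Consider the linear map $M_g\circ M_{h_0}^{-1}:(S/I)_{\alpha+\alpha_0}\to (S/I)_{\alpha+\alpha_0}$, and for each $i$ set $$\frac{g}{h_0}(\zeta_i):=\frac{\mathrm{ev}_{\zeta_i}(\eta_{\alpha_0,\sigma_i}(g))}{\mathrm{ev}_{\zeta_i}(\eta_{\alpha_0,\sigma_i}(h_0))},$$ where $\sigma_i\in\Sigma(n)$ is a cone with $\zeta_i\in U_{\sigma_i}$. Then $$\det\left(\lambda\,\mathrm{id}_{(S/I)_{\alpha+\alpha_0}}-M_g\circ M_{h_0}^{-1}\right)=\prod_{i=1}^{\delta}\left(\lambda-\frac{g}{h_0}(\zeta_i)\right)^{\mu_i}.$$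
   Context: Setting. $X=X_\Sigma$ is the normal toric variety over $\mathbb{C}$ of a complete rational polyhedral fan $\Sigma$ in $N_{\mathbb R}\simeq\mathbb{R}^n$, $M$ is the dual lattice of $N$, $\rho_1,\dots,\rho_k$ are the rays of $\Sigma$ with primitive generators $u_1,\dots,u_k$, $F=[u_1\cdots u_k]\in\mathbb{Z}^{n\times k}$, $D_i$ is the torus-invariant prime divisor of $\rho_i$, $\Sigma(n)$ is the set of $n$-dimensional cones, and $U_\sigma\subset X$ is the affine toric chart of $\sigma$. $\mathrm{Cl}(X)\simeq\mathbb{Z}^k/\mathrm{im}\,F^\top$ is the class group. The Cox ring is $S=\mathbb{C}[x_1,\dots,x_k]$ graded by $\deg x_i=[D_i]$, with graded pieces $S_\alpha$; $x^{\hat\sigma}=\prod_{\rho_i\notin\sigma}x_i$ and $B=\langle x^{\hat\sigma}\mid\sigma\in\Sigma\rangle$ is the irrelevant ideal. $\pi:\mathbb{C}^k\setminus \mathrm{Var}_{\mathbb{C}^k}(B)\to X$ is the Cox quotient map. For homogeneous $f\in S$, $\mathrm{Var}_X(f)=\{\zeta\in X\mid f(x)=0\text{ for some }x\in\pi^{-1}(\zeta)\}$. A homogeneous ideal $I\subset S$ defines a closed subscheme $V_X(I)$ whose ideal on $U_\sigma$ is $I^\sigma:=(I_{x^{\hat\sigma}})_0\subset (S_{x^{\hat\sigma}})_0\simeq\mathbb{C}[U_\sigma]$; $\mathrm{Var}_X(I)$ is its underlying reduced variety. A point $\zeta$ is a basepoint of $S_\alpha$ if all $f\in S_\alpha$ vanish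 at $\zeta$. Regularity. For $V_X(I)$ zero-dimensional of degree $\delta^+=\mu_1+\cdots+\mu_\delta$, $\mathrm{Reg}(I)=\{\alpha\in\mathrm{Cl}(X)\mid \dim_{\mathbb C}(S/I)_\alpha=\delta^+,\ I_\alpha=(I:B^\infty)_\alpha,\ \text{no point of }V_X(I)\text{ is a basepoint of }S_\alpha\}$. A pair $(\alpha,\alpha_0)\in\mathrm{Cl}(X)^2$ is a regularity pair if $\alpha,\alpha+\alpha_0\in\mathrm{Reg}(I)$ and no point of $V_X(I)$ is a basepoint of $S_{\alpha_0}$. Multiplication maps. For $g\in S_{\alpha_0}$, $M_g:(S/I)_\alpha\to(S/I)_{\alpha+\alpha_0}$ is $M_g(f+I_\alpha)=fg+I_{\alpha+\alpha_0}$. (For a regularity pair and $h_0$ nowhere vanishing on $\mathrm{Var}_X(I)$, $M_{h_0}$ is bijective.) Dehomogenization. For $\sigma\in\Sigma(n)$ and $\gamma=[\sum a_iD_i]$ such that there is $m_\sigma\in M$ with $\langle u_i,m_\sigma\rangle+a_i=0$ for all rays $\rho_i$ of $\sigma$, put $x^{\hat\sigma,\gamma}=x^{F^\top m_\sigma+a}$ (a Laurent monomial of degree $\gamma$, a unit in $S_{x^{\hat\sigma}}$) and $f^\sigma=f/x^{\hat\sigma,\gamma}\in\mathbb{C}[U_\sigma]$ for $f\in S_\gamma$. If no such $m_\sigma$ exists, put $f^\sigma=0$. The maps $\eta$. Fix $h_{\alpha_0}\in S_{\alpha_0}$ not vanishing at any point of $\mathrm{Var}_X(I)$. For each $\sigma\in\Sigma(n)$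 there are $\gamma\in\mathrm{Cl}(X)$ and $g_\sigma\in S_{\gamma-\alpha_0}$ with $(g_\sigma h_{\alpha_0})^\sigma\neq0$ and $(g_\sigma h_{\alpha_0})^\sigma-1\in I^\sigma$; fix such a choice and define $\eta_{\alpha_0,\sigma}:S_{\alpha_0}\to\mathbb{C}[U_\sigma]$, $\eta_{\alpha_0,\sigma}(f)=(g_\sigma f)^\sigma$. $\mathrm{ev}_{\zeta_i}$ denotes evaluation of a regular function on $U_{\sigma_i}$ at $\zeta_i$. *)

theory Defs
  imports
    "HOL-Analysis.Analysis"
    "HOL-Library.Poly_Mapping"
    "HOL-Library.Set_Algebras"
    "HOL-Algebra.Ideal_Product"
    "Jordan_Normal_Form.VS_Connect"
begin

no_notation Matrix.vec_index (infixl \<open>$\<close> 100)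

text \<open>
  The lattices are \<open>N = M = int^'n\<close> with the standard pairing, and the rays of the fan are
  indexed by a finite type \<open>'k\<close>. The Cox ring and the coordinate ring of the torus are monoid
  algebras; Laurent polynomials in the Cox variables contain all the localizations of the Cox
  ring at monomials.
\<close>

type_synonym 'k cox_poly = "(nat^'k) \<Rightarrow>\<^sub>0 complex"
type_synonym 'k cox_laurent = "(int^'k) \<Rightarrow>\<^sub>0 complex"
type_synonym 'n character_poly = "(int^'n) \<Rightarrow>\<^sub>0 complex"

text \<open>In a pair \<open>(\<sigma>, \<phi>)\<close>, \<open>\<phi>\<close> is a complex point of the affine chart of \<open>\<sigma>\<close>, i.e. an algebra
  homomorphism from its coordinate ring to the complex numbers. A point of the toric variety is a
  class of such pairs under gluing.\<close>

type_synonym 'n toric_point = "((real^'n) set \<times> ('n character_poly \<Rightarrow> complex)) set"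


subsection \<open>Fans and rays\<close>

definition real_vec :: "int^'n \<Rightarrow> real^'n" where
  "real_vec v = (\<chi> j. real_of_int (v $ j))"

definition rational_polyhedral_cone :: "(real^'n) set \<Rightarrow> bool" where
  "rational_polyhedral_cone \<sigma> \<longleftrightarrow> (\<exists>V. finite V \<and> \<sigma> = convex_cone hull (real_vec ` V))"

definition strongly_convex :: "(real^'n) set \<Rightarrow> bool" where
  "strongly_convex \<sigma> \<longleftrightarrow> \<sigma> \<inter> uminus ` \<sigma> = {0}"

text \<open>The library relation \<open>face_of\<close> also counts the empty set as a face.\<close>

definition fan :: "(real^'n) set set \<Rightarrow> bool" where
  "fan \<Sigma> \<longleftrightarrow> finite \<Sigma> \<and> \<Sigma> \<noteq> {} \<and>
     (\<forall>\<sigma>\<in>\<Sigma>. rational_polyhedral_cone \<sigma> \<and> strongly_convex \<sigma>) \<and>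
     (\<forall>\<sigma>\<in>\<Sigma>. \<forall>\<tau>. \<tau> face_of \<sigma> \<and> \<tau> \<noteq> {} \<longrightarrow> \<tau> \<in> \<Sigma>) \<and>
     (\<forall>\<sigma>\<in>\<Sigma>. \<forall>\<tau>\<in>\<Sigma>. (\<sigma> \<inter> \<tau>) face_of \<sigma> \<and> (\<sigma> \<inter> \<tau>) face_of \<tau>)"

definition complete_fan :: "(real^'n) set set \<Rightarrow> bool" where
  "complete_fan \<Sigma> \<longleftrightarrow> fan \<Sigma> \<and> \<Union>\<Sigma> = UNIV"

definition maximal_cones :: "(real^'n) set set \<Rightarrow> (real^'n) set set" where
  "maximal_cones \<Sigma> = {\<sigma>\<in>\<Sigma>. dim \<sigma> = CARD('n)}"

definition primitive_vec :: "int^'n \<Rightarrow> bool" where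
  "primitive_vec v \<longleftrightarrow> Gcd (range (vec_nth v)) = 1"

definition ray :: "int^'n \<Rightarrow> (real^'n) set" where
  "ray v = convex_cone hull {real_vec v}"

text \<open>\<open>u\<close> enumerates, without repetition, the primitive generators of the rays of the fan.\<close>

definition ray_generators :: "(real^'n) set set \<Rightarrow> ('k::finite \<Rightarrow> int^'n) \<Rightarrow> bool" where
  "ray_generators \<Sigma> u \<longleftrightarrow>
     (\<forall>i. primitive_vec (u i)) \<and> bij_betw (\<lambda>i. ray (u i)) UNIV {\<rho>\<in>\<Sigma>. dim \<rho> = 1}"

definition cone_rays :: "('k \<Rightarrow> int^'n) \<Rightarrow> (real^'n) set \<Rightarrow> 'k set" where
  "cone_rays u \<sigma> = {i. ray (u i) face_of \<sigma>}"


subsection \<open>The class group and the Cox ring\<close>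

text \<open>The linear map given by the transpose of \<open>F = [u\<^sub>1 \<dots> u\<^sub>k]\<close>: its \<open>i\<close>-th
  coordinate is the pairing of \<open>u i\<close> with \<open>m\<close>.\<close>

definition FT :: "('k::finite \<Rightarrow> int^'n) \<Rightarrow> int^'n \<Rightarrow> int^'k" where
  "FT u m = (\<chi> i. u i) *v m"

definition divisor_class :: "('k::finite \<Rightarrow> int^'n) \<Rightarrow> int^'k \<Rightarrow> (int^'k) set" where
  "divisor_class u a = a +o range (FT u)"

text \<open>Classes are cosets of the image of \<open>FT u\<close>, so the group operation is the elementwise sum of
  sets. The symbol \<open>-\<close> on sets is set difference, whence a separate subtraction.\<close>

definition class_group :: "('k::finite \<Rightarrow> int^'n) \<Rightarrow> (int^'k) set set" where
  "class_group u = range (divisor_class u)"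

definition class_diff :: "(int^'k) set \<Rightarrow> (int^'k) set \<Rightarrow> (int^'k) set" where
  "class_diff \<alpha> \<beta> = {a - b | a b. a \<in> \<alpha> \<and> b \<in> \<beta>}"

definition int_vec :: "nat^'k \<Rightarrow> int^'k" where
  "int_vec e = (\<chi> i. int (e $ i))"

text \<open>As \<open>deg x\<^sub>i = [D\<^sub>i]\<close>, a monomial has degree \<open>\<alpha>\<close> iff its exponent vector lies in the
  coset \<open>\<alpha>\<close>.\<close>

definition graded_piece :: "(int^'k) set \<Rightarrow> 'k::finite cox_poly set" where
  "graded_piece \<alpha> = {f. \<forall>e \<in> Poly_Mapping.keys f. int_vec e \<in> \<alpha>}"

definition homogeneous_ideal :: "('k::finite \<Rightarrow> int^'n) \<Rightarrow> 'k cox_poly set \<Rightarrow> bool" where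
  "homogeneous_ideal u I \<longleftrightarrow>
     (\<exists>H \<subseteq> (\<Union>\<alpha>\<in>class_group u. graded_piece \<alpha>). I = Idl\<^bsub>class_ring\<^esub> H)"

definition hat_exponent :: "('k::finite \<Rightarrow> int^'n) \<Rightarrow> (real^'n) set \<Rightarrow> nat^'k" where
  "hat_exponent u \<sigma> = (\<chi> i. if i \<in> cone_rays u \<sigma> then 0 else 1)"

definition irrelevant_ideal ::
    "(real^'n) set set \<Rightarrow> ('k::finite \<Rightarrow> int^'n) \<Rightarrow> 'k cox_poly set" where
  "irrelevant_ideal \<Sigma> u =
     Idl\<^bsub>class_ring\<^esub> ((\<lambda>\<sigma>. Poly_Mapping.single (hat_exponent u \<sigma>) 1) ` \<Sigma>)"

primrec ideal_power :: "('a::comm_ring_1) set \<Rightarrow> nat \<Rightarrow> 'a set" where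
  "ideal_power J 0 = UNIV"
| "ideal_power J (Suc l) = ideal_prod class_ring J (ideal_power J l)"

definition saturation :: "('a::comm_ring_1) set \<Rightarrow> 'a set \<Rightarrow> 'a set" where
  "saturation I J = (\<Union>l. {f. \<forall>b \<in> ideal_power J l. f * b \<in> I})"

definition poly_eval :: "complex^'k \<Rightarrow> 'k::finite cox_poly \<Rightarrow> complex" where
  "poly_eval x f =
     (\<Sum>e\<in>Poly_Mapping.keys f. Poly_Mapping.lookup f e * (\<Prod>i\<in>UNIV. x $ i ^ (e $ i)))"

definition laurent_eval :: "complex^'k \<Rightarrow> 'k::finite cox_laurent \<Rightarrow> complex" where
  "laurent_eval x q =
     (\<Sum>e\<in>Poly_Mapping.keys q. Poly_Mapping.lookup q e * (\<Prod>i\<in>UNIV. x $ i powi (e $ i)))"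

definition to_laurent :: "'k::finite cox_poly \<Rightarrow> 'k cox_laurent" where
  "to_laurent f =
     (\<Sum>e\<in>Poly_Mapping.keys f. Poly_Mapping.single (int_vec e) (Poly_Mapping.lookup f e))"


subsection \<open>The toric variety and the Cox quotient map\<close>

definition dual_monoid :: "(real^'n) set \<Rightarrow> (int^'n) set" where
  "dual_monoid \<sigma> = {m. \<forall>v\<in>\<sigma>. inner (real_vec m) v \<ge> 0}"

definition coord_ring :: "(real^'n) set \<Rightarrow> 'n::finite character_poly ring" where
  "coord_ring \<sigma> = class_ring \<lparr>carrier := {p. Poly_Mapping.keys p \<subseteq> dual_monoid \<sigma>}\<rparr>"

definition chart_points ::
    "(real^'n) set \<Rightarrow> ('n::finite character_poly \<Rightarrow> complex) set" where
  "chart_points \<sigma> =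
     {\<phi> \<in> Ring.ring_hom (coord_ring \<sigma>) class_ring \<inter> extensional (carrier (coord_ring \<sigma>)).
        \<forall>c. \<phi> (Poly_Mapping.single 0 c) = c}"

text \<open>Gluing along the charts of the intersections \<open>\<sigma> \<inter> \<tau>\<close>, whose coordinate rings contain those
  of \<open>\<sigma>\<close> and \<open>\<tau>\<close>.\<close>

definition glue ::
    "(real^'n) set set \<Rightarrow> (((real^'n) set \<times> ('n::finite character_poly \<Rightarrow> complex)) \<times>
      ((real^'n) set \<times> ('n character_poly \<Rightarrow> complex))) set" where
  "glue \<Sigma> = {((\<sigma>, \<phi>), (\<tau>, \<psi>)). \<sigma> \<in> \<Sigma> \<and> \<tau> \<in> \<Sigma> \<and> (\<exists>\<theta>\<in>chart_points (\<sigma> \<inter> \<tau>).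
     \<phi> = restrict \<theta> (carrier (coord_ring \<sigma>)) \<and> \<psi> = restrict \<theta> (carrier (coord_ring \<tau>)))}"

definition toric_variety :: "(real^'n) set set \<Rightarrow> 'n::finite toric_point set" where
  "toric_variety \<Sigma> = (SIGMA \<sigma>:\<Sigma>. chart_points \<sigma>) // glue \<Sigma>"

definition affine_chart ::
    "(real^'n) set set \<Rightarrow> (real^'n) set \<Rightarrow> 'n::finite toric_point set" where
  "affine_chart \<Sigma> \<sigma> = {\<zeta> \<in> toric_variety \<Sigma>. \<exists>\<phi>. (\<sigma>, \<phi>) \<in> \<zeta>}"

definition ev :: "(real^'n) set \<Rightarrow> 'n::finite toric_point \<Rightarrow> 'n character_poly \<Rightarrow> complex" where
  "ev \<sigma> \<zeta> p = (THE \<phi>. (\<sigma>, \<phi>) \<in> \<zeta>) p"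

text \<open>The ring isomorphism from Laurent polynomials in degree 0 to the coordinate ring of the
  torus, inverse to the substitution of \<open>x^(FT u m)\<close> for the character of \<open>m\<close>. It relies on
  \<open>FT u\<close> being injective, which holds for complete fans.\<close>

definition dehom0 :: "('k::finite \<Rightarrow> int^'n) \<Rightarrow> 'k cox_laurent \<Rightarrow> 'n::finite character_poly" where
  "dehom0 u q = Poly_Mapping.map_key (FT u) q"

definition cox_domain ::
    "(real^'n) set set \<Rightarrow> ('k::finite \<Rightarrow> int^'n) \<Rightarrow> (complex^'k) set" where
  "cox_domain \<Sigma> u = - {x. \<forall>b\<in>irrelevant_ideal \<Sigma> u. poly_eval x b = 0}"

definition cox_substitution :: "('k::finite \<Rightarrow> int^'n) \<Rightarrow> 'n::finite character_poly \<Rightarrow> 'k cox_laurent" where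
  "cox_substitution u p =
     (\<Sum>m\<in>Poly_Mapping.keys p. Poly_Mapping.single (FT u m) (Poly_Mapping.lookup p m))"

text \<open>Every \<open>\<sigma>\<close> such that \<open>x^\<sigma>\<close>-hat does not vanish at \<open>x\<close> yields the same point, so the union
  below is a single class.\<close>

definition cox_quotient ::
    "(real^'n) set set \<Rightarrow> ('k::finite \<Rightarrow> int^'n) \<Rightarrow> complex^'k \<Rightarrow> 'n::finite toric_point" where
  "cox_quotient \<Sigma> u x =
     (\<Union>\<sigma>\<in>{\<sigma>\<in>\<Sigma>. poly_eval x (Poly_Mapping.single (hat_exponent u \<sigma>) 1) \<noteq> 0}.
        glue \<Sigma> `` {(\<sigma>, restrict (\<lambda>p. laurent_eval x (cox_substitution u p)) (carrier (coord_ring \<sigma>)))})"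

definition hypersurface ::
    "(real^'n) set set \<Rightarrow> ('k::finite \<Rightarrow> int^'n) \<Rightarrow> 'k cox_poly \<Rightarrow> 'n::finite toric_point set" where
  "hypersurface \<Sigma> u f =
     {\<zeta> \<in> toric_variety \<Sigma>. \<exists>x \<in> cox_domain \<Sigma> u. cox_quotient \<Sigma> u x = \<zeta> \<and> poly_eval x f = 0}"

definition basepoint ::
    "(real^'n) set set \<Rightarrow> ('k::finite \<Rightarrow> int^'n) \<Rightarrow> (int^'k) set \<Rightarrow> 'n::finite toric_point \<Rightarrow> bool" where
  "basepoint \<Sigma> u \<alpha> \<zeta> \<longleftrightarrow> (\<forall>f \<in> graded_piece \<alpha>. \<zeta> \<in> hypersurface \<Sigma> u f)"


subsection \<open>The subscheme of a homogeneous ideal\<close>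

definition localization ::
    "('k::finite \<Rightarrow> int^'n) \<Rightarrow> (real^'n) set \<Rightarrow> 'k cox_poly set \<Rightarrow> 'k cox_laurent set" where
  "localization u \<sigma> I =
     {to_laurent f * Poly_Mapping.single (- int_vec (hat_exponent u \<sigma>)) 1 ^ l | f l. f \<in> I}"

definition chart_ideal ::
    "('k::finite \<Rightarrow> int^'n) \<Rightarrow> (real^'n) set \<Rightarrow> 'k cox_poly set \<Rightarrow> 'n::finite character_poly set" where
  "chart_ideal u \<sigma> I =
     dehom0 u ` {q \<in> localization u \<sigma> I. Poly_Mapping.keys q \<subseteq> divisor_class u 0}"

definition ideal_points ::
    "(real^'n) set set \<Rightarrow> ('k::finite \<Rightarrow> int^'n) \<Rightarrow> 'k cox_poly set \<Rightarrow> 'n::finite toric_point set" where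
  "ideal_points \<Sigma> u I =
     (\<Union>\<sigma>\<in>\<Sigma>. {\<zeta> \<in> affine_chart \<Sigma> \<sigma>. \<forall>p \<in> chart_ideal u \<sigma> I. ev \<sigma> \<zeta> p = 0})"

text \<open>The subscheme is nonempty and its coordinate rings on the affine charts have no chain of
  primes of positive length.\<close>

definition zero_dimensional ::
    "(real^'n) set set \<Rightarrow> ('k::finite \<Rightarrow> int^'n::finite) \<Rightarrow> 'k cox_poly set \<Rightarrow> bool" where
  "zero_dimensional \<Sigma> u I \<longleftrightarrow>
     (\<exists>\<sigma>\<in>\<Sigma>. chart_ideal u \<sigma> I \<noteq> carrier (coord_ring \<sigma>)) \<and>
     (\<forall>\<sigma>\<in>\<Sigma>. \<forall>P Q. primeideal P (coord_ring \<sigma>) \<and> primeideal Q (coord_ring \<sigma>) \<and>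
        chart_ideal u \<sigma> I \<subseteq> P \<and> P \<subseteq> Q \<longrightarrow> P = Q)"

text \<open>The local ring of the subscheme at \<open>\<zeta>\<close>, computed in the chart of \<open>\<sigma>\<close>: the localization of
  the quotient of \<open>coord_ring \<sigma>\<close> by \<open>chart_ideal u \<sigma> I\<close> at the maximal ideal of \<open>\<zeta>\<close>. Fractions
  are represented by pairs of elements of \<open>coord_ring \<sigma>\<close>.\<close>

definition fractions ::
    "(real^'n) set \<Rightarrow> 'n::finite toric_point \<Rightarrow> ('n character_poly \<times> 'n character_poly) set" where
  "fractions \<sigma> \<zeta> = {(p, s). p \<in> carrier (coord_ring \<sigma>) \<and> s \<in> carrier (coord_ring \<sigma>) \<and> ev \<sigma> \<zeta> s \<noteq> 0}"

definition fraction_rel ::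
    "('k::finite \<Rightarrow> int^'n) \<Rightarrow> 'k cox_poly set \<Rightarrow> (real^'n) set \<Rightarrow> 'n::finite toric_point \<Rightarrow>
     (('n character_poly \<times> 'n character_poly) \<times> ('n character_poly \<times> 'n character_poly)) set" where
  "fraction_rel u I \<sigma> \<zeta> =
     {((p, s), (q, t)). (p, s) \<in> fractions \<sigma> \<zeta> \<and> (q, t) \<in> fractions \<sigma> \<zeta> \<and>
        (\<exists>r \<in> carrier (coord_ring \<sigma>). ev \<sigma> \<zeta> r \<noteq> 0 \<and> r * (p * t - q * s) \<in> chart_ideal u \<sigma> I)}"

definition local_ring ::
    "('k::finite \<Rightarrow> int^'n) \<Rightarrow> 'k cox_poly set \<Rightarrow> (real^'n) set \<Rightarrow> 'n::finite toric_point \<Rightarrow>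
     (complex, ('n character_poly \<times> 'n character_poly) set) module" where
  "local_ring u I \<sigma> \<zeta> = (let R = fraction_rel u I \<sigma> \<zeta> in
     \<lparr>carrier = fractions \<sigma> \<zeta> // R,
      mult = (\<lambda>A B. \<Union>(p, s)\<in>A. \<Union>(q, t)\<in>B. R `` {(p * q, s * t)}),
      one = R `` {(1, 1)},
      zero = R `` {(0, 1)},
      add = (\<lambda>A B. \<Union>(p, s)\<in>A. \<Union>(q, t)\<in>B. R `` {(p * t + q * s, s * t)}),
      smult = (\<lambda>c A. \<Union>(p, s)\<in>A. R `` {(Poly_Mapping.single 0 c * p, s)})\<rparr>)"

text \<open>The chosen chart does not matter, and the local ring is finite-dimensional if the subscheme
  is zero-dimensional.\<close>

definition multiplicity_at ::
    "(real^'n) set set \<Rightarrow> ('k::finite \<Rightarrow> int^'n) \<Rightarrow> 'k cox_poly set \<Rightarrow> 'n::finite toric_point \<Rightarrow> nat" where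
  "multiplicity_at \<Sigma> u I \<zeta> =
     vectorspace.dim class_ring (local_ring u I (SOME \<sigma>. \<sigma> \<in> \<Sigma> \<and> \<zeta> \<in> affine_chart \<Sigma> \<sigma>) \<zeta>)"

definition scheme_degree ::
    "(real^'n::finite) set set \<Rightarrow> ('k::finite \<Rightarrow> int^'n) \<Rightarrow> 'k cox_poly set \<Rightarrow> nat" where
  "scheme_degree \<Sigma> u I = (\<Sum>\<zeta>\<in>ideal_points \<Sigma> u I. multiplicity_at \<Sigma> u I \<zeta>)"


subsection \<open>Regularity and multiplication maps\<close>

text \<open>The graded piece of the quotient of the Cox ring by \<open>I\<close>, as a complex vector space of cosets
  \<open>f + I\<^sub>\<alpha>\<close>; the ring multiplication of the record is meaningless.\<close>

definition graded_quotient ::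
    "'k::finite cox_poly set \<Rightarrow> (int^'k) set \<Rightarrow> (complex, 'k cox_poly set) module" where
  "graded_quotient I \<alpha> = (let W = I \<inter> graded_piece \<alpha> in
     \<lparr>carrier = (\<lambda>f. f +o W) ` graded_piece \<alpha>,
      mult = undefined,
      one = undefined,
      zero = W,
      add = (+),
      smult = (\<lambda>c A. \<Union>f\<in>A. (Poly_Mapping.single 0 c * f) +o W)\<rparr>)"

definition regularity ::
    "(real^'n::finite) set set \<Rightarrow> ('k::finite \<Rightarrow> int^'n) \<Rightarrow> 'k cox_poly set \<Rightarrow> (int^'k) set set" where
  "regularity \<Sigma> u I = {\<alpha> \<in> class_group u.
     vectorspace.fin_dim class_ring (graded_quotient I \<alpha>) \<and>
     vectorspace.dim class_ring (graded_quotient I \<alpha>) = scheme_degree \<Sigma> u I \<and>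
     I \<inter> graded_piece \<alpha> = saturation I (irrelevant_ideal \<Sigma> u) \<inter> graded_piece \<alpha> \<and>
     (\<forall>\<zeta> \<in> ideal_points \<Sigma> u I. \<not> basepoint \<Sigma> u \<alpha> \<zeta>)}"

definition regularity_pair ::
    "(real^'n::finite) set set \<Rightarrow> ('k::finite \<Rightarrow> int^'n) \<Rightarrow> 'k cox_poly set \<Rightarrow>
     (int^'k) set \<Rightarrow> (int^'k) set \<Rightarrow> bool" where
  "regularity_pair \<Sigma> u I \<alpha> \<alpha>\<^sub>0 \<longleftrightarrow>
     \<alpha> \<in> class_group u \<and> \<alpha>\<^sub>0 \<in> class_group u \<and>
     \<alpha> \<in> regularity \<Sigma> u I \<and> \<alpha> + \<alpha>\<^sub>0 \<in> regularity \<Sigma> u I \<and>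
     (\<forall>\<zeta> \<in> ideal_points \<Sigma> u I. \<not> basepoint \<Sigma> u \<alpha>\<^sub>0 \<zeta>)"

text \<open>Multiplication by \<open>g\<close> with values in degree \<open>\<beta>\<close>.\<close>

definition mult_map ::
    "'k::finite cox_poly set \<Rightarrow> (int^'k) set \<Rightarrow> 'k cox_poly \<Rightarrow> 'k cox_poly set \<Rightarrow> 'k cox_poly set" where
  "mult_map I \<beta> g A = (\<Union>f\<in>A. (f * g) +o (I \<inter> graded_piece \<beta>))"

text \<open>The determinant of an endomorphism of a finite-dimensional complex vector space, through its
  matrix in a basis; it does not depend on the basis.\<close>

definition coordinates :: "(complex, 'v) module \<Rightarrow> 'v set \<Rightarrow> 'v \<Rightarrow> 'v \<Rightarrow> complex" where
  "coordinates V B v = (THE a. a \<in> extensional B \<and> module.lincomb V a B = v)"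

definition endo_matrix :: "(complex, 'v) module \<Rightarrow> 'v list \<Rightarrow> ('v \<Rightarrow> 'v) \<Rightarrow> complex mat" where
  "endo_matrix V bs T =
     mat (length bs) (length bs) (\<lambda>(i, j). coordinates V (set bs) (T (bs ! j)) (bs ! i))"

definition endo_det :: "(complex, 'v) module \<Rightarrow> ('v \<Rightarrow> 'v) \<Rightarrow> complex" where
  "endo_det V T = Determinant.det
     (endo_matrix V (SOME bs. distinct bs \<and> vectorspace.basis class_ring V (set bs)) T)"


subsection \<open>Dehomogenization\<close>

text \<open>\<open>dehom_exponent u \<sigma> \<gamma> e\<close> states that \<open>e = F\<^sup>T m + a\<close> for a representative \<open>a\<close> of
  \<open>\<gamma>\<close> and some \<open>m\<close> with \<open>\<langle>u\<^sub>i, m\<rangle> + a\<^sub>i = 0\<close> on the rays of \<open>\<sigma>\<close>. On full-dimensional cones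
  there is at most one such \<open>e\<close>.\<close>

definition dehom_exponent ::
    "('k::finite \<Rightarrow> int^'n::finite) \<Rightarrow> (real^'n) set \<Rightarrow> (int^'k) set \<Rightarrow> int^'k \<Rightarrow> bool" where
  "dehom_exponent u \<sigma> \<gamma> e \<longleftrightarrow>
     (\<exists>a m. divisor_class u a = \<gamma> \<and> (\<forall>i \<in> cone_rays u \<sigma>. FT u m $ i + a $ i = 0) \<and> e = FT u m + a)"

definition dehom ::
    "('k::finite \<Rightarrow> int^'n) \<Rightarrow> (real^'n) set \<Rightarrow> (int^'k) set \<Rightarrow> 'k cox_poly \<Rightarrow>
     'n::finite character_poly" where
  "dehom u \<sigma> \<gamma> f =
     (if \<exists>e. dehom_exponent u \<sigma> \<gamma> e
      then dehom0 u (to_laurent f * Poly_Mapping.single (- (THE e. dehom_exponent u \<sigma> \<gamma> e)) 1)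
      else 0)"

text \<open>The data \<open>\<gamma>, g\<^sub>\<sigma>\<close> entering the map \<open>\<eta>\<close> on the chart of \<open>\<sigma>\<close>, for a given \<open>h\<close>
  in degree \<open>\<alpha>\<^sub>0\<close>.\<close>

definition eta_choice ::
    "('k::finite \<Rightarrow> int^'n::finite) \<Rightarrow> 'k cox_poly set \<Rightarrow> (int^'k) set \<Rightarrow> 'k cox_poly \<Rightarrow>
     (real^'n) set \<Rightarrow> (int^'k) set \<Rightarrow> 'k cox_poly \<Rightarrow> bool" where
  "eta_choice u I \<alpha>\<^sub>0 h \<sigma> \<gamma> g\<^sub>\<sigma> \<longleftrightarrow>
     \<gamma> \<in> class_group u \<and> g\<^sub>\<sigma> \<in> graded_piece (class_diff \<gamma> \<alpha>\<^sub>0) \<and>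
     dehom u \<sigma> \<gamma> (g\<^sub>\<sigma> * h) \<noteq> 0 \<and> dehom u \<sigma> \<gamma> (g\<^sub>\<sigma> * h) - 1 \<in> chart_ideal u \<sigma> I"

definition eta ::
    "('k::finite \<Rightarrow> int^'n) \<Rightarrow> (real^'n) set \<Rightarrow> (int^'k) set \<Rightarrow> 'k cox_poly \<Rightarrow> 'k cox_poly \<Rightarrow>
     'n::finite character_poly" where
  "eta u \<sigma> \<gamma> g\<^sub>\<sigma> f = dehom u \<sigma> \<gamma> (g\<^sub>\<sigma> * f)"

end

theory Submission
  imports Defs "Jordan_Normal_Form.Char_Poly" "HOL-Analysis.Kronecker_Approximation_Theorem"
begin

no_notation Matrix.vec_index (infixl "$" 100)

text \<open>Near a point \<open>\<zeta>\<close> of the subscheme some Laurent monomial \<open>x\<^sup>b\<close> of degree \<open>-\<beta>\<close> is a local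
  generator, provided \<open>\<zeta>\<close> is not a basepoint in degree \<open>\<beta>\<close>. Multiplication by these monomials sends
  \<open>S\<^sub>\<beta>\<close> to the product of the local rings of the subscheme. An element of the kernel lies in the
  saturation, because its conductor into the ideal has no zeros on any chart; hence in the regular
  degrees \<open>(S/I)\<^sub>\<beta>\<close> embeds into that product, and both have the same dimension. Under
  this identification \<open>M\<^sub>g \<circ> M\<^sub>h\<^sup>-\<^sup>1\<close> is multiplication by the germs of \<open>g/h\<close>, and on the local ring
  at \<open>\<zeta>\<close> this is the scalar \<open>g/h(\<zeta>)\<close> plus a nilpotent operator.

  A point is handled through one point \<open>x\<close> of its fibre under the Cox quotient map whose vanishing
  coordinates are exactly the rays of a cone: all evaluations on all charts then become
  evaluations of Laurent polynomials at \<open>x\<close>.\<close>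

section \<open>Monoid algebras\<close>

text \<open>The isomorphism onto the product of local rings is never built. It is present only
  through its coordinates, linear functionals on Cox polynomials that vanish on \<open>I\<close>. On
  each local ring they are the coordinates of a flag for the nilpotent part, so the endomorphism
  becomes block diagonal with triangular blocks. Equality of dimensions is used twice: it makes
  multiplication by \<open>h\<close> surjective, so that \<open>inv_into\<close> is a true inverse,
  and it makes the matrix that compares the functionals with a basis square.

  A point of the variety is given only by algebra homomorphisms on glued charts, and over a cone
  that is not simplicial its fibre is more than one orbit: elements of the fibre may vanish at only
  some rays of the smallest cone whose chart contains the point. Asking for exactly the rays of a
  cone selects elements that exist for every point, because a character of the lattice orthogonal to
  the cone extends to all exponent vectors, the group of nonzero complex numbers being divisible. It
  also shows in which charts the point lies.\<close>

abbreviation cst :: "complex \<Rightarrow> 'm::comm_monoid_add \<Rightarrow>\<^sub>0 complex" where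
  "cst \<equiv> Poly_Mapping.single 0"

abbreviation mon :: "'m \<Rightarrow> 'm \<Rightarrow>\<^sub>0 complex" where
  "mon e \<equiv> Poly_Mapping.single e 1"

lemma cst_mult [simp]: "cst a * cst b = cst (a * b)"
  by (simp add: mult_single)

lemma cst_add: "cst (a + b) = cst a + cst b"
  by (simp add: single_add)

lemma cst_diff: "cst (a - b) = cst a - cst b"
  by (simp add: single_diff)

lemma cst_mon: "cst c * mon e = Poly_Mapping.single e c"
  by (simp add: mult_single)

lemma mon_mult [simp]: "mon a * mon b = mon (a + b)"
  by (simp add: mult_single)

lemma sum_single_lookup: "(\<Sum>e\<in>Poly_Mapping.keys q. Poly_Mapping.single e (Poly_Mapping.lookup q e)) = q"
proof (rule poly_mapping_eqI)
  fix k
  have "Poly_Mapping.lookup (\<Sum>e\<in>Poly_Mapping.keys q. Poly_Mapping.single e (Poly_Mapping.lookup q e)) k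
     = (\<Sum>e\<in>Poly_Mapping.keys q. if e = k then Poly_Mapping.lookup q k else 0)"
    by (auto simp: lookup_sum lookup_single intro!: sum.cong simp: when_def)
  also have "\<dots> = Poly_Mapping.lookup q k"
    by (simp add: not_in_keys_iff_lookup_eq_zero)
  finally show "Poly_Mapping.lookup (\<Sum>e\<in>Poly_Mapping.keys q. Poly_Mapping.single e (Poly_Mapping.lookup q e)) k
     = Poly_Mapping.lookup q k" .
qed

text \<open>Linear extension of \<open>F\<close> from monomials, with coefficients carried along
  \<open>\<kappa>\<close>. With \<open>\<kappa>\<close> the identity this is evaluation at a point,
  with \<open>\<kappa> = cst\<close> a substitution into another monoid algebra;
  \<open>laurent_eval\<close>, \<open>poly_eval\<close>, \<open>cox_substitution\<close> and
  \<open>to_laurent\<close> are all of this form.\<close>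

definition lext :: "(complex \<Rightarrow> 'b::comm_ring_1) \<Rightarrow> ('m \<Rightarrow> 'b) \<Rightarrow> ('m \<Rightarrow>\<^sub>0 complex) \<Rightarrow> 'b" where
  "lext \<kappa> F q = (\<Sum>e\<in>Poly_Mapping.keys q. \<kappa> (Poly_Mapping.lookup q e) * F e)"

locale coeff_hom =
  fixes \<kappa> :: "complex \<Rightarrow> 'b::comm_ring_1"
  assumes add: "\<kappa> (a + b) = \<kappa> a + \<kappa> b" and mult: "\<kappa> (a * b) = \<kappa> a * \<kappa> b" and one: "\<kappa> 1 = 1"
begin

lemma zero: "\<kappa> 0 = 0"
  using add[of 0 0] by simp

lemma lext_superset:
  assumes "finite S" "Poly_Mapping.keys q \<subseteq> S"
  shows "lext \<kappa> F q = (\<Sum>e\<in>S. \<kappa> (Poly_Mapping.lookup q e) * F e)"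
  unfolding lext_def
  by (rule sum.mono_neutral_left) (use assms in \<open>auto simp: not_in_keys_iff_lookup_eq_zero zero\<close>)

lemma lext_add: "lext \<kappa> F (p + q) = lext \<kappa> F p + lext \<kappa> F q"
proof -
  let ?S = "Poly_Mapping.keys p \<union> Poly_Mapping.keys q"
  show ?thesis
    by (subst (1 2 3) lext_superset[of ?S])
      (auto simp: lookup_add add distrib_right sum.distrib dest: set_mp[OF keys_add])
qed

lemma lext_single [simp]: "lext \<kappa> F (Poly_Mapping.single e c) = \<kappa> c * F e"
  by (subst lext_superset[of "{e}"]) (auto split: if_splits)

lemma lext_zero [simp]: "lext \<kappa> F 0 = 0"
  by (simp add: lext_def)

lemma lext_sum: "lext \<kappa> F (sum f A) = (\<Sum>a\<in>A. lext \<kappa> F (f a))"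
  by (induction A rule: infinite_finite_induct) (auto simp: lext_add)

lemma lext_uminus: "lext \<kappa> F (- p) = - lext \<kappa> F p"
  using lext_add[of F p "- p"] by (simp add: eq_neg_iff_add_eq_0 add.commute)

lemma lext_diff: "lext \<kappa> F (p - q) = lext \<kappa> F p - lext \<kappa> F q"
  using lext_add[of F p "- q"] by (simp add: lext_uminus)

text \<open>Multiplicativity of \<open>F\<close> is asked only on exponents that occur in
  \<open>p\<close> and \<open>q\<close>: evaluation at a point with zero coordinates is
  multiplicative only on Laurent monomials whose exponents at those coordinates are
  nonnegative.\<close>

lemma lext_mult:
  fixes F :: "'m::comm_monoid_add \<Rightarrow> 'b"
  assumes F: "\<And>a b. a \<in> Poly_Mapping.keys p \<Longrightarrow> b \<in> Poly_Mapping.keys q \<Longrightarrow> F (a + b) = F a * F b"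
  shows "lext \<kappa> F (p * q) = lext \<kappa> F p * lext \<kappa> F q"
proof -
  let ?s = "\<lambda>p e. Poly_Mapping.single e (Poly_Mapping.lookup p e)"
  have "p * q = (\<Sum>a\<in>Poly_Mapping.keys p. ?s p a) * (\<Sum>b\<in>Poly_Mapping.keys q. ?s q b)"
    by (simp add: sum_single_lookup)
  also have "\<dots> = (\<Sum>a\<in>Poly_Mapping.keys p. \<Sum>b\<in>Poly_Mapping.keys q.
      Poly_Mapping.single (a + b) (Poly_Mapping.lookup p a * Poly_Mapping.lookup q b))"
    by (simp add: sum_product mult_single)
  finally have "lext \<kappa> F (p * q) = (\<Sum>a\<in>Poly_Mapping.keys p. \<Sum>b\<in>Poly_Mapping.keys q.
      \<kappa> (Poly_Mapping.lookup p a * Poly_Mapping.lookup q b) * F (a + b))"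
    by (simp add: lext_sum)
  also have "\<dots> = (\<Sum>a\<in>Poly_Mapping.keys p. \<Sum>b\<in>Poly_Mapping.keys q.
      (\<kappa> (Poly_Mapping.lookup p a) * F a) * (\<kappa> (Poly_Mapping.lookup q b) * F b))"
    by (intro sum.cong refl) (simp add: F mult mult_ac)
  finally show ?thesis
    by (simp add: lext_def sum_product)
qed

end

interpretation cid: coeff_hom "\<lambda>c::complex. c" by standard auto
interpretation ccst: coeff_hom "cst :: complex \<Rightarrow> 'm::comm_monoid_add \<Rightarrow>\<^sub>0 complex"
  by standard (auto simp: cst_add)

interpretation pm: vector_space "\<lambda>c (p :: 'm::comm_monoid_add \<Rightarrow>\<^sub>0 complex). cst c * p"
  by standard (simp_all add: cst_add distrib_left distrib_right mult.assoc[symmetric])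

lemma pm_span_mon:
  assumes "Poly_Mapping.keys p \<subseteq> S"
  shows "p \<in> pm.span (mon ` S)"
proof -
  have "(\<Sum>e\<in>Poly_Mapping.keys p. cst (Poly_Mapping.lookup p e) * mon e) \<in> pm.span (mon ` S)"
    using assms by (intro pm.span_sum pm.span_scale pm.span_base) auto
  then show ?thesis by (simp add: cst_mon sum_single_lookup)
qed

section \<open>Points of a monoid algebra\<close>

text \<open>A subset of the full monoid algebra instead of a ring of its own: the coordinate rings
  of all charts then lie in one algebra, and passing between charts is restriction of
  functions.\<close>

definition monalg :: "'m set \<Rightarrow> ('m::comm_monoid_add \<Rightarrow>\<^sub>0 complex) set" where
  "monalg D = {p. Poly_Mapping.keys p \<subseteq> D}"

definition submonoid_of :: "'m::comm_monoid_add set \<Rightarrow> bool" where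
  "submonoid_of D \<longleftrightarrow> 0 \<in> D \<and> (\<forall>a\<in>D. \<forall>b\<in>D. a + b \<in> D)"

definition ideal_of :: "'a::comm_ring_1 set \<Rightarrow> 'a set \<Rightarrow> bool" where
  "ideal_of R J \<longleftrightarrow> J \<subseteq> R \<and> 0 \<in> J \<and> (\<forall>a\<in>J. \<forall>b\<in>J. a + b \<in> J) \<and> (\<forall>r\<in>R. \<forall>a\<in>J. r * a \<in> J)"

definition alg_point :: "('m::comm_monoid_add \<Rightarrow>\<^sub>0 complex) set \<Rightarrow> (('m \<Rightarrow>\<^sub>0 complex) \<Rightarrow> complex) \<Rightarrow> bool" where
  "alg_point R \<phi> \<longleftrightarrow> (\<forall>a\<in>R. \<forall>b\<in>R. \<phi> (a + b) = \<phi> a + \<phi> b \<and> \<phi> (a * b) = \<phi> a * \<phi> b) \<and> (\<forall>c. \<phi> (cst c) = c)"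

lemma monalg_cst: "submonoid_of D \<Longrightarrow> cst c \<in> monalg D"
  by (auto simp: monalg_def submonoid_of_def)

lemma monalg_0 [simp]: "0 \<in> monalg D"
  by (auto simp: monalg_def)

lemma monalg_1: "submonoid_of D \<Longrightarrow> 1 \<in> monalg D"
  by (auto simp: monalg_def submonoid_of_def)

lemma monalg_mon [simp]: "mon m \<in> monalg D \<longleftrightarrow> m \<in> D"
  by (auto simp: monalg_def)

lemma monalg_add: "p \<in> monalg D \<Longrightarrow> q \<in> monalg D \<Longrightarrow> p + q \<in> monalg D"
  unfolding monalg_def using keys_add[of p q] by auto

lemma monalg_uminus: "p \<in> monalg D \<Longrightarrow> - p \<in> monalg D"
  unfolding monalg_def by (simp add: keys_minus)

lemma monalg_diff: "p \<in> monalg D \<Longrightarrow> q \<in> monalg D \<Longrightarrow> p - q \<in> monalg D"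
  using monalg_add[of p D "- q"] monalg_uminus[of q D] by simp

lemma monalg_mult: "submonoid_of D \<Longrightarrow> p \<in> monalg D \<Longrightarrow> q \<in> monalg D \<Longrightarrow> p * q \<in> monalg D"
  unfolding monalg_def submonoid_of_def using keys_mult[of p q] by blast

lemma monalg_power: "submonoid_of D \<Longrightarrow> p \<in> monalg D \<Longrightarrow> p ^ n \<in> monalg D"
  by (induction n) (auto simp: monalg_1 monalg_mult)

lemma monalg_sum: "(\<And>a. a \<in> A \<Longrightarrow> f a \<in> monalg D) \<Longrightarrow> sum f A \<in> monalg D"
  by (induction A rule: infinite_finite_induct) (auto simp: monalg_add)

lemma monalg_prod: "submonoid_of D \<Longrightarrow> (\<And>a. a \<in> A \<Longrightarrow> f a \<in> monalg D) \<Longrightarrow> prod f A \<in> monalg D"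
  by (induction A rule: infinite_finite_induct) (auto simp: monalg_mult monalg_1)

lemma monalg_span: "p \<in> monalg D \<longleftrightarrow> p \<in> pm.span (mon ` D)"
proof
  have "pm.subspace (monalg D)"
    unfolding pm.subspace_def
    by (auto simp: monalg_add) (auto simp: monalg_def dest!: set_mp[OF keys_mult] split: if_splits)
  then have "pm.span (mon ` D) \<subseteq> monalg D"
    by (intro pm.span_minimal) auto
  then show "p \<in> pm.span (mon ` D) \<Longrightarrow> p \<in> monalg D" by blast
qed (auto simp: monalg_def intro: pm_span_mon)

lemma ideal_ofD:
  assumes "ideal_of R J"
  shows "J \<subseteq> R" "0 \<in> J" "a \<in> J \<Longrightarrow> b \<in> J \<Longrightarrow> a + b \<in> J" "r \<in> R \<Longrightarrow> a \<in> J \<Longrightarrow> r * a \<in> J"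
    "r \<in> R \<Longrightarrow> a \<in> J \<Longrightarrow> a * r \<in> J"
  using assms by (auto simp: ideal_of_def mult.commute)

lemma ideal_of_uminus:
  assumes "submonoid_of D" "ideal_of (monalg D) J" "a \<in> J"
  shows "- a \<in> J"
  using ideal_ofD(4)[OF assms(2) monalg_uminus[OF monalg_1[OF assms(1)]] assms(3)] by simp

lemma ideal_of_diff:
  assumes "submonoid_of D" "ideal_of (monalg D) J" "a \<in> J" "b \<in> J"
  shows "a - b \<in> J"
  using ideal_ofD(3)[OF assms(2,3) ideal_of_uminus[OF assms(1,2,4)]] by simp

lemma ideal_of_sum: "ideal_of R J \<Longrightarrow> (\<And>a. a \<in> A \<Longrightarrow> f a \<in> J) \<Longrightarrow> sum f A \<in> J"
  by (induction A rule: infinite_finite_induct) (auto simp: ideal_ofD)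

lemma ideal_of_subspace: "submonoid_of D \<Longrightarrow> ideal_of (monalg D) J \<Longrightarrow> pm.subspace J"
  by (auto simp: pm.subspace_def ideal_ofD monalg_cst)

text \<open>Zorn's lemma: the union of a chain avoids every power of \<open>p\<close>, since a
  single power in it would already lie in a member. As \<open>p ^ 0\<close> counts among the powers,
  the ideal obtained is proper.\<close>

lemma ex_maximal_avoiding_powers:
  assumes "ideal_of R J" "\<And>n. p ^ n \<notin> J"
  obtains P where "ideal_of R P" "J \<subseteq> P" "\<And>n. p ^ n \<notin> P"
    "\<And>Q. ideal_of R Q \<Longrightarrow> P \<subseteq> Q \<Longrightarrow> P \<noteq> Q \<Longrightarrow> \<exists>n. p ^ n \<in> Q"
proof -
  define \<A> where "\<A> = {Q. ideal_of R Q \<and> J \<subseteq> Q \<and> (\<forall>n. p ^ n \<notin> Q)}"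
  have "\<exists>P\<in>\<A>. \<forall>Q\<in>\<A>. P \<subseteq> Q \<longrightarrow> Q = P"
  proof (rule subset_Zorn_nonempty)
    show "\<A> \<noteq> {}" using assms by (auto simp: \<A>_def)
  next
    fix \<C> assume ne: "\<C> \<noteq> {}" and ch: "subset.chain \<A> \<C>"
    then have sub: "\<C> \<subseteq> \<A>" by (simp add: subset.chain_def)
    have dir: "\<exists>Q\<in>\<C>. a \<in> Q \<and> b \<in> Q" if "a \<in> \<Union>\<C>" "b \<in> \<Union>\<C>" for a b
      using that ch unfolding subset_chain_def by blast
    have "ideal_of R (\<Union>\<C>)"
      unfolding ideal_of_def
    proof (intro conjI ballI)
      show "\<Union>\<C> \<subseteq> R" "0 \<in> \<Union>\<C>"
        using sub ne by (auto simp: \<A>_def ideal_of_def)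
      show "a + b \<in> \<Union>\<C>" if ab: "a \<in> \<Union>\<C>" "b \<in> \<Union>\<C>" for a b
      proof -
        obtain Q where "Q \<in> \<C>" "a \<in> Q" "b \<in> Q" using dir[OF ab] by blast
        then show ?thesis using sub by (intro UnionI[of Q]) (auto simp: \<A>_def ideal_of_def)
      qed
      show "r * a \<in> \<Union>\<C>" if ra: "r \<in> R" "a \<in> \<Union>\<C>" for r a
      proof -
        obtain Q where "Q \<in> \<C>" "a \<in> Q" using ra by blast
        then show ?thesis using sub ra by (intro UnionI[of Q]) (auto simp: \<A>_def ideal_of_def)
      qed
    qed
    then show "\<Union>\<C> \<in> \<A>"
      using sub ne by (auto simp: \<A>_def)
  qed
  then obtain P where P: "P \<in> \<A>" "\<And>Q. Q \<in> \<A> \<Longrightarrow> P \<subseteq> Q \<Longrightarrow> Q = P" by blast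
  show ?thesis
  proof
    show "ideal_of R P" "J \<subseteq> P" "\<And>n. p ^ n \<notin> P" using P(1) by (auto simp: \<A>_def)
    show "\<exists>n. p ^ n \<in> Q" if "ideal_of R Q" "P \<subseteq> Q" "P \<noteq> Q" for Q
      using P(2)[of Q] P(1) that by (auto simp: \<A>_def)
  qed
qed

lemma ideal_of_extend:
  assumes D: "submonoid_of D" and P: "ideal_of (monalg D) P" and a: "a \<in> monalg D"
  shows "ideal_of (monalg D) {x + r * a |x r. x \<in> P \<and> r \<in> monalg D}" (is "ideal_of _ ?Q")
    "P \<subseteq> {x + r * a |x r. x \<in> P \<and> r \<in> monalg D}" "a \<in> {x + r * a |x r. x \<in> P \<and> r \<in> monalg D}"
proof -
  show PQ: "P \<subseteq> ?Q" by (force intro: exI[of _ 0])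
  show "a \<in> ?Q" using ideal_ofD(2)[OF P] monalg_1[OF D] by (force intro: exI[of _ 0] exI[of _ 1])
  show "ideal_of (monalg D) ?Q"
    unfolding ideal_of_def
  proof (intro conjI ballI)
    show "?Q \<subseteq> monalg D" using ideal_ofD(1)[OF P] a D by (auto intro!: monalg_add monalg_mult)
    show "0 \<in> ?Q" using PQ ideal_ofD(2)[OF P] by blast
    show "y + z \<in> ?Q" if yz: "y \<in> ?Q" "z \<in> ?Q" for y z
    proof -
      obtain x r x' r' where "y = x + r * a" "z = x' + r' * a" "x \<in> P" "x' \<in> P" "r \<in> monalg D" "r' \<in> monalg D"
        using yz by blast
      then show ?thesis
        by (intro CollectI exI[of _ "x + x'"] exI[of _ "r + r'"])
          (auto simp: algebra_simps ideal_ofD[OF P] monalg_add)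
    qed
    show "s * y \<in> ?Q" if s: "s \<in> monalg D" and y: "y \<in> ?Q" for s y
    proof -
      obtain x r where "y = x + r * a" "x \<in> P" "r \<in> monalg D" using y by blast
      then show ?thesis using s
        by (intro CollectI exI[of _ "s * x"] exI[of _ "s * r"])
          (auto simp: algebra_simps ideal_ofD[OF P] monalg_mult D)
    qed
  qed
qed

section \<open>Complex polynomials evaluated at elements of a monoid algebra\<close>

definition ppoly :: "complex poly \<Rightarrow> ('m::comm_monoid_add \<Rightarrow>\<^sub>0 complex) \<Rightarrow> 'm \<Rightarrow>\<^sub>0 complex" where
  "ppoly Q y = poly (map_poly cst Q) y"

interpretation cst_hom: comm_ring_hom "cst :: complex \<Rightarrow> 'm::comm_monoid_add \<Rightarrow>\<^sub>0 complex"
  by standard (auto simp: cst_add)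

interpretation cst_poly: map_poly_comm_ring_hom "cst :: complex \<Rightarrow> 'm::comm_monoid_add \<Rightarrow>\<^sub>0 complex" ..

lemma ppoly_pCons [simp]: "ppoly (pCons c P) y = cst c + y * ppoly P y"
  unfolding ppoly_def cst_hom.map_poly_pCons_hom by simp

lemma ppoly_0 [simp]: "ppoly 0 y = 0"
  unfolding ppoly_def by simp

lemma ppoly_add [simp]: "ppoly (P + Q) y = ppoly P y + ppoly Q y"
  unfolding ppoly_def cst_poly.hom_add by simp

lemma ppoly_mult [simp]: "ppoly (P * Q) y = ppoly P y * ppoly Q y"
  unfolding ppoly_def cst_poly.hom_mult by simp

lemma ppoly_smult [simp]: "ppoly (Polynomial.smult c P) y = cst c * ppoly P y"
  unfolding ppoly_def cst_hom.map_poly_hom_smult by simp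

lemma ppoly_1 [simp]: "ppoly 1 y = 1"
  unfolding ppoly_def by simp

lemma ppoly_sum: "ppoly (sum f A) y = (\<Sum>a\<in>A. ppoly (f a) y)"
  by (induction A rule: infinite_finite_induct) auto

lemma ppoly_prod: "ppoly (prod f A) y = (\<Prod>a\<in>A. ppoly (f a) y)"
  by (induction A rule: infinite_finite_induct) auto

lemma ppoly_in_monalg:
  assumes "submonoid_of D" "y \<in> monalg D"
  shows "ppoly Q y \<in> monalg D"
  using assms by (induction Q rule: pCons_induct) (simp_all add: monalg_add monalg_mult monalg_cst)

text \<open>The algebra has countable dimension while the ground field is uncountable, so a residue field
  cannot contain a transcendental element. Considering ideals that avoid the powers of \<open>p\<close> makes
  Rabinowitsch's trick unnecessary.\<close>

lemma ex_scalar_mod_maximal: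
  fixes P :: "('m::{comm_monoid_add,countable} \<Rightarrow>\<^sub>0 complex) set"
  assumes D: "submonoid_of D" and P: "ideal_of (monalg D) P" and p: "p \<in> monalg D"
    and avoid: "\<And>n. p ^ n \<notin> P"
    and maxi: "\<And>Q. ideal_of (monalg D) Q \<Longrightarrow> P \<subseteq> Q \<Longrightarrow> P \<noteq> Q \<Longrightarrow> \<exists>n. p ^ n \<in> Q"
    and prime: "\<And>a b. a \<in> monalg D \<Longrightarrow> b \<in> monalg D \<Longrightarrow> a * b \<in> P \<Longrightarrow> a \<in> P \<or> b \<in> P"
    and y: "y \<in> monalg D"
  shows "\<exists>c. y - cst c \<in> P"
proof (rule ccontr)
  assume no: "\<nexists>c. y - cst c \<in> P"
  let ?R = "monalg D"
  note R = monalg_add monalg_mult[OF D] monalg_diff monalg_cst[OF D] monalg_1[OF D] p y monalg_power[OF D]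
  have pP: "p \<notin> P" using avoid[of 1] by simp
  \<comment> \<open>Modulo \<open>P\<close> every \<open>y - cst c\<close> divides a power of
    \<open>p\<close>: it lies outside \<open>P\<close>, so adjoining it to \<open>P\<close> must
    bring in such a power.\<close>
  have "\<exists>n q. q \<in> ?R \<and> q * (y - cst c) - p ^ n \<in> P" for c
  proof -
    have yc: "y - cst c \<in> ?R" by (intro R)
    note ext = ideal_of_extend[OF D P yc]
    then obtain n where "p ^ n \<in> {x + r * (y - cst c) |x r. x \<in> P \<and> r \<in> ?R}"
      using maxi[OF ext(1,2)] no by blast
    then obtain x r where "p ^ n = x + r * (y - cst c)" "x \<in> P" "r \<in> ?R" by blast
    then show ?thesis
      using ideal_of_uminus[OF D P, of x] by (intro exI[of _ n] exI[of _ r]) auto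
  qed
  then obtain N q where q: "\<And>c. q c \<in> ?R" "\<And>c. q c * (y - cst c) - p ^ N c \<in> P"
    by metis
  \<comment> \<open>There are only countably many pairs of an exponent and a finite support, but
    uncountably many \<open>c\<close>; hence infinitely many \<open>c\<close> share both.\<close>
  define T where "T c = (N c, Poly_Mapping.keys (q c))" for c
  have "countable (range T)"
  proof (rule countable_subset)
    show "range T \<subseteq> UNIV \<times> Collect finite" by (auto simp: T_def)
    show "countable ((UNIV :: nat set) \<times> (Collect finite :: 'm set set))"
      by (intro countable_SIGMA) (auto intro: countable_Collect_finite)
  qed
  have "\<exists>z. infinite (T -` {z})"
  proof (rule ccontr)
    assume "\<not> ?thesis"
    then have "countable (\<Union>z\<in>range T. T -` {z})"
      using \<open>countable (range T)\<close> by (intro countable_UN) (auto intro: countable_finite)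
    moreover have "(\<Union>z\<in>range T. T -` {z}) = UNIV" by auto
    ultimately show False using uncountable_UNIV_complex by simp
  qed
  then obtain n K where inf: "infinite (T -` {(n, K)})" by (metis surj_pair)
  have TD: "N c = n" "Poly_Mapping.keys (q c) = K" if "c \<in> T -` {(n, K)}" for c
    using that by (auto simp: T_def)
  have "finite K" using TD(2) inf finite_keys by (metis finite.emptyI ex_in_conv)
  \<comment> \<open>One index more than the common support \<open>K\<close> has elements: the
    \<open>q c\<close> lie in the span of \<open>card K\<close> monomials, so they are linearly
    dependent.\<close>
  obtain F where F: "F \<subseteq> T -` {(n, K)}" "finite F" "card F = Suc (card K)"
    using infinite_arbitrarily_large[OF inf] by blast
  have qn: "q c * (y - cst c) - p ^ n \<in> P" if "c \<in> F" for c
    using q(2)[of c] TD(1)[of c] F(1) that by auto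
  have inj: "inj_on q F"
  proof (rule inj_onI, rule ccontr)
    fix c d assume cd: "c \<in> F" "d \<in> F" "q c = q d" "c \<noteq> d"
    have "(q c * (y - cst c) - p ^ n) - (q d * (y - cst d) - p ^ n) \<in> P"
      using ideal_of_diff[OF D P qn[OF cd(1)] qn[OF cd(2)]] .
    then have "cst (d - c) * q c \<in> P"
      using cd(3) by (simp add: algebra_simps cst_diff)
    then have "cst (inverse (d - c)) * (cst (d - c) * q c) \<in> P"
      by (rule ideal_ofD(4)[OF P monalg_cst[OF D]])
    moreover have "cst (inverse (d - c)) * (cst (d - c) * q c) = q c"
      using cd(4) by (simp only: mult.assoc[symmetric] cst_mult) simp
    ultimately have "q c \<in> P" by simp
    then have "q c * (y - cst c) \<in> P"
      by (rule ideal_ofD(5)[OF P monalg_diff[OF y monalg_cst[OF D]]])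
    from ideal_of_diff[OF D P this qn[OF cd(1)]] show False using avoid[of n] by simp
  qed
  have "pm.dependent (q ` F)"
  proof (rule ccontr)
    assume "pm.independent (q ` F)"
    moreover have "q ` F \<subseteq> pm.span (mon ` K)"
      using F(1) TD(2) by (auto intro!: pm_span_mon)
    ultimately have "card (q ` F) \<le> card (mon ` K :: ('m \<Rightarrow>\<^sub>0 complex) set)"
      using pm.independent_span_bound[of "mon ` K" "q ` F"] \<open>finite K\<close> by simp
    also have "\<dots> \<le> card K" by (rule card_image_le[OF \<open>finite K\<close>])
    finally show False using F(3) card_image[OF inj] by simp
  qed
  then obtain w v where w: "v \<in> q ` F" "w v \<noteq> 0" "(\<Sum>v\<in>q ` F. cst (w v) * v) = 0"
    using pm.dependent_finite[of "q ` F"] F(2) by auto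
  define l where "l c = w (q c)" for c
  have l0: "(\<Sum>c\<in>F. cst (l c) * q c) = 0"
    using w(3) by (simp add: sum.reindex[OF inj] l_def)
  obtain c0 where c0: "c0 \<in> F" "l c0 \<noteq> 0" using w(1,2) by (auto simp: l_def)
  \<comment> \<open>Modulo \<open>P\<close>, \<open>q c\<close> is \<open>p ^ n / (y - c)\<close>,
    so the linear relation says that the sum of the \<open>l c / (y - c)\<close> is killed by
    \<open>p ^ n\<close>. \<open>Q\<close> is the numerator of that sum; its value at
    \<open>c0\<close> shows that it is not the zero polynomial.\<close>
  define Q where "Q = (\<Sum>c\<in>F. Polynomial.smult (l c) (\<Prod>d\<in>F - {c}. [:-d, 1:]))"
  have "poly Q c0 = l c0 * (\<Prod>d\<in>F - {c0}. c0 - d)"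
  proof -
    have "poly Q c0 = (\<Sum>c\<in>F. l c * (\<Prod>d\<in>F - {c}. c0 - d))"
      by (simp add: Q_def poly_sum poly_prod)
    also have "\<dots> = (\<Sum>c\<in>F. if c = c0 then l c0 * (\<Prod>d\<in>F - {c0}. c0 - d) else 0)"
      using F(2) c0(1) by (intro sum.cong refl) (auto intro!: prod_zero bexI[of _ c0])
    finally show ?thesis using F(2) c0(1) by simp
  qed
  then have Q0: "Q \<noteq> 0" using c0(2) F(2) by (auto simp: prod_zero_iff)
  have pr: "(\<Prod>d\<in>F - {c}. y - cst d) \<in> ?R" for c
    by (intro monalg_prod[OF D] R)
  have "p ^ n * ppoly Q y \<in> P"
  proof -
    have Qy: "ppoly Q y = (\<Sum>c\<in>F. cst (l c) * (\<Prod>d\<in>F - {c}. y - cst d))"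
      by (simp add: Q_def ppoly_sum ppoly_prod single_uminus)
    have "(\<Sum>c\<in>F. cst (l c) * (\<Prod>d\<in>F - {c}. y - cst d) * (q c * (y - cst c) - p ^ n)) \<in> P"
    proof (rule ideal_of_sum[OF P])
      fix c assume "c \<in> F"
      then show "cst (l c) * (\<Prod>d\<in>F - {c}. y - cst d) * (q c * (y - cst c) - p ^ n) \<in> P"
        by (intro ideal_ofD(4)[OF P] R pr qn)
    qed
    also have "(\<Sum>c\<in>F. cst (l c) * (\<Prod>d\<in>F - {c}. y - cst d) * (q c * (y - cst c) - p ^ n))
       = (\<Sum>c\<in>F. (cst (l c) * q c) * (\<Prod>d\<in>F. y - cst d) - p ^ n * (cst (l c) * (\<Prod>d\<in>F - {c}. y - cst d)))"
      using F(2) by (intro sum.cong refl) (auto simp: prod.remove algebra_simps)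
    also have "\<dots> = - (p ^ n * ppoly Q y)"
      by (simp add: Qy sum_subtractf l0 flip: sum_distrib_right sum_distrib_left)
    finally have "- (- (p ^ n * ppoly Q y)) \<in> P" by (rule ideal_of_uminus[OF D P])
    then show ?thesis by simp
  qed
  then have "ppoly Q y \<in> P"
    using prime[OF monalg_power[OF D p] ppoly_in_monalg[OF D y]] avoid[of n] by blast
  \<comment> \<open>\<open>Q\<close> splits into linear factors over the complex numbers,
    \<open>P\<close> is prime, and no \<open>y - cst z\<close> lies in \<open>P\<close>. Stripping
    the factors one by one would leave a nonzero constant in \<open>P\<close>.\<close>
  with Q0 show False
  proof (induction "degree Q" arbitrary: Q rule: less_induct)
    case less
    show False
    proof (cases "degree Q = 0")
      case True
      then obtain c where c: "Q = [:c:]" using degree_eq_zeroE by blast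
      have "cst (inverse c) * ppoly Q y \<in> P"
        using less.prems(2) by (rule ideal_ofD(4)[OF P monalg_cst[OF D]])
      moreover have "c \<noteq> 0" using less.prems(1) c by simp
      ultimately have "1 \<in> P" by (simp add: c)
      then show False using avoid[of 0] by simp
    next
      case False
      then obtain z where "poly Q z = 0"
        using fundamental_theorem_of_algebra[of Q] constant_degree[of Q] by metis
      then obtain Q' where Q': "Q = [:-z, 1:] * Q'" using poly_eq_0_iff_dvd by blast
      then have "Q' \<noteq> 0" using less.prems(1) by (intro notI) simp
      then have "degree Q' < degree Q"
        unfolding Q' by (subst degree_mult_eq) simp_all
      have "ppoly Q y = (y - cst z) * ppoly Q' y"
        unfolding Q' ppoly_mult by (simp add: single_uminus)
      then have "(y - cst z) * ppoly Q' y \<in> P"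
        using less.prems(2) by simp
      then have "ppoly Q' y \<in> P"
        using prime[OF monalg_diff[OF y monalg_cst[OF D]] ppoly_in_monalg[OF D y]] no by blast
      then show False using less.hyps[of Q'] \<open>Q' \<noteq> 0\<close> \<open>degree Q' < degree Q\<close> by blast
    qed
  qed
qed

text \<open>An ideal that is maximal among those containing \<open>J\<close> and avoiding the powers
  of \<open>p\<close> is prime: for two elements outside it, the enlarged ideals contain powers of
  \<open>p\<close>, and the product of these powers would fall into the ideal as soon as the product
  of the elements does. All residues are then scalars, and \<open>\<phi>\<close> is the residue
  map.\<close>

theorem nullstellensatz:
  fixes J :: "('m::{comm_monoid_add,countable} \<Rightarrow>\<^sub>0 complex) set"
  assumes D: "submonoid_of D" and J: "ideal_of (monalg D) J" and p: "p \<in> monalg D"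
    and avoidJ: "\<And>n. p ^ n \<notin> J"
  obtains \<phi> where "alg_point (monalg D) \<phi>" "\<And>a. a \<in> J \<Longrightarrow> \<phi> a = 0" "\<phi> p \<noteq> 0"
proof -
  obtain P where P: "ideal_of (monalg D) P" and JP: "J \<subseteq> P" and avoid: "\<And>n. p ^ n \<notin> P"
    and maxi: "\<And>Q. ideal_of (monalg D) Q \<Longrightarrow> P \<subseteq> Q \<Longrightarrow> P \<noteq> Q \<Longrightarrow> \<exists>n. p ^ n \<in> Q"
    using ex_maximal_avoiding_powers[OF J avoidJ] by metis
  have prime: "a \<in> P \<or> b \<in> P" if a: "a \<in> monalg D" and b: "b \<in> monalg D" and ab: "a * b \<in> P" for a b
  proof (rule ccontr)
    assume "\<not> ?thesis"
    then have nP: "a \<notin> P" "b \<notin> P" by auto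
    obtain m x r where 1: "p ^ m = x + r * a" "x \<in> P" "r \<in> monalg D"
      using maxi[OF ideal_of_extend(1,2)[OF D P a]] ideal_of_extend(3)[OF D P a] nP(1) by blast
    obtain k x' r' where 2: "p ^ k = x' + r' * b" "x' \<in> P" "r' \<in> monalg D"
      using maxi[OF ideal_of_extend(1,2)[OF D P b]] ideal_of_extend(3)[OF D P b] nP(2) by blast
    have "p ^ (m + k) = p ^ k * x + (r * a) * x' + (r * r') * (a * b)"
      by (simp add: power_add 1(1) 2(1) algebra_simps)
    also have "\<dots> \<in> P"
      by (intro ideal_ofD(3)[OF P] ideal_ofD(4)[OF P] monalg_mult[OF D] monalg_power[OF D] a b p ab 1(2,3) 2(2,3))
    finally show False using avoid by blast
  qed
  have scal: "\<exists>c. y - cst c \<in> P" if "y \<in> monalg D" for y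
    by (rule ex_scalar_mod_maximal[OF D P p avoid]) (use maxi prime that in blast)+
  have uniq: "c = d" if "a - cst c \<in> P" "a - cst d \<in> P" for a c d
  proof (rule ccontr)
    assume "c \<noteq> d"
    have "cst (d - c) \<in> P" using ideal_of_diff[OF D P that] by (simp add: cst_diff)
    then have "cst (inverse (d - c)) * cst (d - c) \<in> P" by (intro ideal_ofD(4)[OF P] monalg_cst[OF D])
    then show False using \<open>c \<noteq> d\<close> avoid[of 0] by simp
  qed
  define \<phi> where "\<phi> a = (THE c. a - cst c \<in> P)" for a
  have \<phi>I: "\<phi> a = c" if "a - cst c \<in> P" for a c
    unfolding \<phi>_def using that uniq by blast
  have \<phi>: "a - cst (\<phi> a) \<in> P" if "a \<in> monalg D" for a
    using scal[OF that] \<phi>I by blast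
  show ?thesis
  proof
    show "alg_point (monalg D) \<phi>"
      unfolding alg_point_def
    proof (intro conjI ballI allI)
      show "\<phi> (cst c) = c" for c by (rule \<phi>I) (simp add: ideal_ofD[OF P])
      fix a b assume ab: "a \<in> monalg D" "b \<in> monalg D"
      show "\<phi> (a + b) = \<phi> a + \<phi> b"
        using ideal_ofD(3)[OF P \<phi>[OF ab(1)] \<phi>[OF ab(2)]] by (intro \<phi>I) (simp add: cst_add algebra_simps)
      have "b * (a - cst (\<phi> a)) + cst (\<phi> a) * (b - cst (\<phi> b)) \<in> P"
        using \<phi>[OF ab(1)] \<phi>[OF ab(2)] ab
        by (intro ideal_ofD(3)[OF P] ideal_ofD(4)[OF P] monalg_cst[OF D])
      then show "\<phi> (a * b) = \<phi> a * \<phi> b"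
        by (intro \<phi>I) (simp add: algebra_simps)
    qed
    show "\<phi> a = 0" if "a \<in> J" for a
      using that JP by (intro \<phi>I) auto
    show "\<phi> p \<noteq> 0"
      using \<phi>[OF p] avoid[of 1] by auto
  qed
qed

section \<open>Quotient spaces\<close>

text \<open>Families indexed by numbers instead of sets, so that two members in the same class
  modulo \<open>K\<close> count as dependent.\<close>

definition indep_mod :: "('m::comm_monoid_add \<Rightarrow>\<^sub>0 complex) set \<Rightarrow> (nat \<Rightarrow> 'm \<Rightarrow>\<^sub>0 complex) \<Rightarrow> nat \<Rightarrow> bool" where
  "indep_mod K f d \<longleftrightarrow> (\<forall>c. (\<Sum>i<d. cst (c i) * f i) \<in> K \<longrightarrow> (\<forall>i<d. c i = 0))"

definition spans_mod :: "('m::comm_monoid_add \<Rightarrow>\<^sub>0 complex) set \<Rightarrow> ('m \<Rightarrow>\<^sub>0 complex) set \<Rightarrow> (nat \<Rightarrow> 'm \<Rightarrow>\<^sub>0 complex) \<Rightarrow> nat \<Rightarrow> bool" where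
  "spans_mod X K f d \<longleftrightarrow> (\<forall>x\<in>X. \<exists>c. x - (\<Sum>i<d. cst (c i) * f i) \<in> K)"

text \<open>A linear functional on the quotient of \<open>X\<close> by \<open>K\<close>, given on
  representatives; its values off \<open>X\<close> are left open.\<close>

definition linear_mod :: "('m::comm_monoid_add \<Rightarrow>\<^sub>0 complex) set \<Rightarrow> ('m \<Rightarrow>\<^sub>0 complex) set \<Rightarrow> (('m \<Rightarrow>\<^sub>0 complex) \<Rightarrow> complex) \<Rightarrow> bool" where
  "linear_mod X K l \<longleftrightarrow> (\<forall>x\<in>X. \<forall>y\<in>X. l (x + y) = l x + l y) \<and> (\<forall>c. \<forall>x\<in>X. l (cst c * x) = c * l x) \<and> (\<forall>x\<in>K. l x = 0)"

lemma linear_mod_sum: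
  assumes "linear_mod X K l" "pm.subspace X" "\<And>i. i \<in> A \<Longrightarrow> f i \<in> X"
  shows "l (\<Sum>i\<in>A. cst (c i) * f i) = (\<Sum>i\<in>A. c i * l (f i))"
proof -
  have "l 0 = 0"
    using assms(1) pm.subspace_0[OF assms(2)] unfolding linear_mod_def
    by (metis add_cancel_right_right)
  then show ?thesis using assms(3)
  proof (induction A rule: infinite_finite_induct)
    case (insert a A)
    have "(\<Sum>i\<in>A. cst (c i) * f i) \<in> X"
      by (intro pm.subspace_sum[OF assms(2)] pm.subspace_scale[OF assms(2)]) (use insert in auto)
    moreover have "cst (c a) * f a \<in> X"
      by (intro pm.subspace_scale[OF assms(2)]) (use insert in auto)
    ultimately show ?case using insert assms(1) by (simp add: linear_mod_def)
  qed simp_all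
qed

lemma linear_mod_cong:
  assumes "linear_mod X K l" "pm.subspace X" "K \<subseteq> X" "x \<in> X" "y \<in> X" "x - y \<in> K"
  shows "l x = l y"
proof -
  have "l ((x - y) + y) = l (x - y) + l y"
    using assms unfolding linear_mod_def by blast
  then show ?thesis using assms unfolding linear_mod_def by simp
qed

text \<open>Graded pieces of the quotient ring and local rings are records whose elements are sets
  of representatives. Here such a record is identified with \<open>X\<close> modulo
  \<open>K\<close>, so that bases, dimensions and determinants can be computed on representatives,
  without ever handling a coset.\<close>

locale quotient_vs =
  fixes X K :: "('m::comm_monoid_add \<Rightarrow>\<^sub>0 complex) set"
    and V :: "(complex, 'v) module" and \<Phi> :: "('m \<Rightarrow>\<^sub>0 complex) \<Rightarrow> 'v"
  assumes X: "pm.subspace X" and K: "pm.subspace K" and KX: "K \<subseteq> X"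
    and carr: "carrier V = \<Phi> ` X"
    and add: "\<And>p q. p \<in> X \<Longrightarrow> q \<in> X \<Longrightarrow> \<Phi> p \<oplus>\<^bsub>V\<^esub> \<Phi> q = \<Phi> (p + q)"
    and zer: "\<zero>\<^bsub>V\<^esub> = \<Phi> 0"
    and smu: "\<And>c p. p \<in> X \<Longrightarrow> c \<odot>\<^bsub>V\<^esub> \<Phi> p = \<Phi> (cst c * p)"
    and eq: "\<And>p q. p \<in> X \<Longrightarrow> q \<in> X \<Longrightarrow> \<Phi> p = \<Phi> q \<longleftrightarrow> p - q \<in> K"
begin

lemmas Xs = pm.subspace_0[OF X] pm.subspace_add[OF X] pm.subspace_diff[OF X] pm.subspace_scale[OF X]

lemma X_sum: "(\<And>i. i \<in> A \<Longrightarrow> f i \<in> X) \<Longrightarrow> (\<Sum>i\<in>A. cst (c i) * f i) \<in> X"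
  by (intro pm.subspace_sum[OF X] Xs(4)) auto

lemma vs: "vectorspace class_ring V"
proof (rule vs_criteria)
  show "field (class_ring :: complex ring)" by (rule class_field)
  show "\<zero>\<^bsub>V\<^esub> \<in> carrier V" by (simp add: carr zer Xs)
  show "\<forall>v w. v \<in> carrier V \<and> w \<in> carrier V \<longrightarrow> v \<oplus>\<^bsub>V\<^esub> w \<in> carrier V"
    by (auto simp: carr add Xs)
  show "\<forall>v\<in>carrier V. \<exists>neg_v\<in>carrier V. v \<oplus>\<^bsub>V\<^esub> neg_v = \<zero>\<^bsub>V\<^esub>"
    using Xs(3)[OF Xs(1)] by (auto simp: carr add zer Xs intro!: bexI[of _ "- _"])
  show "\<forall>c v. c \<in> carrier class_ring \<and> v \<in> carrier V \<longrightarrow> c \<odot>\<^bsub>V\<^esub> v \<in> carrier V"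
    by (auto simp: carr smu Xs)
  show "\<forall>v w. v \<in> carrier V \<and> w \<in> carrier V \<longrightarrow> v \<oplus>\<^bsub>V\<^esub> w = w \<oplus>\<^bsub>V\<^esub> v"
    by (auto simp: carr add Xs add.commute)
  show "\<forall>v w x. v \<in> carrier V \<and> w \<in> carrier V \<and> x \<in> carrier V \<longrightarrow>
      v \<oplus>\<^bsub>V\<^esub> w \<oplus>\<^bsub>V\<^esub> x = v \<oplus>\<^bsub>V\<^esub> (w \<oplus>\<^bsub>V\<^esub> x)"
    by (auto simp: carr add Xs add.assoc)
  show "\<forall>v\<in>carrier V. v \<oplus>\<^bsub>V\<^esub> \<zero>\<^bsub>V\<^esub> = v"
    by (auto simp: carr add zer Xs)
  show "\<forall>a b v. a \<in> carrier class_ring \<and> b \<in> carrier class_ring \<and> v \<in> carrier V \<longrightarrow>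
      (a \<otimes>\<^bsub>class_ring\<^esub> b) \<odot>\<^bsub>V\<^esub> v = a \<odot>\<^bsub>V\<^esub> (b \<odot>\<^bsub>V\<^esub> v)"
    by (auto simp: carr smu Xs class_ring_simps mult.assoc[symmetric])
  show "\<forall>v\<in>carrier V. \<one>\<^bsub>class_ring\<^esub> \<odot>\<^bsub>V\<^esub> v = v"
    by (auto simp: carr smu class_ring_simps)
  show "\<forall>a b v. a \<in> carrier class_ring \<and> b \<in> carrier class_ring \<and> v \<in> carrier V \<longrightarrow>
      (a \<oplus>\<^bsub>class_ring\<^esub> b) \<odot>\<^bsub>V\<^esub> v = a \<odot>\<^bsub>V\<^esub> v \<oplus>\<^bsub>V\<^esub> b \<odot>\<^bsub>V\<^esub> v"
    by (auto simp: carr smu add Xs class_ring_simps cst_add distrib_right)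
  show "\<forall>a v w. a \<in> carrier class_ring \<and> v \<in> carrier V \<and> w \<in> carrier V \<longrightarrow>
      a \<odot>\<^bsub>V\<^esub> (v \<oplus>\<^bsub>V\<^esub> w) = a \<odot>\<^bsub>V\<^esub> v \<oplus>\<^bsub>V\<^esub> a \<odot>\<^bsub>V\<^esub> w"
    by (auto simp: carr smu add Xs distrib_left)
qed

sublocale vectorspace "class_ring :: complex ring" V by (rule vs)

lemma uminus: "p \<in> X \<Longrightarrow> \<ominus>\<^bsub>V\<^esub> \<Phi> p = \<Phi> (- p)"
  using Xs(3)[OF Xs(1), of p] by (intro M.minus_equality) (auto simp: carr add zer)

lemma minus: "p \<in> X \<Longrightarrow> q \<in> X \<Longrightarrow> \<Phi> p \<ominus>\<^bsub>V\<^esub> \<Phi> q = \<Phi> (p - q)"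
  using Xs(3)[OF Xs(1), of q] by (simp add: a_minus_def uminus add)

lemma \<Phi>_sum:
  "finite A \<Longrightarrow> (\<And>i. i \<in> A \<Longrightarrow> f i \<in> X) \<Longrightarrow> finsum V (\<lambda>i. \<Phi> (f i)) A = \<Phi> (sum f A)"
proof (induction A rule: finite_induct)
  case (insert a A)
  then have "sum f A \<in> X" by (intro pm.subspace_sum[OF X]) auto
  then show ?case using insert by (subst finsum_insert) (auto simp: carr add)
qed (simp add: zer)

lemma lincomb_\<Phi>:
  fixes f :: "nat \<Rightarrow> 'm \<Rightarrow>\<^sub>0 complex"
  assumes "\<And>i. i < d \<Longrightarrow> f i \<in> X" "inj_on (\<Phi> \<circ> f) {..<d}"
  shows "lincomb a ((\<Phi> \<circ> f) ` {..<d}) = \<Phi> (\<Sum>i<d. cst (a (\<Phi> (f i))) * f i)"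
proof -
  have "lincomb a ((\<Phi> \<circ> f) ` {..<d}) = finsum V (\<lambda>i. a ((\<Phi> \<circ> f) i) \<odot>\<^bsub>V\<^esub> (\<Phi> \<circ> f) i) {..<d}"
    unfolding lincomb_def using assms by (subst finsum_reindex) (auto simp: carr smu Xs)
  also have "\<dots> = finsum V (\<lambda>i. \<Phi> (cst (a (\<Phi> (f i))) * f i)) {..<d}"
    using assms(1) by (intro finsum_cong') (auto simp: carr smu Xs)
  also have "\<dots> = \<Phi> (\<Sum>i<d. cst (a (\<Phi> (f i))) * f i)"
    using assms(1) by (intro \<Phi>_sum) (auto simp: Xs)
  finally show ?thesis .
qed

lemma indep_mod_imp:
  assumes fX: "\<And>i. i < d \<Longrightarrow> f i \<in> X" and ind: "indep_mod K f d"
  shows "inj_on (\<Phi> \<circ> f) {..<d}" "lin_indpt ((\<Phi> \<circ> f) ` {..<d})"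
proof -
  show inj: "inj_on (\<Phi> \<circ> f) {..<d}"
  proof (rule inj_onI, rule ccontr)
    fix i j assume ij: "i \<in> {..<d}" "j \<in> {..<d}" "(\<Phi> \<circ> f) i = (\<Phi> \<circ> f) j" "i \<noteq> j"
    define c where "c = (\<lambda>k. (if k = i then 1 else 0) - (if k = j then 1 else 0 :: complex))"
    have "(\<Sum>k<d. cst (c k) * f k) = (\<Sum>k<d. (if k = i then f k else 0) - (if k = j then f k else 0))"
      by (intro sum.cong refl) (auto simp: c_def cst_diff)
    also have "\<dots> = f i - f j"
      using ij by (simp add: sum_subtractf)
    also have "\<dots> \<in> K"
      using ij fX eq by auto
    finally have "c i = 0" using ind ij(1) unfolding indep_mod_def by blast
    then show False using ij(4) by (simp add: c_def)
  qed
  show "lin_indpt ((\<Phi> \<circ> f) ` {..<d})"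
  proof (rule finite_lin_indpt2)
    fix a assume "lincomb a ((\<Phi> \<circ> f) ` {..<d}) = \<zero>\<^bsub>V\<^esub>"
    then have "\<Phi> (\<Sum>i<d. cst (a (\<Phi> (f i))) * f i) = \<Phi> 0"
      by (simp only: lincomb_\<Phi>[OF fX inj] zer)
    then have "(\<Sum>i<d. cst (a (\<Phi> (f i))) * f i) \<in> K"
      using fX by (subst (asm) eq) (auto intro: X_sum Xs)
    then have "a (\<Phi> (f i)) = 0" if "i < d" for i
      using ind[unfolded indep_mod_def, rule_format, of "\<lambda>i. a (\<Phi> (f i))"] that by blast
    then show "\<forall>v\<in>(\<Phi> \<circ> f) ` {..<d}. a v = \<zero>\<^bsub>class_ring\<^esub>"
      by (auto simp: class_ring_simps)
  qed (use fX in \<open>auto simp: carr\<close>)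
qed

lemma basis_imageI:
  assumes fX: "\<And>i. i < d \<Longrightarrow> f i \<in> X" and ind: "indep_mod K f d" and sp: "spans_mod X K f d"
  shows "basis ((\<Phi> \<circ> f) ` {..<d})" "fin_dim" "dim = d"
proof -
  note inj = indep_mod_imp[OF fX ind]
  have sub: "(\<Phi> \<circ> f) ` {..<d} \<subseteq> carrier V" using fX by (auto simp: carr)
  have gen: "gen_set ((\<Phi> \<circ> f) ` {..<d})"
  proof
    show "span ((\<Phi> \<circ> f) ` {..<d}) \<subseteq> carrier V" using sub by (rule span_is_subset2)
    show "carrier V \<subseteq> span ((\<Phi> \<circ> f) ` {..<d})"
    proof
      fix v assume "v \<in> carrier V"
      then obtain x where x: "v = \<Phi> x" "x \<in> X" by (auto simp: carr)
      then obtain c where c: "x - (\<Sum>i<d. cst (c i) * f i) \<in> K" using sp unfolding spans_mod_def by blast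
      define a where "a v = c (the_inv_into {..<d} (\<Phi> \<circ> f) v)" for v
      have a: "a (\<Phi> (f i)) = c i" if "i < d" for i
        using the_inv_into_f_f[OF inj(1)] that by (simp add: a_def)
      have "lincomb a ((\<Phi> \<circ> f) ` {..<d}) = \<Phi> (\<Sum>i<d. cst (c i) * f i)"
        using a by (subst lincomb_\<Phi>[OF fX inj(1)]) auto
      also have "\<dots> = v" using c eq[OF x(2) X_sum, of "{..<d}" f c] fX x(1) by simp
      finally show "v \<in> span ((\<Phi> \<circ> f) ` {..<d})"
        using finite_span[OF _ sub] by (auto simp: class_ring_simps)
    qed
  qed
  show b: "basis ((\<Phi> \<circ> f) ` {..<d})" unfolding basis_def using inj gen sub by auto
  show "fin_dim" unfolding fin_dim_def using gen sub by blast
  show "dim = d" using dim_basis[OF _ b] card_image[OF inj(1)] by simp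
qed

lemma basisD:
  assumes fX: "\<And>i. i < d \<Longrightarrow> f i \<in> X" and inj: "inj_on (\<Phi> \<circ> f) {..<d}" and b: "basis ((\<Phi> \<circ> f) ` {..<d})"
  shows "indep_mod K f d" "spans_mod X K f d"
proof -
  have sub: "(\<Phi> \<circ> f) ` {..<d} \<subseteq> carrier V" using fX by (auto simp: carr)
  show "indep_mod K f d"
    unfolding indep_mod_def
  proof (intro allI impI)
    fix c i assume c: "(\<Sum>i<d. cst (c i) * f i) \<in> K" and i: "i < d"
    define a where "a v = c (the_inv_into {..<d} (\<Phi> \<circ> f) v)" for v
    have a: "a (\<Phi> (f i)) = c i" if "i < d" for i
      using the_inv_into_f_f[OF inj(1)] that by (simp add: a_def)
    have "lincomb a ((\<Phi> \<circ> f) ` {..<d}) = \<Phi> (\<Sum>i<d. cst (c i) * f i)"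
      using a by (subst lincomb_\<Phi>[OF fX inj(1)]) auto
    also have "\<dots> = \<zero>\<^bsub>V\<^esub>" using c eq[OF X_sum Xs(1), of "{..<d}" f c] fX by (simp add: zer)
    finally have "a (\<Phi> (f i)) = 0"
      using b lin_dep_crit[of "(\<Phi> \<circ> f) ` {..<d}" "(\<Phi> \<circ> f) ` {..<d}" a "\<Phi> (f i)"] i
      unfolding basis_def by (auto simp: class_ring_simps)
    then show "c i = 0" using a i by simp
  qed
  show "spans_mod X K f d"
    unfolding spans_mod_def
  proof
    fix x assume x: "x \<in> X"
    then have "\<Phi> x \<in> span ((\<Phi> \<circ> f) ` {..<d})" using b by (simp add: basis_def carr)
    then have "\<Phi> x \<in> {lincomb a ((\<Phi> \<circ> f) ` {..<d}) |a. a \<in> (\<Phi> \<circ> f) ` {..<d} \<rightarrow> carrier class_ring}"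
      by (simp only: finite_span[OF finite_imageI[OF finite_lessThan] sub])
    then obtain a where a: "\<Phi> x = lincomb a ((\<Phi> \<circ> f) ` {..<d})"
      by blast
    then have "\<Phi> x = \<Phi> (\<Sum>i<d. cst (a (\<Phi> (f i))) * f i)"
      by (simp only: lincomb_\<Phi>[OF fX inj])
    then show "\<exists>c. x - (\<Sum>i<d. cst (c i) * f i) \<in> K"
      using fX by (subst (asm) eq) (auto intro: X_sum x)
  qed
qed

lemma coordinates_eq:
  fixes f :: "nat \<Rightarrow> 'm \<Rightarrow>\<^sub>0 complex"
  assumes fX: "\<And>i. i < d \<Longrightarrow> f i \<in> X" and inj: "inj_on (\<Phi> \<circ> f) {..<d}" and b: "basis ((\<Phi> \<circ> f) ` {..<d})"
    and x: "x \<in> X" "x - (\<Sum>i<d. cst (c i) * f i) \<in> K" and i: "i < d"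
  shows "coordinates V ((\<Phi> \<circ> f) ` {..<d}) (\<Phi> x) (\<Phi> (f i)) = c i"
proof -
  let ?B = "(\<Phi> \<circ> f) ` {..<d}"
  define a where "a = restrict (\<lambda>v. c (the_inv_into {..<d} (\<Phi> \<circ> f) v)) ?B"
  have a: "a (\<Phi> (f i)) = c i" if "i < d" for i
    using the_inv_into_f_f[OF inj(1)] that by (simp add: a_def)
  have la: "lincomb a ?B = \<Phi> x"
    using a x eq[OF x(1) X_sum, of "{..<d}" f c] fX by (subst lincomb_\<Phi>[OF fX inj(1)]) auto
  have uniq: "a' = a" if a': "a' \<in> extensional ?B" "lincomb a' ?B = \<Phi> x" for a'
  proof (rule extensionalityI[OF a'(1)])
    show "a \<in> extensional ?B" by (simp add: a_def)
    fix v assume "v \<in> ?B"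
    then obtain j where j: "v = \<Phi> (f j)" "j < d" by auto
    have "\<Phi> (\<Sum>i<d. cst (a' (\<Phi> (f i))) * f i) = \<Phi> (\<Sum>i<d. cst (a (\<Phi> (f i))) * f i)"
      using la a'(2) by (simp only: lincomb_\<Phi>[OF fX inj])
    then have "(\<Sum>i<d. cst (a' (\<Phi> (f i))) * f i) - (\<Sum>i<d. cst (a (\<Phi> (f i))) * f i) \<in> K"
      by (subst (asm) eq) (auto intro: X_sum fX)
    then have "(\<Sum>i<d. cst (a' (\<Phi> (f i)) - a (\<Phi> (f i))) * f i) \<in> K"
      by (simp add: cst_diff left_diff_distrib sum_subtractf)
    then have "a' (\<Phi> (f j)) - a (\<Phi> (f j)) = 0"
      using basisD(1)[OF fX inj b, unfolded indep_mod_def, rule_format,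
          of "\<lambda>i. a' (\<Phi> (f i)) - a (\<Phi> (f i))"] j by blast
    then show "a' v = a v" using j by simp
  qed
  have "coordinates V ?B (\<Phi> x) = a"
    unfolding coordinates_def by (rule the_equality) (use la uniq in \<open>auto simp: a_def\<close>)
  then show ?thesis using a i by simp
qed

lemma obtain_lift:
  assumes "set bs \<subseteq> carrier V"
  obtains f where "\<And>i. i < length bs \<Longrightarrow> f i \<in> X" "\<And>i. i < length bs \<Longrightarrow> bs ! i = \<Phi> (f i)"
proof -
  have "\<forall>i. \<exists>x. i < length bs \<longrightarrow> x \<in> X \<and> bs ! i = \<Phi> x"
    using assms nth_mem unfolding carr by blast
  from choice[OF this] obtain f where "\<forall>i. i < length bs \<longrightarrow> f i \<in> X \<and> bs ! i = \<Phi> (f i)" ..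
  then show ?thesis by (intro that[of f]) auto
qed

lemma lift_image:
  assumes "\<And>i. i < length bs \<Longrightarrow> bs ! i = \<Phi> (f i)"
  shows "(\<Phi> \<circ> f) ` {..<length bs} = set bs" "distinct bs \<Longrightarrow> inj_on (\<Phi> \<circ> f) {..<length bs}"
proof -
  have "(\<Phi> \<circ> f) ` {..<length bs} = (\<lambda>i. bs ! i) ` {..<length bs}"
    using assms by (intro image_cong) auto
  then show "(\<Phi> \<circ> f) ` {..<length bs} = set bs" by (simp add: set_conv_nth image_def Bex_def conj_commute)
  show "inj_on (\<Phi> \<circ> f) {..<length bs}" if "distinct bs"
    using inj_on_nth[OF that, of "{..<length bs}"] assms by (subst inj_on_cong[of _ _ "(!) bs"]) auto
qed

lemma obtain_basis:
  assumes "fin_dim"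
  obtains f where "\<And>i. i < dim \<Longrightarrow> f i \<in> X" "indep_mod K f dim" "spans_mod X K f dim"
proof -
  obtain B where B: "finite B" "basis B" using finite_basis_exists[OF assms] by blast
  obtain bs where bs: "set bs = B" "distinct bs" using finite_distinct_list[OF B(1)] by blast
  have l: "length bs = dim" using dim_basis[OF B] bs distinct_card by metis
  obtain f where f: "\<And>i. i < length bs \<Longrightarrow> f i \<in> X" "\<And>i. i < length bs \<Longrightarrow> bs ! i = \<Phi> (f i)"
    by (rule obtain_lift[of bs]) (use bs B(2) in \<open>auto simp: basis_def\<close>)
  have im: "(\<Phi> \<circ> f) ` {..<length bs} = B"
    using lift_image(1)[OF f(2)] bs(1) by simp
  have inj: "inj_on (\<Phi> \<circ> f) {..<length bs}"
    using lift_image(2)[OF f(2) bs(2)] .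
  show ?thesis using basisD[OF f(1) inj] im B(2) f(1) l that by auto
qed

text \<open>The functionals \<open>L\<close> conjugate the endomorphism to the matrix \<open>U\<close>.\<close>

lemma endo_det_eq:
  assumes fd: "fin_dim" and d: "dim = d"
    and T: "\<And>x. x \<in> X \<Longrightarrow> \<tau> x \<in> X \<and> T (\<Phi> x) = \<Phi> (\<tau> x)"
    and L: "\<And>r. r < d \<Longrightarrow> linear_mod X K (L r)"
    and inj: "\<And>x. x \<in> X \<Longrightarrow> (\<And>r. r < d \<Longrightarrow> L r x = 0) \<Longrightarrow> x \<in> K"
    and U: "U \<in> carrier_mat d d"
    and LU: "\<And>r x. r < d \<Longrightarrow> x \<in> X \<Longrightarrow> L r (\<tau> x) = (\<Sum>s<d. U $$ (r, s) * L s x)"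
  shows "endo_det V T = Determinant.det U"
proof -
  let ?P = "\<lambda>bs. distinct bs \<and> basis (set bs)"
  define bs where "bs = (SOME bs. ?P bs)"
  obtain B where "finite B" "basis B" using finite_basis_exists[OF fd] by blast
  moreover then obtain bs' where "set bs' = B" "distinct bs'" using finite_distinct_list by blast
  ultimately have "?P bs'" by simp
  then have "?P bs" unfolding bs_def by (rule someI[of ?P])
  then have bs: "distinct bs" "basis (set bs)" by auto
  have len: "length bs = d" using dim_basis[OF finite_set bs(2)] d distinct_card[OF bs(1)] by simp
  obtain f where f: "\<And>i. i < d \<Longrightarrow> f i \<in> X" "\<And>i. i < d \<Longrightarrow> bs ! i = \<Phi> (f i)"
    by (rule obtain_lift[of bs]) (use bs(2) len in \<open>auto simp: basis_def\<close>)
  have im: "(\<Phi> \<circ> f) ` {..<d} = set bs"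
    using lift_image(1)[of bs f] f(2) len by simp
  have finj: "inj_on (\<Phi> \<circ> f) {..<d}"
    using lift_image(2)[of bs f] f(2) bs(1) len by simp
  have bas: "basis ((\<Phi> \<circ> f) ` {..<d})" using im bs(2) by simp
  note ind = basisD[OF f(1) finj bas]
  have "\<forall>j. \<exists>c. j < d \<longrightarrow> \<tau> (f j) - (\<Sum>i<d. cst (c i) * f i) \<in> K"
    using ind(2) f(1) T unfolding spans_mod_def by blast
  from choice[OF this] obtain c where c: "\<And>j. j < d \<Longrightarrow> \<tau> (f j) - (\<Sum>i<d. cst (c j i) * f i) \<in> K" by blast
  define C where "C = endo_matrix V bs T"
  have C: "C \<in> carrier_mat d d" by (simp add: C_def endo_matrix_def len)
  have Cij: "C $$ (i, j) = c j i" if "i < d" "j < d" for i j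
  proof -
    have "C $$ (i, j) = coordinates V (set bs) (T (bs ! j)) (bs ! i)"
      using that by (simp add: C_def endo_matrix_def len)
    also have "\<dots> = coordinates V ((\<Phi> \<circ> f) ` {..<d}) (\<Phi> (\<tau> (f j))) (\<Phi> (f i))"
      using T[OF f(1)[OF that(2)]] by (simp only: im f(2)[OF that(1)] f(2)[OF that(2)])
    also have "\<dots> = c j i"
      using T[OF f(1)[OF that(2)]] c[OF that(2)] that by (intro coordinates_eq[OF f(1) finj bas]) auto
    finally show ?thesis .
  qed
  \<comment> \<open>\<open>E\<close> evaluates the functionals on the basis picked inside
    \<open>endo_det\<close>. It intertwines the matrix \<open>C\<close> of the endomorphism in that
    basis with \<open>U\<close>, and it is invertible because a common zero of the functionals lies
    in \<open>K\<close>.\<close>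
  define E where "E = Matrix.mat d d (\<lambda>(r, j). L r (f j))"
  have E: "E \<in> carrier_mat d d" by (simp add: E_def)
  have "E * C = U * E"
  proof (rule eq_matI)
    fix r j assume "r < dim_row (U * E)" "j < dim_col (U * E)"
    then have rj: "r < d" "j < d" using U E by auto
    have "(E * C) $$ (r, j) = (\<Sum>i<d. c j i * L r (f i))"
      using rj E C by (auto simp: scalar_prod_def E_def Cij lessThan_atLeast0 mult.commute)
    also have "\<dots> = L r (\<Sum>i<d. cst (c j i) * f i)"
      using L[OF rj(1)] X f(1) by (subst linear_mod_sum) auto
    also have "\<dots> = L r (\<tau> (f j))"
      using rj T[OF f(1)[OF rj(2)]] by (intro linear_mod_cong[OF L X KX, symmetric] c X_sum f(1)) auto
    also have "\<dots> = (U * E) $$ (r, j)"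
      using rj U E LU[OF rj(1) f(1)[OF rj(2)]] by (auto simp: scalar_prod_def E_def lessThan_atLeast0)
    finally show "(E * C) $$ (r, j) = (U * E) $$ (r, j)" .
  qed (use E U C in auto)
  then have "Determinant.det E * Determinant.det C = Determinant.det U * Determinant.det E"
    using det_mult[OF E C] det_mult[OF U E] by metis
  moreover have "Determinant.det E \<noteq> 0"
  proof
    assume "Determinant.det E = 0"
    then obtain v where v: "v \<in> carrier_vec d" "v \<noteq> 0\<^sub>v d" "E *\<^sub>v v = 0\<^sub>v d"
      using det_0_iff_vec_prod_zero[OF E] by auto
    have "(\<Sum>j<d. cst (vec_index v j) * f j) \<in> K"
    proof (rule inj[OF X_sum])
      fix r assume r: "r < d"
      have "L r (\<Sum>j<d. cst (vec_index v j) * f j) = (\<Sum>j<d. vec_index v j * L r (f j))"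
        using L[OF r] X f(1) by (subst linear_mod_sum) auto
      also have "\<dots> = vec_index (E *\<^sub>v v) r"
        using r v(1) E by (auto simp: scalar_prod_def E_def lessThan_atLeast0 mult.commute)
      finally show "L r (\<Sum>j<d. cst (vec_index v j) * f j) = 0" using v(3) r by simp
    qed (use f in auto)
    then have "\<forall>i<d. vec_index v i = 0" using ind(1) unfolding indep_mod_def by blast
    then have "v = 0\<^sub>v d" using v(1) by (intro eq_vecI) auto
    then show False using v(2) by simp
  qed
  ultimately show ?thesis by (simp add: endo_det_def bs_def C_def mult.commute)
qed

end

section \<open>Nilpotent operators\<close>

lemma span_insert_union: "pm.span (insert w K \<union> e ` {..<r}) = pm.span (K \<union> case_nat w e ` {..<Suc r})"
proof -
  have "case_nat w e ` {..<Suc r} = insert w (e ` {..<r})"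
    by (auto simp: lessThan_Suc_eq_insert_0 image_image)
  then show ?thesis by simp
qed

lemma span_span_Un: "pm.span (pm.span A \<union> B) = pm.span (A \<union> B)"
proof (rule subset_antisym)
  show "pm.span (pm.span A \<union> B) \<subseteq> pm.span (A \<union> B)"
    using pm.span_mono[of A "A \<union> B"] pm.span_superset[of "A \<union> B"]
    by (intro pm.span_minimal pm.subspace_span) blast
  show "pm.span (A \<union> B) \<subseteq> pm.span (pm.span A \<union> B)"
    using pm.span_superset[of A] by (intro pm.span_mono) blast
qed

text \<open>The iterate just before the orbit of \<open>x\<close> first enters \<open>K\<close>. It
  is killed by \<open>n\<close> modulo \<open>K\<close>, hence a suitable next member of a
  flag.\<close>

lemma funpow_last_outside:
  assumes "x \<notin> K" "(n ^^ k) x \<in> K"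
  obtains j where "(n ^^ j) x \<notin> K" "n ((n ^^ j) x) \<in> K"
  using assms
proof (induction k arbitrary: x thesis)
  case (Suc k)
  show ?case
  proof (cases "n x \<in> K")
    case True
    then show ?thesis using Suc.prems(1)[of 0] Suc.prems(2) by simp
  next
    case False
    have "(n ^^ k) (n x) \<in> K" using Suc.prems(3) by (simp add: funpow_swap1)
    then obtain j where "(n ^^ j) (n x) \<notin> K" "n ((n ^^ j) (n x)) \<in> K" using Suc.IH False by blast
    then show ?thesis using Suc.prems(1)[of "Suc j"] by (simp add: funpow_swap1)
  qed
qed simp

lemma ex_flag:
  fixes n :: "('m::comm_monoid_add \<Rightarrow>\<^sub>0 complex) \<Rightarrow> ('m \<Rightarrow>\<^sub>0 complex)"
  assumes "finite G" "pm.subspace K" "K \<subseteq> X" "X \<subseteq> pm.span (K \<union> G)" "pm.subspace X"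
    and nX: "\<And>x. x \<in> X \<Longrightarrow> n x \<in> X" and nil: "\<And>x. x \<in> X \<Longrightarrow> \<exists>k. (n ^^ k) x \<in> K"
  shows "\<exists>(\<mu>::nat) e. (\<forall>r<\<mu>. e r \<in> X \<and> e r \<notin> pm.span (K \<union> e ` {..<r}) \<and> n (e r) \<in> pm.span (K \<union> e ` {..<r}))
      \<and> X = pm.span (K \<union> e ` {..<\<mu>})"
  using assms(1-4) nil
proof (induction "card G" arbitrary: G K)
  case 0
  have "pm.span K = K" using 0 pm.span_eq_iff by blast
  moreover have "X \<subseteq> pm.span K" using 0 by auto
  ultimately have "X = pm.span K" using \<open>K \<subseteq> X\<close> by blast
  then have "X = pm.span (K \<union> (\<lambda>_. 0) ` {..<0::nat})" by simp
  then show ?case by (intro exI[of _ 0] exI[of _ "\<lambda>_. 0"]) auto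
next
  case (Suc c)
  show ?case
  proof (cases "X = K")
    case True
    moreover have "pm.span K = K" using Suc.prems(2) pm.span_eq_iff by blast
    ultimately have "X = pm.span (K \<union> (\<lambda>_. 0) ` {..<0::nat})"
      by (metis lessThan_0 image_empty sup_bot_right)
    then show ?thesis by (intro exI[of _ 0] exI[of _ "\<lambda>_. 0"]) auto
  next
    case False
    then obtain v where v: "v \<in> X" "v \<notin> K" using Suc.prems(3) by blast
    obtain k where "(n ^^ k) v \<in> K" using Suc.prems(5) v by blast
    then obtain j where j: "(n ^^ j) v \<notin> K" "n ((n ^^ j) v) \<in> K" using funpow_last_outside v by metis
    define w where "w = (n ^^ j) v"
    have wX: "w \<in> X" unfolding w_def by (induction j) (auto simp: v nX)
    have w: "w \<notin> K" "n w \<in> K" using j by (auto simp: w_def)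
    \<comment> \<open>Steinitz exchange relative to \<open>K\<close>: a smallest part
      \<open>G0\<close> of \<open>G\<close> that spans \<open>w\<close> over \<open>K\<close> is
      nonempty since \<open>w\<close> is not in \<open>K\<close>, and each of its elements can be
      traded for \<open>w\<close>.\<close>
    have "\<exists>g\<in>G. g \<in> pm.span (insert w (K \<union> (G - {g})))"
    proof -
      obtain G0 where G0: "G0 \<subseteq> G" "w \<in> pm.span (K \<union> G0)"
        and mini: "\<And>G'. G' \<subset> G0 \<Longrightarrow> w \<notin> pm.span (K \<union> G')"
      proof -
        have "w \<in> pm.span (K \<union> G)" using wX Suc.prems(4) by blast
        then have "\<exists>G0. (G0 \<subseteq> G \<and> w \<in> pm.span (K \<union> G0)) \<and>
            (\<forall>G'. (G' \<subseteq> G \<and> w \<in> pm.span (K \<union> G')) \<longrightarrow> card G0 \<le> card G')"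
          by (intro ex_has_least_nat[of _ G]) auto
        then obtain G0 where G0: "G0 \<subseteq> G" "w \<in> pm.span (K \<union> G0)"
            "\<And>G'. G' \<subseteq> G \<Longrightarrow> w \<in> pm.span (K \<union> G') \<Longrightarrow> card G0 \<le> card G'" by blast
        show ?thesis
        proof (rule that[OF G0(1,2)], rule notI)
          fix G' assume G': "G' \<subset> G0" "w \<in> pm.span (K \<union> G')"
          have "finite G0" using Suc.prems(1) G0(1) finite_subset by blast
          then have "card G' < card G0" using G'(1) by (rule psubset_card_mono)
          then show False using G0(3)[of G'] G' G0(1) by fastforce
        qed
      qed
      have "pm.span K = K" using Suc.prems(2) pm.span_eq_iff by blast
      then have "G0 \<noteq> {}" using G0(2) w(1) by (metis sup_bot_right)
      then obtain g where g: "g \<in> G0" by blast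
      have "w \<in> pm.span (insert g (K \<union> (G0 - {g})))"
        using G0(2) g pm.span_mono[of "K \<union> G0" "insert g (K \<union> (G0 - {g}))"] by blast
      moreover have "w \<notin> pm.span (K \<union> (G0 - {g}))" using g by (intro mini) auto
      ultimately have "g \<in> pm.span (insert w (K \<union> (G0 - {g})))" by (rule pm.in_span_insert)
      moreover have "insert w (K \<union> (G0 - {g})) \<subseteq> insert w (K \<union> (G - {g}))" using G0(1) by blast
      ultimately show ?thesis using g G0(1) pm.span_mono by blast
    qed
    then obtain g where g: "g \<in> G" "g \<in> pm.span (insert w (K \<union> (G - {g})))" by blast
    define K' where "K' = pm.span (insert w K)"
    have K': "K \<subseteq> K'" "w \<in> K'" unfolding K'_def by (auto intro: pm.span_base)
    have "insert w (K \<union> (G - {g})) \<subseteq> pm.span (K' \<union> (G - {g}))"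
      using K' by (auto intro: pm.span_base)
    then have g': "g \<in> pm.span (K' \<union> (G - {g}))"
      using g(2) pm.span_minimal[OF _ pm.subspace_span] by blast
    have "K \<union> G \<subseteq> pm.span (K' \<union> (G - {g}))"
      using K' g' by (auto intro: pm.span_base)
    then have XG: "X \<subseteq> pm.span (K' \<union> (G - {g}))"
      using Suc.prems(4) pm.span_minimal[OF _ pm.subspace_span] by blast
    have K'X: "K' \<subseteq> X" unfolding K'_def
      using wX Suc.prems(3) assms(5) by (intro pm.span_minimal) auto
    have "\<exists>(\<mu>::nat) e. (\<forall>r<\<mu>. e r \<in> X \<and> e r \<notin> pm.span (K' \<union> e ` {..<r}) \<and> n (e r) \<in> pm.span (K' \<union> e ` {..<r}))
      \<and> X = pm.span (K' \<union> e ` {..<\<mu>})"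
    proof (rule Suc.hyps(1))
      show "c = card (G - {g})" using Suc.hyps(2) g(1) Suc.prems(1) by simp
      show "finite (G - {g})" using Suc.prems(1) by simp
      show "pm.subspace K'" by (simp add: K'_def)
      show "\<And>x. x \<in> X \<Longrightarrow> \<exists>k. (n ^^ k) x \<in> K'" using Suc.prems(5) K'(1) by blast
    qed (use XG K'X in auto)
    then obtain \<mu> :: nat and e where e: "\<And>r. r < \<mu> \<Longrightarrow> e r \<in> X \<and> e r \<notin> pm.span (K' \<union> e ` {..<r}) \<and> n (e r) \<in> pm.span (K' \<union> e ` {..<r})"
      "X = pm.span (K' \<union> e ` {..<\<mu>})" by blast
    have sp: "pm.span (K' \<union> e ` {..<r}) = pm.span (K \<union> case_nat w e ` {..<Suc r})" for r
    proof -
      have "pm.span (K' \<union> e ` {..<r}) = pm.span (insert w K \<union> e ` {..<r})"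
        unfolding K'_def by (rule span_span_Un)
      then show ?thesis by (simp only: span_insert_union)
    qed
    have "pm.span K = K" using Suc.prems(2) pm.span_eq_iff by blast
    with w have sK: "w \<notin> pm.span K" "n w \<in> pm.span K" by metis+
    \<comment> \<open>\<open>case_nat w e\<close> puts \<open>w\<close> in front of the flag found
      for the enlarged subspace \<open>K'\<close>, which shifts the indices by one.\<close>
    show ?thesis
    proof (intro exI[of _ "Suc \<mu>"] exI[of _ "case_nat w e"] conjI allI impI)
      fix r assume r: "r < Suc \<mu>"
      show "case_nat w e r \<in> X" using r e wX by (cases r) auto
      show "case_nat w e r \<notin> pm.span (K \<union> case_nat w e ` {..<r})"
        using r e(1) sK unfolding sp by (cases r) auto
      show "n (case_nat w e r) \<in> pm.span (K \<union> case_nat w e ` {..<r})"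
        using r e(1) sK unfolding sp by (cases r) auto
    qed (simp only: e(2)[unfolded sp])
  qed
qed

lemma span_Un_image:
  assumes "pm.subspace K" "x \<in> pm.span (K \<union> e ` {..<d::nat})"
  obtains c where "x - (\<Sum>i<d. cst (c i) * e i) \<in> K"
  using assms(2)
proof (induction d arbitrary: x thesis)
  case 0
  have "pm.span K = K" using assms(1) pm.span_eq_iff by blast
  with 0 show ?case by auto
next
  case (Suc d)
  have "x \<in> pm.span (insert (e d) (K \<union> e ` {..<d}))"
    using Suc.prems(2) by (simp add: lessThan_Suc)
  then obtain k where "x - cst k * e d \<in> pm.span (K \<union> e ` {..<d})"
    using pm.span_breakdown_eq by blast
  then obtain c where c: "(x - cst k * e d) - (\<Sum>i<d. cst (c i) * e i) \<in> K" using Suc.IH by blast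
  show ?case
    by (rule Suc.prems(1)[of "c(d := k)"]) (use c in \<open>simp add: algebra_simps\<close>)
qed

lemma flag_indep:
  assumes "pm.subspace K" "\<And>r. r < \<mu> \<Longrightarrow> e r \<notin> pm.span (K \<union> e ` {..<r})"
  shows "indep_mod K e \<mu>"
  unfolding indep_mod_def
proof (rule allI, rule impI)
  fix c assume "(\<Sum>i<\<mu>. cst (c i) * e i) \<in> K"
  then show "\<forall>i<\<mu>. c i = 0" using assms(2)
  proof (induction \<mu>)
    case (Suc d)
    have "c d = 0"
    proof (rule ccontr)
      assume nz: "c d \<noteq> 0"
      have "(\<Sum>i<d. cst (c i) * e i) \<in> pm.span (K \<union> e ` {..<d})"
        by (intro pm.span_sum pm.span_scale pm.span_base) auto
      with Suc.prems(1) have "(\<Sum>i<Suc d. cst (c i) * e i) - (\<Sum>i<d. cst (c i) * e i) \<in> pm.span (K \<union> e ` {..<d})"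
        by (intro pm.span_diff) (auto intro: pm.span_base)
      then have "cst (c d) * e d \<in> pm.span (K \<union> e ` {..<d})" by simp
      then have "cst (inverse (c d)) * (cst (c d) * e d) \<in> pm.span (K \<union> e ` {..<d})"
        by (rule pm.span_scale)
      then have "e d \<in> pm.span (K \<union> e ` {..<d})"
        using nz by (simp only: mult.assoc[symmetric] cst_mult) simp
      then show False using Suc.prems(2) by blast
    qed
    then have "(\<Sum>i<d. cst (c i) * e i) \<in> K" using Suc.prems(1) by simp
    then have "\<forall>i<d. c i = 0" by (rule Suc.IH) (simp add: Suc.prems(2))
    with \<open>c d = 0\<close> show ?case by (simp add: less_Suc_eq)
  qed simp
qed

text \<open>The functionals are the coordinates with respect to a flag for \<open>n\<close>, and
  \<open>N r s\<close> is the coordinate of \<open>n (e s)\<close> at \<open>e r\<close>. As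
  \<open>n (e s)\<close> lies in the span of \<open>K\<close> and the earlier members,
  \<open>N\<close> vanishes on and below the diagonal.\<close>

lemma nilpotent_functionals:
  fixes n :: "('m::comm_monoid_add \<Rightarrow>\<^sub>0 complex) \<Rightarrow> ('m \<Rightarrow>\<^sub>0 complex)"
  assumes fin: "finite G" and K: "pm.subspace K" and KX: "K \<subseteq> X" and XG: "X \<subseteq> pm.span (K \<union> G)"
    and X: "pm.subspace X"
    and nX: "\<And>x. x \<in> X \<Longrightarrow> n x \<in> X" and nK: "\<And>x. x \<in> K \<Longrightarrow> n x \<in> K"
    and nadd: "\<And>x y. n (x + y) = n x + n y" and nsc: "\<And>c x. n (cst c * x) = cst c * n x"
    and nil: "\<And>x. x \<in> X \<Longrightarrow> \<exists>k. (n ^^ k) x \<in> K"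
  obtains \<mu> :: nat and e l N where "\<And>r. r < \<mu> \<Longrightarrow> e r \<in> X" "indep_mod K e \<mu>" "spans_mod X K e \<mu>"
    "\<And>r. r < \<mu> \<Longrightarrow> linear_mod X K (l r)"
    "\<And>x. x \<in> X \<Longrightarrow> (\<And>r. r < \<mu> \<Longrightarrow> l r x = 0) \<Longrightarrow> x \<in> K"
    "\<And>r x. r < \<mu> \<Longrightarrow> x \<in> X \<Longrightarrow> l r (n x) = (\<Sum>s<\<mu>. N r s * l s x)"
    "\<And>r s. s \<le> r \<Longrightarrow> r < \<mu> \<Longrightarrow> N r s = (0::complex)"
proof -
  obtain \<mu> :: nat and e where e: "\<And>r. r < \<mu> \<Longrightarrow> e r \<in> X" "\<And>r. r < \<mu> \<Longrightarrow> e r \<notin> pm.span (K \<union> e ` {..<r})"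
    "\<And>r. r < \<mu> \<Longrightarrow> n (e r) \<in> pm.span (K \<union> e ` {..<r})" and Xe: "X = pm.span (K \<union> e ` {..<\<mu>})"
    using ex_flag[OF fin K KX XG X nX nil] by auto
  have ind: "indep_mod K e \<mu>" using flag_indep[OF K e(2)] .
  have sp: "spans_mod X K e \<mu>" unfolding spans_mod_def using span_Un_image[OF K] Xe by metis
  obtain l' where l': "\<And>x. x \<in> X \<Longrightarrow> x - (\<Sum>i<\<mu>. cst (l' x i) * e i) \<in> K"
    using sp unfolding spans_mod_def by metis
  define l where "l r x = l' x r" for r x
  have l: "x - (\<Sum>i<\<mu>. cst (l i x) * e i) \<in> K" if "x \<in> X" for x
    using l'[OF that] by (simp add: l_def)
  \<comment> \<open>Coordinates are unique modulo \<open>K\<close>. The linearity of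
    \<open>l r\<close> and the zeros of \<open>N\<close> are both read off by exhibiting some
    coordinates and appealing to this.\<close>
  have uniq: "l r x = c r" if "x \<in> X" "x - (\<Sum>i<\<mu>. cst (c i) * e i) \<in> K" "r < \<mu>" for r x c
  proof -
    have "(x - (\<Sum>i<\<mu>. cst (c i) * e i)) - (x - (\<Sum>i<\<mu>. cst (l i x) * e i)) \<in> K"
      using that(2) l[OF that(1)] by (rule pm.subspace_diff[OF K])
    then have "(\<Sum>i<\<mu>. cst (l i x - c i) * e i) \<in> K"
      by (simp add: cst_diff left_diff_distrib sum_subtractf)
    then have "l r x - c r = 0"
      using ind[unfolded indep_mod_def, rule_format, of "\<lambda>i. l i x - c i"] that(3) by blast
    then show ?thesis by simp
  qed
  have lin: "linear_mod X K (l r)" if r: "r < \<mu>" for r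
    unfolding linear_mod_def
  proof (intro conjI ballI allI)
    show "l r (x + y) = l r x + l r y" if "x \<in> X" "y \<in> X" for x y
      using pm.subspace_add[OF K l[OF that(1)] l[OF that(2)]]
      by (intro uniq[where c = "\<lambda>i. l i x + l i y"] pm.subspace_add[OF X] that r)
        (simp add: cst_add distrib_right sum.distrib add_diff_add)
    show "l r (cst c * x) = c * l r x" if "x \<in> X" for x c
      using pm.subspace_scale[OF K l[OF that], of c]
      by (intro uniq[where c = "\<lambda>i. c * l i x"] pm.subspace_scale[OF X] that r)
        (simp add: right_diff_distrib sum_distrib_left mult.assoc[symmetric])
    show "l r x = 0" if "x \<in> K" for x
      using that KX by (intro uniq[where c = "\<lambda>i. 0"] r) auto
  qed
  define N where "N r s = l r (n (e s))" for r s
  have n0: "n 0 = 0" using nadd[of 0 0] by simp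
  have nsum: "n (\<Sum>i\<in>A. cst (c i) * e i) = (\<Sum>i\<in>A. cst (c i) * n (e i))" for A c
    by (induction A rule: infinite_finite_induct) (auto simp: n0 nadd nsc)
  show ?thesis
  proof (rule that[OF e(1) ind sp lin])
    show "x \<in> K" if "x \<in> X" "\<And>r. r < \<mu> \<Longrightarrow> l r x = 0" for x
      using l[OF that(1)] that(2) by simp
    show "l r (n x) = (\<Sum>s<\<mu>. N r s * l s x)" if r: "r < \<mu>" and x: "x \<in> X" for r x
    proof -
      let ?y = "\<Sum>i<\<mu>. cst (l i x) * e i"
      have y: "?y \<in> X" using e(1) by (intro pm.subspace_sum[OF X] pm.subspace_scale[OF X]) auto
      have "n ((x - ?y) + ?y) = n (x - ?y) + n ?y" by (rule nadd)
      then have "n x - n ?y = n (x - ?y)" by simp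
      also have "\<dots> \<in> K" using nK l[OF x] by blast
      finally have "l r (n x) = l r (n ?y)"
        using nX x y by (intro linear_mod_cong[OF lin[OF r] X KX]) auto
      also have "\<dots> = (\<Sum>s<\<mu>. l s x * l r (n (e s)))"
        using nX e(1) unfolding nsum by (intro linear_mod_sum[OF lin[OF r] X]) auto
      finally show ?thesis by (simp add: N_def mult.commute)
    qed
    show "N r s = 0" if sr: "s \<le> r" and r: "r < \<mu>" for r s
    proof -
      have s: "s < \<mu>" using sr r by simp
      obtain c where c: "n (e s) - (\<Sum>i<s. cst (c i) * e i) \<in> K"
        using span_Un_image[OF K e(3)[OF s]] by blast
      have "(\<Sum>i<\<mu>. cst (if i < s then c i else 0) * e i) = (\<Sum>i<s. cst (c i) * e i)"
        using s by (intro sum.mono_neutral_cong_right) auto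
      then have "l r (n (e s)) = (if r < s then c r else 0)"
        using c by (intro uniq[where c = "\<lambda>i. if i < s then c i else 0"] nX e(1) s r) auto
      then show ?thesis using sr by (simp add: N_def)
    qed
  qed auto
qed

section \<open>Rational cones\<close>

lemma convex_cone_hull_finite:
  fixes V :: "'a::real_vector set"
  assumes "finite V"
  shows "convex_cone hull V = {\<Sum>v\<in>V. c v *\<^sub>R v |c. \<forall>v\<in>V. 0 \<le> c v}" (is "_ = ?R")
proof
  show "convex_cone hull V \<subseteq> ?R"
  proof (rule hull_minimal)
    show "V \<subseteq> ?R"
    proof
      fix v assume v: "v \<in> V"
      have "v = (\<Sum>w\<in>V. if w = v then v else 0)" using v assms by simp
      also have "\<dots> = (\<Sum>w\<in>V. (if w = v then 1 else 0) *\<^sub>R w)" by (intro sum.cong) auto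
      finally show "v \<in> ?R" by (intro CollectI exI[of _ "\<lambda>w. if w = v then 1 else 0"]) auto
    qed
    show "convex_cone ?R"
      unfolding convex_cone_iff
    proof (intro conjI ballI allI impI)
      show "0 \<in> ?R" by (intro CollectI exI[of _ "\<lambda>_. 0"]) auto
      show "x + y \<in> ?R" if xy: "x \<in> ?R" "y \<in> ?R" for x y
      proof -
        obtain c d where "x = (\<Sum>v\<in>V. c v *\<^sub>R v)" "y = (\<Sum>v\<in>V. d v *\<^sub>R v)" "\<forall>v\<in>V. 0 \<le> c v" "\<forall>v\<in>V. 0 \<le> d v"
          using xy by blast
        then show ?thesis
          by (intro CollectI exI[of _ "\<lambda>v. c v + d v"]) (auto simp: scaleR_add_left sum.distrib)
      qed
      show "r *\<^sub>R x \<in> ?R" if x: "x \<in> ?R" and r: "0 \<le> r" for r x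
      proof -
        obtain c where "x = (\<Sum>v\<in>V. c v *\<^sub>R v)" "\<forall>v\<in>V. 0 \<le> c v" using x by blast
        then show ?thesis using r
          by (intro CollectI exI[of _ "\<lambda>v. r * c v"]) (auto simp: scaleR_sum_right)
      qed
    qed
  qed
  have "(\<Sum>v\<in>W. c v *\<^sub>R v) \<in> convex_cone hull V" if "finite W" "W \<subseteq> V" "\<forall>v\<in>V. 0 \<le> c v" for c W
    using that
  proof (induction W rule: finite_induct)
    case empty
    then show ?case by (simp add: convex_cone_hull_contains_0)
  next
    case (insert w W)
    then show ?case
      by (auto intro!: convex_cone_hull_add convex_cone_hull_mul intro: hull_inc)
  qed
  then show "?R \<subseteq> convex_cone hull V" using assms by auto
qed

lemma ray_hull: "convex_cone hull {v} = {c *\<^sub>R v |c. 0 \<le> (c::real)}"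
  by (subst convex_cone_hull_finite) auto

lemma pointed_sum_zero:
  fixes \<sigma> :: "'a::real_vector set"
  assumes "\<sigma> \<inter> uminus ` \<sigma> = {0}" "x \<in> \<sigma>" "y \<in> \<sigma>" "x + y = 0"
  shows "x = 0"
proof -
  have "x = - y" using assms(4) by (simp add: eq_neg_iff_add_eq_0)
  then have "x \<in> \<sigma> \<inter> uminus ` \<sigma>" using assms(2,3) by blast
  then show ?thesis using assms(1) by blast
qed

text \<open>Let \<open>x + y = s v\<close> with \<open>x\<close> and \<open>y\<close> in the cone,
  both expanded in the generators. The coefficients of \<open>v\<close> add up to at least
  \<open>s\<close>, since otherwise \<open>v\<close> would be a combination of the other generators.
  With \<open>s v\<close> moved to the other side, elements of a pointed cone add up to zero, so
  every term with a generator other than \<open>v\<close> vanishes and \<open>x\<close> is a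
  multiple of \<open>v\<close>.\<close>

lemma ray_of_minimal_generator:
  fixes V :: "'a::real_vector set"
  assumes fin: "finite V" and \<sigma>: "\<sigma> = convex_cone hull V" and pointed: "\<sigma> \<inter> uminus ` \<sigma> = {0}"
    and mini: "\<And>w. w \<in> V \<Longrightarrow> w \<notin> convex_cone hull (V - {w})" and v: "v \<in> V"
  shows "(convex_cone hull {v}) face_of \<sigma>"
proof -
  let ?\<rho> = "convex_cone hull {v}"
  have key: "x \<in> ?\<rho>" if xy: "x \<in> \<sigma>" "y \<in> \<sigma>" "x + y \<in> ?\<rho>" for x y
  proof -
    obtain a where a: "x = (\<Sum>w\<in>V. a w *\<^sub>R w)" "\<forall>w\<in>V. 0 \<le> a w"
      using xy(1) unfolding \<sigma> convex_cone_hull_finite[OF fin] by blast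
    obtain b where b: "y = (\<Sum>w\<in>V. b w *\<^sub>R w)" "\<forall>w\<in>V. 0 \<le> b w"
      using xy(2) unfolding \<sigma> convex_cone_hull_finite[OF fin] by blast
    obtain s where s: "x + y = s *\<^sub>R v" "0 \<le> s" using xy(3) by (auto simp: ray_hull)
    define rest where "rest = (\<Sum>w\<in>V - {v}. (a w + b w) *\<^sub>R w)"
    have eq: "rest + (a v + b v - s) *\<^sub>R v = 0"
    proof -
      have "x + y = (\<Sum>w\<in>V. (a w + b w) *\<^sub>R w)" by (simp add: a b scaleR_add_left sum.distrib)
      also have "\<dots> = (a v + b v) *\<^sub>R v + rest" unfolding rest_def using fin v by (simp add: sum.remove)
      finally show ?thesis using s(1) by (simp add: algebra_simps)
    qed
    have restV: "rest \<in> convex_cone hull (V - {v})"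
      unfolding rest_def convex_cone_hull_finite[OF finite_Diff[OF fin]] using a b by auto
    have ge: "s \<le> a v + b v"
    proof (rule ccontr)
      assume "\<not> s \<le> a v + b v"
      then have pos: "0 < s - (a v + b v)" by simp
      then have "v = inverse (s - (a v + b v)) *\<^sub>R ((s - (a v + b v)) *\<^sub>R v)" by simp
      also have "(s - (a v + b v)) *\<^sub>R v = rest"
        using eq by (simp add: algebra_simps add_eq_0_iff2)
      finally have "v \<in> convex_cone hull (V - {v})"
        using convex_cone_hull_mul[OF restV, of "inverse (s - (a v + b v))"] pos by simp
      then show False using mini v by blast
    qed
    have a0: "a w = 0" if w: "w \<in> V" "w \<noteq> v" for w
    proof -
      define rest' where "rest' = (\<Sum>z\<in>V - {v} - {w}. (a z + b z) *\<^sub>R z)"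
      have "rest = (a w + b w) *\<^sub>R w + rest'"
        unfolding rest_def rest'_def using fin w by (intro sum.remove) auto
      then have "(a w + b w) *\<^sub>R w + (rest' + (a v + b v - s) *\<^sub>R v) = 0" using eq by (simp add: add.assoc)
      moreover have "(a w + b w) *\<^sub>R w \<in> \<sigma>"
        unfolding \<sigma> using a b w by (intro convex_cone_hull_mul hull_inc) auto
      moreover have "rest' \<in> convex_cone hull (V - {v} - {w})"
        unfolding rest'_def convex_cone_hull_finite[OF finite_Diff[OF finite_Diff[OF fin]]] using a b by auto
      then have "rest' \<in> \<sigma>"
        unfolding \<sigma> using hull_mono[of "V - {v} - {w}" V convex_cone] by blast
      then have "rest' + (a v + b v - s) *\<^sub>R v \<in> \<sigma>"
        unfolding \<sigma> using v ge by (auto intro!: convex_cone_hull_add convex_cone_hull_mul intro: hull_inc)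
      ultimately have "(a w + b w) *\<^sub>R w = 0" using pointed_sum_zero[OF pointed] by blast
      moreover have "w \<noteq> 0" using mini[OF w(1)] convex_cone_hull_contains_0 by metis
      ultimately have "a w + b w = 0" by simp
      then show "a w = 0" using a b w by (meson add_nonneg_eq_0_iff)
    qed
    have "x = (\<Sum>w\<in>V. if w = v then a v *\<^sub>R v else 0)"
      unfolding a(1) by (intro sum.cong) (auto simp: a0)
    also have "\<dots> = a v *\<^sub>R v" using fin v by simp
    finally show "x \<in> ?\<rho>" using a(2) v by (auto simp: ray_hull)
  qed
  show ?thesis
    unfolding face_of_def
  proof (intro conjI ballI impI)
    show "?\<rho> \<subseteq> \<sigma>" unfolding \<sigma> using v by (intro hull_mono) auto
    show "convex ?\<rho>" by (rule convex_convex_cone_hull)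
    fix a b x assume ab: "a \<in> \<sigma>" "b \<in> \<sigma>" and x: "x \<in> ?\<rho>" "x \<in> open_segment a b"
    obtain t where t: "0 < t" "t < 1" "x = (1 - t) *\<^sub>R a + t *\<^sub>R b"
      using x(2) unfolding in_segment by blast
    have mem: "(1 - t) *\<^sub>R a \<in> \<sigma>" "t *\<^sub>R b \<in> \<sigma>"
      using ab t unfolding \<sigma> by (auto intro!: convex_cone_hull_mul)
    have "(1 - t) *\<^sub>R a \<in> ?\<rho>" using key[OF mem] x(1) t(3) by simp
    moreover have "t *\<^sub>R b \<in> ?\<rho>" using key[OF mem(2,1)] x(1) t(3) by (simp add: add.commute)
    ultimately show "a \<in> ?\<rho>" "b \<in> ?\<rho>"
      using convex_cone_hull_mul[of "(1 - t) *\<^sub>R a" "{v}" "inverse (1 - t)"]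
        convex_cone_hull_mul[of "t *\<^sub>R b" "{v}" "inverse t"] t by simp_all
  qed
qed

lemma ex_minimal_generators:
  fixes V :: "'a::real_vector set"
  assumes "finite V"
  obtains W where "W \<subseteq> V" "convex_cone hull W = convex_cone hull V"
    "\<And>w. w \<in> W \<Longrightarrow> w \<notin> convex_cone hull (W - {w})"
proof -
  let ?P = "\<lambda>W. W \<subseteq> V \<and> convex_cone hull W = convex_cone hull V"
  obtain W where W: "?P W" and mini: "\<And>W'. ?P W' \<Longrightarrow> card W \<le> card W'"
    using ex_has_least_nat[of ?P V card] by blast
  show ?thesis
  proof (rule that[of W])
    fix w assume w: "w \<in> W"
    have finW: "finite W" using W assms finite_subset by blast
    show "w \<notin> convex_cone hull (W - {w})"
    proof
      assume "w \<in> convex_cone hull (W - {w})"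
      then have "W \<subseteq> convex_cone hull (W - {w})" using hull_subset[of "W - {w}" convex_cone] by blast
      then have "convex_cone hull W \<subseteq> convex_cone hull (W - {w})"
        by (rule hull_minimal) (rule convex_cone_convex_cone_hull)
      moreover have "convex_cone hull (W - {w}) \<subseteq> convex_cone hull W" by (rule hull_mono) auto
      ultimately have "?P (W - {w})" using W by auto
      then have "card W \<le> card (W - {w})" by (rule mini)
      then show False using w finW by (metis card_Diff1_less not_le)
    qed
  qed (use W in auto)
qed

section \<open>Pairing of characters with the ray generators\<close>

lemma FT_nth: "FT u m $ i = (\<Sum>j\<in>UNIV. u i $ j * m $ j)"
  by (simp add: FT_def matrix_vector_mult_def)

lemma inner_real_vec: "inner (real_vec m) (real_vec (u i)) = of_int (FT u m $ i)"
  by (simp add: inner_vec_def real_vec_def FT_nth mult.commute)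

lemma FT_add: "FT u (a + b) = FT u a + FT u b"
  by (simp add: Finite_Cartesian_Product.vec_eq_iff FT_nth sum.distrib algebra_simps)

lemma FT_0 [simp]: "FT u 0 = 0"
  by (simp add: Finite_Cartesian_Product.vec_eq_iff FT_nth)

lemma FT_uminus: "FT u (- a) = - FT u a"
  using FT_add[of u a "- a"] by (simp add: eq_neg_iff_add_eq_0 add.commute)

lemma FT_diff: "FT u (a - b) = FT u a - FT u b"
  using FT_add[of u a "- b"] by (simp add: FT_uminus)

lemma FT_sum: "FT u (sum f A) = (\<Sum>a\<in>A. FT u (f a))"
  by (induction A rule: infinite_finite_induct) (auto simp: FT_add)

text \<open>Dirichlet's theorem makes the approximation \<open>q \<theta>\<close> of the real functional so good that the
  integers \<open>\<langle>u i, p\<rangle>\<close> vanish or are positive together with \<open>\<langle>u i, \<theta>\<rangle>\<close>.\<close>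

lemma integral_functional:
  fixes u :: "'k::finite \<Rightarrow> int^'n::finite" and \<theta> :: "real^'n"
  obtains m :: "int^'n" where "\<And>i. inner \<theta> (real_vec (u i)) = 0 \<Longrightarrow> FT u m $ i = 0"
    "\<And>i. inner \<theta> (real_vec (u i)) > 0 \<Longrightarrow> FT u m $ i > 0"
proof -
  obtain h :: "nat \<Rightarrow> 'n" and n where h: "bij_betw h {..<n} UNIV"
    using ex_bij_betw_nat_finite[OF finite_class.finite_UNIV] lessThan_atLeast0 by metis
  \<comment> \<open>A bound that serves all \<open>u i\<close> at once: coordinates approximated up
    to \<open>1 / N\<close> change each pairing by at most \<open>S / N\<close>.\<close>
  define S where "S = (\<Sum>i\<in>UNIV. \<Sum>j\<in>UNIV. \<bar>real_of_int (u i $ j)\<bar>)"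
  define P where "P = {i. inner \<theta> (real_vec (u i)) > 0}"
  \<comment> \<open>At most 1, so that an integer closer to 0 than \<open>\<epsilon>\<close> is 0;
    at most each positive pairing, so that an approximation of its multiple by \<open>q\<close>,
    which is a positive integer, remains positive.\<close>
  define \<epsilon> where "\<epsilon> = Min (insert 1 ((\<lambda>i. inner \<theta> (real_vec (u i))) ` P))"
  have \<epsilon>: "0 < \<epsilon>" "\<epsilon> \<le> 1" "\<And>i. inner \<theta> (real_vec (u i)) > 0 \<Longrightarrow> \<epsilon> \<le> inner \<theta> (real_vec (u i))"
    unfolding \<epsilon>_def P_def by (subst Min_gr_iff) auto
  obtain N :: nat where N: "S / \<epsilon> < N" using reals_Archimedean2 by blast
  have "0 \<le> S" by (simp add: S_def sum_nonneg)
  then have N0: "N > 0" using N \<epsilon>(1) by (metis divide_nonneg_pos gr0I less_le_not_le of_nat_0)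
  have SN: "S / N < \<epsilon>" using N N0 \<epsilon>(1) by (simp add: field_simps)
  obtain q p where q: "0 < q" and p: "\<And>k. k < n \<Longrightarrow> \<bar>of_int q * \<theta> $ h k - of_int (p k)\<bar> < 1 / N"
    using Dirichlet_approx_simult[OF N0, where n = n and \<theta> = "\<lambda>k. \<theta> $ h k"] by metis
  define m :: "int^'n" where "m = (\<chi> j. p (the_inv_into {..<n} h j))"
  have m: "\<bar>of_int q * \<theta> $ j - of_int (m $ j)\<bar> \<le> 1 / N" for j
  proof -
    obtain k where "k < n" "j = h k" using h unfolding bij_betw_def by auto
    then show ?thesis using p[of k] h by (simp add: m_def bij_betw_def the_inv_into_f_f)
  qed
  have close: "\<bar>of_int q * inner \<theta> (real_vec (u i)) - of_int (FT u m $ i)\<bar> < \<epsilon>" for i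
  proof -
    have "of_int q * inner \<theta> (real_vec (u i)) - of_int (FT u m $ i)
        = (\<Sum>j\<in>UNIV. of_int (u i $ j) * (of_int q * \<theta> $ j - of_int (m $ j)))"
      by (simp add: inner_vec_def real_vec_def FT_nth sum_distrib_left sum_subtractf algebra_simps)
    also have "\<bar>\<dots>\<bar> \<le> (\<Sum>j\<in>UNIV. \<bar>of_int (u i $ j)\<bar> * (1 / N))"
      by (rule order_trans[OF sum_abs]) (intro sum_mono, auto simp only: abs_mult intro!: mult_left_mono m)
    also have "\<dots> = (\<Sum>j\<in>UNIV. \<bar>real_of_int (u i $ j)\<bar>) / N"
      by (simp add: sum_divide_distrib)
    also have "\<dots> \<le> S / N"
      unfolding S_def by (intro divide_right_mono member_le_sum) (auto intro: sum_nonneg)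
    finally show ?thesis using SN by simp
  qed
  show ?thesis
  proof (rule that[of m])
    fix i assume "inner \<theta> (real_vec (u i)) = 0"
    then have "\<bar>real_of_int (FT u m $ i)\<bar> < 1" using close[of i] \<epsilon>(2) by simp
    then show "FT u m $ i = 0" by linarith
  next
    fix i assume pos: "inner \<theta> (real_vec (u i)) > 0"
    have "1 * inner \<theta> (real_vec (u i)) \<le> of_int q * inner \<theta> (real_vec (u i))"
      using q pos by (intro mult_right_mono) auto
    then have "\<epsilon> \<le> of_int q * inner \<theta> (real_vec (u i))" using \<epsilon>(3)[OF pos] by simp
    then have "real_of_int (FT u m $ i) > 0" using close[of i] by linarith
    then show "FT u m $ i > 0" by simp
  qed
qed

section \<open>Dickson's lemma and Hilbert bases\<close>

text \<open>One coordinate at a time, by passing to monotone subsequences. A decreasing sequence of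
  natural numbers is constant from the place of its minimum on, so a tail of it is nondecreasing as
  well.\<close>

lemma dickson_mono:
  fixes s :: "nat \<Rightarrow> 'b \<Rightarrow> nat"
  assumes "finite B"
  obtains r :: "nat \<Rightarrow> nat" where "strict_mono r" "\<And>b i j. b \<in> B \<Longrightarrow> i \<le> j \<Longrightarrow> s (r i) b \<le> s (r j) b"
  using assms
proof (induction B arbitrary: thesis rule: finite_induct)
  case empty
  show ?case by (rule empty[of "\<lambda>n. n"]) (auto simp: strict_mono_def)
next
  case (insert b B)
  obtain r :: "nat \<Rightarrow> nat" where r: "strict_mono r" "\<And>b i j. b \<in> B \<Longrightarrow> i \<le> j \<Longrightarrow> s (r i) b \<le> s (r j) b"
    using insert.IH by blast
  obtain q where q: "strict_mono q" "monoseq (\<lambda>n. s (r (q n)) b)"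
    using seq_monosub[of "\<lambda>n. s (r n) b"] by blast
  obtain k where k: "\<And>i j. k \<le> i \<Longrightarrow> i \<le> j \<Longrightarrow> s (r (q i)) b \<le> s (r (q j)) b"
  proof (cases "\<forall>i j. i \<le> j \<longrightarrow> s (r (q i)) b \<le> s (r (q j)) b")
    case True
    then show ?thesis by (intro that[of 0]) auto
  next
    case False
    then have dec: "s (r (q j)) b \<le> s (r (q i)) b" if "i \<le> j" for i j
      using q(2) that unfolding monoseq_def by blast
    obtain k where "\<forall>n. s (r (q k)) b \<le> s (r (q n)) b"
      using ex_has_least_nat[of "\<lambda>_. True" 0 "\<lambda>n. s (r (q n)) b"] by auto
    then show ?thesis using dec by (intro that[of k]) (meson order_trans)
  qed
  show ?case
  proof (rule insert.prems(1)[of "\<lambda>n. r (q (n + k))"])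
    show "strict_mono (\<lambda>n. r (q (n + k)))"
      using r(1) q(1) by (auto simp: strict_mono_def)
    fix b' i j assume b': "b' \<in> insert b B" and ij: "i \<le> (j::nat)"
    have "q (i + k) \<le> q (j + k)" using q(1) ij by (simp add: strict_mono_less_eq)
    then show "s (r (q (i + k))) b' \<le> s (r (q (j + k))) b'"
      using b' r(2) k[of "i + k" "j + k"] ij by auto
  qed
qed

definition norm1 :: "int^'n::finite \<Rightarrow> nat" where
  "norm1 m = (\<Sum>j\<in>UNIV. nat \<bar>m $ j\<bar>)"

lemma norm1_eq_0: "norm1 m = 0 \<longleftrightarrow> m = 0"
  by (auto simp: norm1_def Finite_Cartesian_Product.vec_eq_iff)

text \<open>Irreducibility is taken within an orthant, so that the units of the monoid, on which all
  pairings vanish, are generated as well.\<close>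

lemma hilbert_basis:
  fixes u :: "'k::finite \<Rightarrow> int^'n::finite" and R :: "'k set"
  defines "D \<equiv> {m. \<forall>i\<in>R. 0 \<le> FT u m $ i}"
  obtains G where "finite G" "G \<subseteq> D"
    "\<And>S m. 0 \<in> S \<Longrightarrow> (\<And>s g. s \<in> S \<Longrightarrow> g \<in> G \<Longrightarrow> s + g \<in> S) \<Longrightarrow> m \<in> D \<Longrightarrow> m \<in> S"
proof -
  define G where "G = {m \<in> D. m \<noteq> 0 \<and> \<not> (\<exists>a\<in>D. \<exists>b\<in>D. a \<noteq> 0 \<and> b \<noteq> 0 \<and> m = a + b \<and> norm1 m = norm1 a + norm1 b)}"
  \<comment> \<open>Pairings with \<open>R\<close> together with the positive and negative parts of
    the coordinates. If \<open>s a\<close> is below \<open>s b\<close> everywhere, then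
    \<open>b - a\<close> is in \<open>D\<close> and nothing cancels in
    \<open>b = a + (b - a)\<close>, so the norms add and \<open>b\<close> is not
    irreducible.\<close>
  define s :: "int^'n \<Rightarrow> 'k + ('n + 'n) \<Rightarrow> nat" where
    "s m = case_sum (\<lambda>i. if i \<in> R then nat (FT u m $ i) else 0) (case_sum (\<lambda>j. nat (m $ j)) (\<lambda>j. nat (- m $ j)))" for m
  have "finite G"
  proof (rule ccontr)
    assume "infinite G"
    then obtain f :: "nat \<Rightarrow> int^'n" where f: "inj f" "range f \<subseteq> G"
      using infinite_countable_subset by blast
    obtain r :: "nat \<Rightarrow> nat" where r: "strict_mono r" "\<And>b i j. i \<le> j \<Longrightarrow> s (f (r i)) b \<le> s (f (r j)) b"
      using dickson_mono[of UNIV "\<lambda>n. s (f n)"] by auto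
    define a b where "a = f (r 0)" and "b = f (r 1)"
    have ab: "a \<in> G" "b \<in> G" using f(2) by (auto simp: a_def b_def)
    have "r 0 \<noteq> r 1" using r(1) strict_mono_eq[of r 0 1] by simp
    then have "a \<noteq> b" using f(1) by (auto simp: a_def b_def dest: injD)
    have le: "s a x \<le> s b x" for x using r(2)[of 0 1 x] by (simp add: a_def b_def)
    have D: "a \<in> D" "b \<in> D" using ab by (auto simp: G_def)
    have "b - a \<in> D"
      unfolding D_def
    proof (intro CollectI ballI)
      fix i assume i: "i \<in> R"
      then show "0 \<le> FT u (b - a) $ i"
        using le[of "Inl i"] D by (auto simp: s_def D_def FT_diff)
    qed
    moreover have "norm1 b = norm1 a + norm1 (b - a)"
      unfolding norm1_def sum.distrib[symmetric]
    proof (intro sum.cong refl)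
      fix j
      show "nat \<bar>b $ j\<bar> = nat \<bar>a $ j\<bar> + nat \<bar>(b - a) $ j\<bar>"
        using le[of "Inr (Inl j)"] le[of "Inr (Inr j)"] by (simp add: s_def) arith
    qed
    moreover have "b = a + (b - a)" "a \<noteq> 0" "b - a \<noteq> 0" using ab \<open>a \<noteq> b\<close> by (auto simp: G_def)
    ultimately show False using ab(2) D unfolding G_def by blast
  qed
  moreover have "G \<subseteq> D" by (auto simp: G_def)
  moreover have "m \<in> S" if S0: "0 \<in> S" and Sg: "\<And>s g. s \<in> S \<Longrightarrow> g \<in> G \<Longrightarrow> s + g \<in> S" and m: "m \<in> D" for S m
  proof -
    \<comment> \<open>Strengthened to translation of all of \<open>S\<close> by \<open>m\<close>, so
      that a decomposition \<open>m = a + b\<close> acts as two translations in succession.\<close>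
    have "\<forall>s\<in>S. s + m \<in> S" using m
    proof (induction "norm1 m" arbitrary: m rule: less_induct)
      case less
      show ?case
      proof (cases "m = 0 \<or> m \<in> G")
        case True
        then show ?thesis using Sg by auto
      next
        case False
        then obtain a b where ab: "a \<in> D" "b \<in> D" "a \<noteq> 0" "b \<noteq> 0" "m = a + b" "norm1 m = norm1 a + norm1 b"
          using less.prems unfolding G_def by blast
        then have "norm1 a < norm1 m" "norm1 b < norm1 m" using norm1_eq_0 by (metis add.commute gr0I less_add_same_cancel1)+
        then have "\<forall>s\<in>S. s + a \<in> S" "\<forall>s\<in>S. s + b \<in> S" using less.hyps ab by blast+
        then show ?thesis unfolding ab(5) by (metis add.assoc)
      qed
    qed
    then show ?thesis using S0 by force
  qed
  ultimately show ?thesis by (rule that)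
qed

section \<open>Cones of a fan and their rays\<close>

locale toric =
  fixes \<Sigma> :: "(real^'n::finite) set set" and u :: "'k::finite \<Rightarrow> int^'n"
  assumes compl: "complete_fan \<Sigma>" and rays: "ray_generators \<Sigma> u"
begin

lemma fan: "fan \<Sigma>"
  using compl by (simp add: complete_fan_def)

lemma face_in_fan: "\<sigma> \<in> \<Sigma> \<Longrightarrow> \<tau> face_of \<sigma> \<Longrightarrow> \<tau> \<noteq> {} \<Longrightarrow> \<tau> \<in> \<Sigma>"
  using fan by (auto simp: fan_def)

lemma ray_eq: "ray (u i) = {c *\<^sub>R real_vec (u i) |c. 0 \<le> c}"
  by (simp add: ray_def ray_hull)

lemma real_vec_in_ray: "real_vec (u i) \<in> ray (u i)"
  by (auto simp: ray_eq intro!: exI[of _ 1])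

lemma cone_zero: "\<sigma> \<in> \<Sigma> \<Longrightarrow> 0 \<in> \<sigma>"
  using fan unfolding fan_def rational_polyhedral_cone_def by (metis convex_cone_hull_contains_0)

text \<open>In a minimal generating set every vector spans a one-dimensional face by
  \<open>ray_of_minimal_generator\<close>. Faces belong to the fan, so this face is one of the
  enumerated rays.\<close>

lemma cone_rays_generate:
  assumes \<sigma>: "\<sigma> \<in> \<Sigma>"
  shows "\<sigma> = convex_cone hull ((\<lambda>i. real_vec (u i)) ` cone_rays u \<sigma>)"
proof -
  have "rational_polyhedral_cone \<sigma>" "strongly_convex \<sigma>"
    using fan \<sigma> by (auto simp: fan_def)
  then obtain V0 where V0: "finite V0" "\<sigma> = convex_cone hull (real_vec ` V0)"
    and pointed: "\<sigma> \<inter> uminus ` \<sigma> = {0}"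
    by (auto simp: rational_polyhedral_cone_def strongly_convex_def)
  obtain V where V: "V \<subseteq> real_vec ` V0" "convex_cone hull V = \<sigma>"
    and mini: "\<And>w. w \<in> V \<Longrightarrow> w \<notin> convex_cone hull (V - {w})"
    using ex_minimal_generators[of "real_vec ` V0"] V0 by auto
  have finV: "finite V" using V(1) V0(1) finite_surj by blast
  show ?thesis
  proof
    have "V \<subseteq> convex_cone hull ((\<lambda>i. real_vec (u i)) ` cone_rays u \<sigma>)"
    proof
      fix v assume v: "v \<in> V"
      have face: "(convex_cone hull {v}) face_of \<sigma>"
        by (rule ray_of_minimal_generator[OF finV _ pointed mini v]) (simp_all add: V(2))
      have "v \<noteq> 0" using mini[OF v] convex_cone_hull_contains_0 by metis
      have vin: "v \<in> convex_cone hull {v}" by (rule hull_inc) simp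
      have "dim (convex_cone hull {v}) = 1"
      proof -
        have "span (convex_cone hull {v}) = span {v}"
        proof
          show "span (convex_cone hull {v}) \<subseteq> span {v}"
            by (rule span_minimal) (auto simp: ray_hull intro: span_scale span_base)
          show "span {v} \<subseteq> span (convex_cone hull {v})"
            using vin by (intro span_mono) auto
        qed
        then have "dim (convex_cone hull {v}) = dim {v}" by (metis dim_span)
        then show ?thesis using \<open>v \<noteq> 0\<close> by (simp add: dim_insert)
      qed
      moreover have "convex_cone hull {v} \<in> \<Sigma>" using face_in_fan[OF \<sigma> face] vin by blast
      ultimately have "convex_cone hull {v} \<in> range (\<lambda>i. ray (u i))"
        using rays by (simp add: ray_generators_def bij_betw_def)
      then obtain i where i: "convex_cone hull {v} = ray (u i)" by blast
      then have "i \<in> cone_rays u \<sigma>" using face by (simp add: cone_rays_def)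
      then have "ray (u i) \<subseteq> convex_cone hull ((\<lambda>i. real_vec (u i)) ` cone_rays u \<sigma>)"
        unfolding ray_def by (intro hull_mono) auto
      then show "v \<in> convex_cone hull ((\<lambda>i. real_vec (u i)) ` cone_rays u \<sigma>)"
        using vin i by blast
    qed
    then show "\<sigma> \<subseteq> convex_cone hull ((\<lambda>i. real_vec (u i)) ` cone_rays u \<sigma>)"
      unfolding V(2)[symmetric] by (rule hull_minimal) (rule convex_cone_convex_cone_hull)
    have "(\<lambda>i. real_vec (u i)) ` cone_rays u \<sigma> \<subseteq> \<sigma>"
      using real_vec_in_ray face_of_imp_subset by (fastforce simp: cone_rays_def)
    then show "convex_cone hull ((\<lambda>i. real_vec (u i)) ` cone_rays u \<sigma>) \<subseteq> \<sigma>"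
      using V(2) convex_cone_convex_cone_hull by (intro hull_minimal) auto
  qed
qed

lemma real_vec_in_cone: "i \<in> cone_rays u \<sigma> \<Longrightarrow> real_vec (u i) \<in> \<sigma>"
  using real_vec_in_ray face_of_imp_subset by (fastforce simp: cone_rays_def)

lemma ray_in_subcone:
  assumes "\<tau> \<in> \<Sigma>" "real_vec (u i) \<in> \<tau>" "\<tau> \<subseteq> \<sigma>" "i \<in> cone_rays u \<sigma>"
  shows "i \<in> cone_rays u \<tau>"
proof -
  have "convex_cone \<tau>"
    using cone_rays_generate[OF assms(1)] convex_cone_convex_cone_hull by metis
  then have "ray (u i) \<subseteq> \<tau>"
    unfolding ray_def using assms(2) by (intro hull_minimal) auto
  then show ?thesis
    using assms unfolding cone_rays_def by (auto intro: face_of_subset)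
qed

lemma dual_monoid_iff:
  assumes "\<sigma> \<in> \<Sigma>"
  shows "m \<in> dual_monoid \<sigma> \<longleftrightarrow> (\<forall>i\<in>cone_rays u \<sigma>. 0 \<le> FT u m $ i)"
proof
  show "m \<in> dual_monoid \<sigma> \<Longrightarrow> \<forall>i\<in>cone_rays u \<sigma>. 0 \<le> FT u m $ i"
    using real_vec_in_cone by (auto simp: dual_monoid_def inner_real_vec dest!: bspec)
  assume "\<forall>i\<in>cone_rays u \<sigma>. 0 \<le> FT u m $ i"
  then have "convex_cone hull ((\<lambda>i. real_vec (u i)) ` cone_rays u \<sigma>) \<subseteq> {x. inner (real_vec m) x \<ge> 0}"
    by (intro hull_minimal convex_cone_halfspace_ge) (auto simp: inner_real_vec)
  then show "m \<in> dual_monoid \<sigma>"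
    using cone_rays_generate[OF assms] by (auto simp: dual_monoid_def)
qed

lemma submonoid_dual: "submonoid_of (dual_monoid (\<sigma> :: (real^'n) set))"
proof -
  have "real_vec (a + b) = real_vec a + real_vec b" for a b :: "int^'n"
    by (simp add: real_vec_def Finite_Cartesian_Product.vec_eq_iff)
  moreover have "real_vec 0 = (0 :: real^'n)"
    by (simp add: real_vec_def Finite_Cartesian_Product.vec_eq_iff)
  ultimately show ?thesis by (auto simp: submonoid_of_def dual_monoid_def inner_add_left)
qed

text \<open>Faces of a polyhedral cone are exposed, and the exposing hyperplane passes through 0
  because \<open>\<tau>\<close> contains 0. Its real normal is replaced by an integral one with the
  same sign pattern on the rays. The resulting character is invertible along the orbit of
  \<open>\<tau>\<close>, and its powers clear negative exponents at the other rays of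
  \<open>\<sigma>\<close>; this is how statements move between charts.\<close>

lemma face_functional:
  assumes \<sigma>: "\<sigma> \<in> \<Sigma>" and \<tau>: "\<tau> \<in> \<Sigma>" and sub: "\<tau> \<subseteq> \<sigma>"
  obtains m where "\<And>i. i \<in> cone_rays u \<tau> \<Longrightarrow> FT u m $ i = 0"
    "\<And>i. i \<in> cone_rays u \<sigma> \<Longrightarrow> i \<notin> cone_rays u \<tau> \<Longrightarrow> 0 < FT u m $ i"
proof -
  have face: "\<tau> face_of \<sigma>"
    using fan \<sigma> \<tau> sub unfolding fan_def by (metis inf.absorb_iff2)
  have "rational_polyhedral_cone \<sigma>" using fan \<sigma> unfolding fan_def by blast
  then obtain V where "finite V" "\<sigma> = convex_cone hull (real_vec ` V)"
    unfolding rational_polyhedral_cone_def by blast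
  then have "polyhedron \<sigma>" by (simp add: polyhedron_convex_cone_hull)
  then have "\<tau> exposed_face_of \<sigma>" using face exposed_face_of_polyhedron by blast
  then obtain a b where ab: "\<sigma> \<subseteq> {x. inner a x \<le> b}" "\<tau> = \<sigma> \<inter> {x. inner a x = b}"
    by (auto simp: exposed_face_of_def)
  have b: "b = 0" using cone_zero[OF \<tau>] ab(2) by simp
  obtain m where m: "\<And>i. inner (- a) (real_vec (u i)) = 0 \<Longrightarrow> FT u m $ i = 0"
    "\<And>i. inner (- a) (real_vec (u i)) > 0 \<Longrightarrow> FT u m $ i > 0"
    using integral_functional[of "- a" u] by blast
  show ?thesis
  proof (rule that[of m])
    show "FT u m $ i = 0" if "i \<in> cone_rays u \<tau>" for i
      using m(1)[of i] real_vec_in_cone[OF that] ab(2) b by simp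
    show "0 < FT u m $ i" if i: "i \<in> cone_rays u \<sigma>" "i \<notin> cone_rays u \<tau>" for i
    proof -
      have "real_vec (u i) \<notin> \<tau>" using ray_in_subcone[OF \<tau> _ sub i(1)] i(2) by blast
      then have "inner a (real_vec (u i)) \<noteq> 0" using real_vec_in_cone[OF i(1)] ab(2) b by simp
      moreover have "inner a (real_vec (u i)) \<le> 0" using real_vec_in_cone[OF i(1)] ab(1) b by auto
      ultimately show ?thesis by (intro m(2)) simp
    qed
  qed
qed

lemma FT_cone_zero:
  assumes "\<sigma> \<in> \<Sigma>" "\<And>i. i \<in> cone_rays u \<sigma> \<Longrightarrow> FT u m $ i = 0" "x \<in> \<sigma>"
  shows "inner (real_vec m) x = 0"
proof -
  have "m \<in> dual_monoid \<sigma>" "- m \<in> dual_monoid \<sigma>"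
    using assms(2) by (auto simp: dual_monoid_iff[OF assms(1)] FT_uminus)
  moreover have "real_vec (- m) = - real_vec m"
    by (simp add: real_vec_def Finite_Cartesian_Product.vec_eq_iff)
  ultimately show ?thesis using assms(3) by (force simp: dual_monoid_def)
qed

lemma real_vec_eq_0: "real_vec m = 0 \<longleftrightarrow> m = 0"
  by (simp add: real_vec_def Finite_Cartesian_Product.vec_eq_iff)

text \<open>By completeness the vector \<open>a - b\<close> lies in some cone. It is orthogonal to
  all rays, hence to that cone, hence to itself.\<close>

lemma inj_FT: "inj (FT u)"
proof (rule injI)
  fix a b assume "FT u a = FT u b"
  then have 0: "FT u (a - b) = 0" by (simp add: FT_diff)
  have "real_vec (a - b) \<in> \<Union>\<Sigma>" using compl by (simp add: complete_fan_def)
  then obtain \<sigma> where "\<sigma> \<in> \<Sigma>" "real_vec (a - b) \<in> \<sigma>" by blast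
  then have "inner (real_vec (a - b)) (real_vec (a - b)) = 0"
    using FT_cone_zero[of \<sigma> "a - b"] 0 by simp
  then show "a = b" using real_vec_eq_0[of "a - b"] by simp
qed

text \<open>Otherwise the full-dimensional cone would lie in the hyperplane orthogonal to
  \<open>m\<close>.\<close>

lemma maximal_cone_FT_zero:
  assumes "\<sigma> \<in> maximal_cones \<Sigma>" "\<And>i. i \<in> cone_rays u \<sigma> \<Longrightarrow> FT u m $ i = 0"
  shows "m = 0"
proof (rule ccontr)
  assume "m \<noteq> 0"
  then have m: "real_vec m \<noteq> 0" using real_vec_eq_0 by blast
  have "\<sigma> \<subseteq> {x. inner (real_vec m) x = 0}"
    using FT_cone_zero[OF _ assms(2)] assms(1) by (auto simp: maximal_cones_def)
  then have "dim \<sigma> \<le> dim {x. inner (real_vec m) x = 0}" by (rule dim_subset)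
  also have "\<dots> = CARD('n) - 1" using m by (simp add: dim_hyperplane)
  finally have "dim \<sigma> \<le> CARD('n) - 1" .
  moreover have "dim \<sigma> = CARD('n)" using assms(1) unfolding maximal_cones_def by blast
  moreover have "0 < CARD('n)" by (rule zero_less_card_finite)
  ultimately show False by linarith
qed

lemma inter_in_fan: "\<sigma> \<in> \<Sigma> \<Longrightarrow> \<tau> \<in> \<Sigma> \<Longrightarrow> \<sigma> \<inter> \<tau> \<in> \<Sigma>"
  using fan cone_zero face_in_fan[of \<sigma> "\<sigma> \<inter> \<tau>"] unfolding fan_def by blast

lemma cone_rays_inter:
  assumes "\<sigma> \<in> \<Sigma>" "\<tau> \<in> \<Sigma>"
  shows "cone_rays u (\<sigma> \<inter> \<tau>) = cone_rays u \<sigma> \<inter> cone_rays u \<tau>"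
proof
  have "(\<sigma> \<inter> \<tau>) face_of \<sigma>" "(\<sigma> \<inter> \<tau>) face_of \<tau>" using fan assms by (auto simp: fan_def)
  then show "cone_rays u (\<sigma> \<inter> \<tau>) \<subseteq> cone_rays u \<sigma> \<inter> cone_rays u \<tau>"
    by (auto simp: cone_rays_def intro: face_of_trans)
  show "cone_rays u \<sigma> \<inter> cone_rays u \<tau> \<subseteq> cone_rays u (\<sigma> \<inter> \<tau>)"
    using ray_in_subcone[OF inter_in_fan[OF assms], of _ \<sigma>] real_vec_in_cone by auto
qed

lemma cone_rays_subset: "\<sigma> \<in> \<Sigma> \<Longrightarrow> \<tau> \<in> \<Sigma> \<Longrightarrow> cone_rays u \<tau> \<subseteq> cone_rays u \<sigma> \<longleftrightarrow> \<tau> \<subseteq> \<sigma>"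
proof
  assume "\<sigma> \<in> \<Sigma>" "\<tau> \<in> \<Sigma>" "cone_rays u \<tau> \<subseteq> cone_rays u \<sigma>"
  then show "\<tau> \<subseteq> \<sigma>"
    using cone_rays_generate hull_mono[of "(\<lambda>i. real_vec (u i)) ` cone_rays u \<tau>" _ convex_cone]
    by (metis image_mono)
next
  assume "\<sigma> \<in> \<Sigma>" "\<tau> \<in> \<Sigma>" "\<tau> \<subseteq> \<sigma>"
  then show "cone_rays u \<tau> \<subseteq> cone_rays u \<sigma>"
    using cone_rays_inter[of \<sigma> \<tau>] by (metis inf.absorb2 inf_le1)
qed

end

section \<open>Extension of characters\<close>

lemma hom_int_powi:
  fixes f :: "int \<Rightarrow> complex"
  assumes add: "\<And>a b. f (a + b) = f a * f b" and nz: "\<And>a. f a \<noteq> 0"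
  shows "f k = f 1 powi k"
proof -
  have f0: "f 0 = 1" using add[of 0 0] nz[of 0] by simp
  have n: "f (int n) = f 1 ^ n" for n
    by (induction n) (auto simp: f0 add)
  show ?thesis
  proof (cases "k \<ge> 0")
    case True
    then show ?thesis using n[of "nat k"] by (simp add: power_int_def)
  next
    case False
    have "f k * f (- k) = 1" using add[of k "- k"] f0 by simp
    then have "f k = inverse (f (- k))" using nz by (simp add: field_simps)
    then show ?thesis using n[of "nat (- k)"] False by (simp add: power_int_def power_inverse)
  qed
qed

definition subgroup_of :: "'g::ab_group_add set \<Rightarrow> bool" where
  "subgroup_of H \<longleftrightarrow> 0 \<in> H \<and> (\<forall>a\<in>H. \<forall>b\<in>H. a + b \<in> H) \<and> (\<forall>a\<in>H. - a \<in> H)"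

definition character_on :: "'g::ab_group_add set \<Rightarrow> ('g \<Rightarrow> complex) \<Rightarrow> bool" where
  "character_on H \<omega> \<longleftrightarrow> (\<forall>a\<in>H. \<forall>b\<in>H. \<omega> (a + b) = \<omega> a * \<omega> b) \<and> (\<forall>a\<in>H. \<omega> a \<noteq> 0)"

lemma subgroup_ofD:
  assumes "subgroup_of H"
  shows "0 \<in> H" "a \<in> H \<Longrightarrow> b \<in> H \<Longrightarrow> a + b \<in> H" "a \<in> H \<Longrightarrow> - a \<in> H" "a \<in> H \<Longrightarrow> b \<in> H \<Longrightarrow> a - b \<in> H"
proof -
  show *: "0 \<in> H" "a \<in> H \<Longrightarrow> b \<in> H \<Longrightarrow> a + b \<in> H" "a \<in> H \<Longrightarrow> - a \<in> H" for a b
    using assms by (auto simp: subgroup_of_def)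
  show "a \<in> H \<Longrightarrow> b \<in> H \<Longrightarrow> a - b \<in> H" using *(2)[of a "- b"] *(3)[of b] by simp
qed

lemma subgroup_smult:
  fixes w :: "int^'k"
  assumes H: "subgroup_of H" and w: "w \<in> H"
  shows "k *s w \<in> H"
proof -
  have n: "int n *s w \<in> H" for n
    by (induction n) (auto simp: vector_sadd_rdistrib subgroup_ofD[OF H] w)
  show ?thesis
  proof (cases "k \<ge> 0")
    case True
    then show ?thesis using n[of "nat k"] by simp
  next
    case False
    then have "k *s w = - (int (nat (- k)) *s w)" by (simp add: Finite_Cartesian_Product.vec_eq_iff)
    then show ?thesis using subgroup_ofD(3)[OF H n] by metis
  qed
qed

text \<open>The extension sends \<open>v\<close> to \<open>c\<close>. The value \<open>c\<close> is
  constrained only by the multiples of \<open>v\<close> that already lie in \<open>H\<close>, and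
  complex roots satisfy that constraint.\<close>

lemma extend_character_step:
  fixes H :: "(int^'k) set"
  assumes H: "subgroup_of H" and \<omega>: "character_on H \<omega>"
  obtains H' \<omega>' where "subgroup_of H'" "character_on H' \<omega>'" "H \<subseteq> H'" "v \<in> H'" "\<And>a. a \<in> H \<Longrightarrow> \<omega>' a = \<omega> a"
proof -
  have \<omega>D: "\<And>a b. a \<in> H \<Longrightarrow> b \<in> H \<Longrightarrow> \<omega> (a + b) = \<omega> a * \<omega> b" "\<And>a. a \<in> H \<Longrightarrow> \<omega> a \<noteq> 0"
    using \<omega> by (auto simp: character_on_def)
  have \<omega>0: "\<omega> 0 = 1" using \<omega>D(1)[of 0 0] \<omega>D(2)[of 0] subgroup_ofD(1)[OF H] by simp
  \<comment> \<open>If some positive multiple of \<open>v\<close> lies in \<open>H\<close> and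
    \<open>d\<close> is the least such factor, then \<open>c\<close> is a \<open>d\<close>-th root
    of the value at \<open>d\<close> times \<open>v\<close>; all other multiples of \<open>v\<close>
    in \<open>H\<close> are multiples of that one. Otherwise \<open>c\<close> is free, and 1 is
    taken.\<close>
  obtain c :: complex where c0: "c \<noteq> 0" and c: "\<And>z. z *s v \<in> H \<Longrightarrow> \<omega> (z *s v) = c powi z"
  proof (cases "\<exists>d>0. int d *s v \<in> H")
    case True
    define d where "d = (LEAST d. d > 0 \<and> int d *s v \<in> H)"
    have d: "d > 0" "int d *s v \<in> H" using LeastI_ex[OF True] by (auto simp: d_def)
    have dmin: "d \<le> e" if "e > 0" "int e *s v \<in> H" for e
      unfolding d_def using that by (intro Least_le) auto
    define w where "w = int d *s v"
    have w: "w \<in> H" using d by (simp add: w_def)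
    obtain c where c: "\<omega> w = c ^ d" using exists_complex_root[of d "\<omega> w"] d(1) by auto
    have c0: "c \<noteq> 0" using \<omega>D(2)[OF w] c d(1) by auto
    have mult: "\<omega> (k *s w) = \<omega> w powi k" for k
      using hom_int_powi[of "\<lambda>k. \<omega> (k *s w)" k] \<omega>D subgroup_smult[OF H w]
      by (simp add: vector_sadd_rdistrib)
    show ?thesis
    proof (rule that[OF c0])
      fix z assume z: "z *s v \<in> H"
      define q r where "q = z div int d" and "r = z mod int d"
      have zqr: "z = q * int d + r" by (simp add: q_def r_def)
      have "r *s v = z *s v - q *s w"
        unfolding zqr w_def by (simp add: Finite_Cartesian_Product.vec_eq_iff algebra_simps)
      then have rH: "r *s v \<in> H" using subgroup_ofD(4)[OF H z subgroup_smult[OF H w]] by simp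
      have r: "0 \<le> r" "r < int d" using d(1) by (auto simp: r_def)
      have "r = 0"
      proof (rule ccontr)
        assume "r \<noteq> 0"
        then have "d \<le> nat r" using r rH by (intro dmin) auto
        then show False using r by linarith
      qed
      then have "z *s v = q *s w" unfolding zqr w_def by (simp add: Finite_Cartesian_Product.vec_eq_iff)
      then have "\<omega> (z *s v) = (c ^ d) powi q" using mult c by simp
      also have "\<dots> = c powi z" using \<open>r = 0\<close> unfolding zqr
        by (simp add: power_int_mult mult.commute[of q])
      finally show "\<omega> (z *s v) = c powi z" .
    qed
  next
    case False
    have "z = 0" if z: "z *s v \<in> H" for z
    proof (rule ccontr)
      assume "z \<noteq> 0"
      have "\<bar>z\<bar> *s v \<in> H"
      proof (cases "z \<ge> 0")
        case nonneg: False
        have "\<bar>z\<bar> *s v = - (z *s v)" using nonneg by (simp add: Finite_Cartesian_Product.vec_eq_iff)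
        then show ?thesis using subgroup_ofD(3)[OF H z] by simp
      qed (use z in simp)
      then have "int (nat \<bar>z\<bar>) *s v \<in> H" by simp
      then show False using False \<open>z \<noteq> 0\<close> by (metis abs_eq_0 nat_0_iff abs_ge_zero order_antisym gr0I)
    qed
    then show ?thesis using \<omega>0 by (intro that[of 1]) (simp, metis power_int_1_left vector_smult_lzero)
  qed
  define H' where "H' = {h + z *s v |h z. h \<in> H}"
  define \<omega>' where "\<omega>' x = (THE y. \<exists>h z. h \<in> H \<and> x = h + z *s v \<and> y = \<omega> h * c powi z)" for x
  \<comment> \<open>The value does not depend on the representation: two of them differ by a
    multiple of \<open>v\<close> that lies in \<open>H\<close>, where \<open>\<omega>\<close> agrees
    with the powers of \<open>c\<close>.\<close>
  have \<omega>': "\<omega>' (h + z *s v) = \<omega> h * c powi z" if h: "h \<in> H" for h z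
    unfolding \<omega>'_def
  proof (rule the_equality)
    fix y assume "\<exists>h' z'. h' \<in> H \<and> h + z *s v = h' + z' *s v \<and> y = \<omega> h' * c powi z'"
    then obtain h' z' where h': "h' \<in> H" "h + z *s v = h' + z' *s v" "y = \<omega> h' * c powi z'" by blast
    have eq: "(z - z') *s v = h' - h"
      using h'(2) by (simp add: vector_ssub_ldistrib vector_sub_rdistrib algebra_simps)
    have "\<omega> h' = \<omega> (h + (h' - h))" by simp
    also have "\<dots> = \<omega> h * c powi (z - z')"
      using c[of "z - z'"] eq subgroup_ofD(4)[OF H h'(1) h] \<omega>D(1)[OF h, of "h' - h"] by metis
    finally show "y = \<omega> h * c powi z"
      using h'(3) c0 by (simp add: power_int_diff)
  qed (use h in blast)
  show ?thesis
  proof (rule that[of H' \<omega>'])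
    show "subgroup_of H'"
      unfolding subgroup_of_def
    proof (intro conjI ballI)
      show "0 \<in> H'" unfolding H'_def using subgroup_ofD(1)[OF H]
        by (intro CollectI exI[of _ 0]) auto
      show "a + b \<in> H'" if ab: "a \<in> H'" "b \<in> H'" for a b
      proof -
        obtain h z h' z' where "a = h + z *s v" "b = h' + z' *s v" "h \<in> H" "h' \<in> H"
          using ab unfolding H'_def by blast
        then show ?thesis unfolding H'_def using subgroup_ofD(2)[OF H]
          by (intro CollectI exI[of _ "h + h'"] exI[of _ "z + z'"]) (auto simp: vector_sadd_rdistrib)
      qed
      show "- a \<in> H'" if a: "a \<in> H'" for a
      proof -
        obtain h z where "a = h + z *s v" "h \<in> H" using a unfolding H'_def by blast
        then show ?thesis unfolding H'_def using subgroup_ofD(3)[OF H]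
          by (intro CollectI exI[of _ "- h"] exI[of _ "- z"])
            (auto simp: Finite_Cartesian_Product.vec_eq_iff)
      qed
    qed
    show "character_on H' \<omega>'"
      unfolding character_on_def
    proof (intro conjI ballI)
      fix a b assume "a \<in> H'" "b \<in> H'"
      then obtain h z h' z' where ab: "a = h + z *s v" "b = h' + z' *s v" "h \<in> H" "h' \<in> H"
        unfolding H'_def by blast
      have "a + b = (h + h') + (z + z') *s v" by (simp add: ab vector_sadd_rdistrib)
      then have "\<omega>' (a + b) = \<omega> (h + h') * c powi (z + z')"
        using \<omega>'[OF subgroup_ofD(2)[OF H ab(3,4)]] by metis
      then show "\<omega>' (a + b) = \<omega>' a * \<omega>' b"
        using ab \<omega>' \<omega>D(1) c0 by (simp add: power_int_add)
    next
      fix a assume "a \<in> H'"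
      then obtain h z where a: "a = h + z *s v" "h \<in> H" unfolding H'_def by blast
      then show "\<omega>' a \<noteq> 0" using \<omega>' \<omega>D(2) c0 by (simp add: power_int_eq_0_iff)
    qed
    show "H \<subseteq> H'"
    proof
      fix h assume "h \<in> H"
      then show "h \<in> H'" unfolding H'_def by (intro CollectI exI[of _ h] exI[of _ 0]) auto
    qed
    show "v \<in> H'" unfolding H'_def using subgroup_ofD(1)[OF H]
      by (intro CollectI exI[of _ 0] exI[of _ 1]) auto
    show "\<omega>' a = \<omega> a" if "a \<in> H" for a
      using \<omega>'[OF that, of 0] by simp
  qed
qed

lemma extend_character_finite:
  fixes H :: "(int^'k) set"
  assumes "finite B" "subgroup_of H" "character_on H \<omega>"
  obtains H' \<omega>' where "subgroup_of H'" "character_on H' \<omega>'" "H \<subseteq> H'" "B \<subseteq> H'" "\<And>a. a \<in> H \<Longrightarrow> \<omega>' a = \<omega> a"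
  using assms(1)
proof (induction B arbitrary: thesis rule: finite_induct)
  case empty
  show ?case by (rule empty[OF assms(2,3)]) auto
next
  case (insert v B)
  obtain H1 \<omega>1 where 1: "subgroup_of H1" "character_on H1 \<omega>1" "H \<subseteq> H1" "B \<subseteq> H1" "\<And>a. a \<in> H \<Longrightarrow> \<omega>1 a = \<omega> a"
    using insert.IH by blast
  obtain H2 \<omega>2 where 2: "subgroup_of H2" "character_on H2 \<omega>2" "H1 \<subseteq> H2" "v \<in> H2" "\<And>a. a \<in> H1 \<Longrightarrow> \<omega>2 a = \<omega>1 a"
    using extend_character_step[OF 1(1,2), of v] by blast
  show ?case
    by (rule insert.prems[OF 2(1,2)]) (use 1 2 in auto)
qed

text \<open>Value of a Laurent monomial. As 0 to a negative power is 0 here, the value is 0 whenever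
  a vanishing coordinate has a nonzero exponent of either sign; multiplicativity in \<open>e\<close>
  therefore needs nonnegative exponents at the zeros of \<open>x\<close>.\<close>

definition mval :: "complex^'k::finite \<Rightarrow> int^'k \<Rightarrow> complex" where
  "mval x e = (\<Prod>i\<in>UNIV. x $ i powi (e $ i))"

text \<open>Adjoining the standard basis vectors extends the character to all exponent vectors; its
  values on them are the coordinates of \<open>x\<close>.\<close>

theorem extend_character:
  fixes H :: "(int^'k::finite) set"
  assumes "subgroup_of H" "character_on H \<omega>"
  obtains x :: "complex^'k" where "\<And>i. x $ i \<noteq> 0" "\<And>h. h \<in> H \<Longrightarrow> \<omega> h = mval x h"
proof -
  obtain H' \<psi> where H': "subgroup_of H'" "character_on H' \<psi>" "range (\<lambda>i. axis i 1) \<subseteq> H'"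
    and \<psi>\<omega>: "\<And>a. a \<in> H \<Longrightarrow> \<psi> a = \<omega> a"
    by (rule extend_character_finite[OF _ assms, of "range (\<lambda>i. axis i 1)"]) auto
  have e_sum: "e = (\<Sum>i\<in>UNIV. (e $ i) *s axis i 1)" for e :: "int^'k"
    by (simp add: Finite_Cartesian_Product.vec_eq_iff axis_def if_distrib cong: if_cong)
  have ax: "axis i 1 \<in> H'" for i using H'(3) by auto
  have sum_in: "(\<Sum>i\<in>A. (e $ i) *s axis i 1) \<in> H'" for e :: "int^'k" and A
    by (induction A rule: infinite_finite_induct)
      (simp_all add: subgroup_ofD(1,2)[OF H'(1)] subgroup_smult[OF H'(1) ax])
  have \<psi>D: "\<And>a b. a \<in> H' \<Longrightarrow> b \<in> H' \<Longrightarrow> \<psi> (a + b) = \<psi> a * \<psi> b" "\<And>a. a \<in> H' \<Longrightarrow> \<psi> a \<noteq> 0"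
    using H'(2) by (auto simp: character_on_def)
  define x :: "complex^'k" where "x = (\<chi> i. \<psi> (axis i 1))"
  have \<psi>0: "\<psi> 0 = 1" using \<psi>D(1)[of 0 0] \<psi>D(2)[of 0] subgroup_ofD(1)[OF H'(1)] by simp
  have axk: "\<psi> (k *s axis i 1) = x $ i powi k" for i k
    using hom_int_powi[of "\<lambda>k. \<psi> (k *s axis i 1)" k] \<psi>D subgroup_smult[OF H'(1) ax]
    by (simp add: vector_sadd_rdistrib x_def)
  have "\<psi> (\<Sum>i\<in>A. (e $ i) *s axis i 1) = (\<Prod>i\<in>A. x $ i powi (e $ i))" for e :: "int^'k" and A
  proof (induction A rule: infinite_finite_induct)
    case (insert i A)
    then show ?case
      using \<psi>D(1)[OF subgroup_smult[OF H'(1) ax] sum_in] axk by simp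
  qed (auto simp: \<psi>0)
  then have "\<psi> e = mval x e" for e
    using e_sum[of e] unfolding mval_def by metis
  moreover have "x $ i \<noteq> 0" for i using \<psi>D(2)[OF ax] by (simp add: x_def)
  ultimately show ?thesis using \<psi>\<omega> by (intro that[of x]) auto
qed

section \<open>Points of the toric variety in Cox coordinates\<close>

lemma mval_0 [simp]: "mval x 0 = 1"
  by (simp add: mval_def)

lemma mval_add:
  assumes "\<And>i. x $ i = 0 \<Longrightarrow> 0 \<le> a $ i \<and> 0 \<le> b $ i"
  shows "mval x (a + b) = mval x a * mval x b"
  unfolding mval_def prod.distrib[symmetric]
proof (intro prod.cong refl)
  fix i
  show "x $ i powi (a + b) $ i = x $ i powi a $ i * x $ i powi b $ i"
  proof (cases "x $ i = 0")
    case True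
    then show ?thesis using assms[OF True] by (cases "a $ i = 0"; cases "b $ i = 0") (auto simp: power_int_0_left_if)
  next
    case False
    then show ?thesis by (simp add: power_int_add)
  qed
qed

lemma mval_eq_0_iff: "mval x e = 0 \<longleftrightarrow> (\<exists>i. x $ i = 0 \<and> e $ i \<noteq> 0)"
  by (auto simp: mval_def power_int_eq_0_iff prod_zero_iff)

lemma laurent_eval_lext: "laurent_eval x q = lext (\<lambda>c. c) (mval x) q"
  by (simp add: laurent_eval_def lext_def mval_def)

lemma mval_int_vec: "mval x (int_vec e) = (\<Prod>i\<in>UNIV. x $ i ^ (e $ i))"
  by (simp add: mval_def int_vec_def)

lemma poly_eval_lext: "poly_eval x f = lext (\<lambda>c. c) (\<lambda>e. mval x (int_vec e)) f"
  by (simp add: poly_eval_def lext_def mval_int_vec)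

lemma cox_substitution_lext: "cox_substitution u p = lext cst (\<lambda>m. mon (FT u m)) p"
  by (simp add: cox_substitution_def lext_def cst_mon)

lemma to_laurent_lext: "to_laurent f = lext cst (\<lambda>e. mon (int_vec e)) f"
  by (simp add: to_laurent_def lext_def cst_mon)

lemma int_vec_add: "int_vec (a + b) = int_vec a + int_vec b"
  by (simp add: int_vec_def Finite_Cartesian_Product.vec_eq_iff)

lemma int_vec_0 [simp]: "int_vec 0 = 0"
  by (simp add: int_vec_def Finite_Cartesian_Product.vec_eq_iff)

lemma laurent_eval_single [simp]: "laurent_eval x (Poly_Mapping.single e c) = c * mval x e"
  by (simp add: laurent_eval_lext)

lemma laurent_eval_add: "laurent_eval x (p + q) = laurent_eval x p + laurent_eval x q"
  by (simp add: laurent_eval_lext cid.lext_add)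

lemma laurent_eval_diff: "laurent_eval x (p - q) = laurent_eval x p - laurent_eval x q"
  by (simp add: laurent_eval_lext cid.lext_diff)

lemma laurent_eval_sum: "laurent_eval x (sum f A) = (\<Sum>a\<in>A. laurent_eval x (f a))"
  by (simp add: laurent_eval_lext cid.lext_sum)

lemma laurent_eval_mult:
  assumes "\<And>e i. e \<in> Poly_Mapping.keys p \<Longrightarrow> x $ i = 0 \<Longrightarrow> 0 \<le> e $ i"
    "\<And>e i. e \<in> Poly_Mapping.keys q \<Longrightarrow> x $ i = 0 \<Longrightarrow> 0 \<le> e $ i"
  shows "laurent_eval x (p * q) = laurent_eval x p * laurent_eval x q"
  unfolding laurent_eval_lext
proof (rule cid.lext_mult)
  fix a b assume "a \<in> Poly_Mapping.keys p" "b \<in> Poly_Mapping.keys q"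
  then show "mval x (a + b) = mval x a * mval x b"
    using assms by (intro mval_add) simp
qed

lemma laurent_eval_to_laurent: "laurent_eval x (to_laurent f) = poly_eval x f"
  unfolding to_laurent_def laurent_eval_sum poly_eval_lext by (simp add: lext_def)

lemma laurent_eval_cox: "laurent_eval x (cox_substitution u p) = lext (\<lambda>c. c) (\<lambda>m. mval x (FT u m)) p"
  unfolding cox_substitution_def laurent_eval_sum by (simp add: lext_def)

lemma cs_add: "cox_substitution u (p + q) = cox_substitution u p + cox_substitution u q"
  by (simp add: cox_substitution_lext ccst.lext_add)

lemma cs_diff: "cox_substitution u (p - q) = cox_substitution u p - cox_substitution u q"
  by (simp add: cox_substitution_lext ccst.lext_diff)

lemma cs_single [simp]: "cox_substitution u (Poly_Mapping.single m c) = Poly_Mapping.single (FT u m) c"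
  by (simp add: cox_substitution_lext cst_mon)

lemma cs_mult: "cox_substitution u (p * q) = cox_substitution u p * cox_substitution u q"
  unfolding cox_substitution_lext by (rule ccst.lext_mult) (simp add: FT_add)

lemma to_laurent_add: "to_laurent (p + q) = to_laurent p + to_laurent q"
  by (simp add: to_laurent_lext ccst.lext_add)

lemma to_laurent_single [simp]: "to_laurent (Poly_Mapping.single e c) = Poly_Mapping.single (int_vec e) c"
  by (simp add: to_laurent_lext cst_mon)

lemma to_laurent_mult: "to_laurent (p * q) = to_laurent p * to_laurent q"
  unfolding to_laurent_lext by (rule ccst.lext_mult) (simp add: int_vec_add)

lemma poly_eval_mult: "poly_eval x (p * q) = poly_eval x p * poly_eval x q"
  unfolding poly_eval_lext
proof (rule cid.lext_mult)
  fix a b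
  show "mval x (int_vec (a + b)) = mval x (int_vec a) * mval x (int_vec b)"
    unfolding int_vec_add by (rule mval_add) (simp add: int_vec_def)
qed

lemma carrier_coord_ring [simp]: "carrier (coord_ring \<sigma>) = monalg (dual_monoid \<sigma>)"
  by (simp add: coord_ring_def monalg_def)

lemma mon_power: "mon e ^ n = mon (int n *s e)" for e :: "int^'k"
  by (induction n) (auto simp: vector_sadd_rdistrib single_one)

lemma alg_point_power:
  assumes "submonoid_of D" "alg_point (monalg D) \<phi>" "p \<in> monalg D"
  shows "\<phi> (p ^ n) = \<phi> p ^ n"
proof (induction n)
  case 0
  have "\<phi> (cst 1) = 1" using assms(2) unfolding alg_point_def by blast
  then show ?case by (simp add: single_one)
next
  case (Suc n)
  have "p ^ n \<in> monalg D" using monalg_power assms by blast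
  then have "\<phi> (p * p ^ n) = \<phi> p * \<phi> (p ^ n)" using assms unfolding alg_point_def by blast
  then show ?case using Suc by simp
qed

lemma alg_point_lext:
  assumes D: "submonoid_of D" and \<phi>: "alg_point (monalg D) \<phi>" and p: "p \<in> monalg D"
  shows "\<phi> p = lext (\<lambda>c. c) (\<lambda>m. \<phi> (mon m)) p"
proof -
  have "\<phi> (\<Sum>e\<in>A. Poly_Mapping.single e (Poly_Mapping.lookup p e)) = (\<Sum>e\<in>A. Poly_Mapping.lookup p e * \<phi> (mon e))"
    if "finite A" "A \<subseteq> Poly_Mapping.keys p" for A
    using that
  proof (induction A rule: finite_induct)
    case empty
    have "\<phi> (cst 0) = 0" using \<phi> unfolding alg_point_def by blast
    then show ?case by simp
  next
    case (insert e A)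
    let ?s = "\<lambda>e. Poly_Mapping.single e (Poly_Mapping.lookup p e)"
    have AD: "insert e A \<subseteq> D" using insert.prems p by (auto simp: monalg_def)
    then have s: "?s e' \<in> monalg D" if "e' \<in> insert e A" for e' using that by (auto simp: monalg_def)
    then have "(\<Sum>e\<in>A. ?s e) \<in> monalg D" by (intro monalg_sum) auto
    then have "\<phi> (?s e + (\<Sum>e\<in>A. ?s e)) = \<phi> (?s e) + \<phi> (\<Sum>e\<in>A. ?s e)"
      using \<phi> s unfolding alg_point_def by blast
    moreover have "\<phi> (cst (Poly_Mapping.lookup p e) * mon e) = \<phi> (cst (Poly_Mapping.lookup p e)) * \<phi> (mon e)"
      using \<phi> AD monalg_cst[OF D] unfolding alg_point_def by (metis insert_subset monalg_mon)
    moreover have "\<phi> (cst c) = c" for c using \<phi> unfolding alg_point_def by blast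
    ultimately show ?case using insert by (simp add: cst_mon)
  qed
  from this[of "Poly_Mapping.keys p"] show ?thesis by (simp add: sum_single_lookup lext_def)
qed

lemma chart_points_iff:
  "\<phi> \<in> chart_points \<sigma> \<longleftrightarrow> alg_point (monalg (dual_monoid \<sigma>)) \<phi> \<and> \<phi> \<in> extensional (monalg (dual_monoid \<sigma>))"
proof -
  have 1: "\<phi> 1 = 1" if "\<And>c. \<phi> (cst c) = c"
    using that[of 1] by (simp add: single_one)
  show ?thesis
    unfolding chart_points_def alg_point_def Ring.ring_hom_def
    using 1 by (auto simp: coord_ring_def class_ring_simps monalg_def)
qed

text \<open>A positive integer \<open>e $ i\<close> is at least 1, so the sum of all absolute values
  of \<open>w\<close> is a large enough factor for every index at once.\<close>

lemma shift_nonneg: "\<exists>N::nat. \<forall>i. 0 < e $ i \<longrightarrow> 0 \<le> w $ i + int N * e $ i" for e w :: "int^'k::finite"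
proof
  let ?N = "\<Sum>i\<in>UNIV. nat \<bar>w $ i\<bar>"
  show "\<forall>i. 0 < e $ i \<longrightarrow> 0 \<le> w $ i + int ?N * e $ i"
  proof (intro allI impI)
    fix i assume e: "0 < e $ i"
    have "nat \<bar>w $ i\<bar> \<le> ?N" by (rule member_le_sum) auto
    then have "\<bar>w $ i\<bar> \<le> int ?N" by linarith
    also have "int ?N * 1 \<le> int ?N * e $ i" using e by (intro mult_left_mono) auto
    finally show "0 \<le> w $ i + int ?N * e $ i" by linarith
  qed
qed

lemma FT_smult: "FT u (k *s m) = k *s FT u m"
  by (simp add: Finite_Cartesian_Product.vec_eq_iff FT_nth sum_distrib_left mult_ac)

text \<open>The homomorphism on the chart of \<open>\<sigma>\<close> given by Cox coordinates
  \<open>x\<close>. It is restricted because \<open>chart_points\<close> consists of extensional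
  functions.\<close>

definition pt :: "('k::finite \<Rightarrow> int^'n::finite) \<Rightarrow> complex^'k \<Rightarrow> (real^'n) set \<Rightarrow> 'n character_poly \<Rightarrow> complex" where
  "pt u x \<sigma> = restrict (\<lambda>p. laurent_eval x (cox_substitution u p)) (monalg (dual_monoid \<sigma>))"

section \<open>Existence and uniqueness of lifts to Cox coordinates\<close>

context toric
begin

definition lifts :: "complex^'k \<Rightarrow> (real^'n) set \<Rightarrow> bool" where
  "lifts x \<tau> \<longleftrightarrow> \<tau> \<in> \<Sigma> \<and> {i. x $ i = 0} = cone_rays u \<tau>"

lemma pt_chart_point:
  assumes \<sigma>: "\<sigma> \<in> \<Sigma>" and x: "{i. x $ i = 0} \<subseteq> cone_rays u \<sigma>"
  shows "pt u x \<sigma> \<in> chart_points \<sigma>"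
proof -
  note D = submonoid_dual[of \<sigma>]
  have "laurent_eval x (cox_substitution u (a * b)) = laurent_eval x (cox_substitution u a) * laurent_eval x (cox_substitution u b)"
    if "a \<in> monalg (dual_monoid \<sigma>)" "b \<in> monalg (dual_monoid \<sigma>)" for a b
    unfolding laurent_eval_cox
  proof (rule cid.lext_mult)
    fix m n assume "m \<in> Poly_Mapping.keys a" "n \<in> Poly_Mapping.keys b"
    then have "m \<in> dual_monoid \<sigma>" "n \<in> dual_monoid \<sigma>" using that by (auto simp: monalg_def)
    then show "mval x (FT u (m + n)) = mval x (FT u m) * mval x (FT u n)"
      unfolding FT_add using x by (intro mval_add) (auto simp: dual_monoid_iff[OF \<sigma>])
  qed
  then show ?thesis
    unfolding chart_points_iff alg_point_def pt_def
    using monalg_mult[OF D] monalg_cst[OF D] by (auto simp: monalg_add cs_add laurent_eval_add)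
qed

lemma lifts_subset: "lifts x \<tau> \<Longrightarrow> \<sigma> \<in> \<Sigma> \<Longrightarrow> {i. x $ i = 0} \<subseteq> cone_rays u \<sigma> \<longleftrightarrow> \<tau> \<subseteq> \<sigma>"
  using cone_rays_subset by (auto simp: lifts_def)

lemma dual_monoid_mono: "\<rho> \<subseteq> \<sigma> \<Longrightarrow> dual_monoid \<sigma> \<subseteq> dual_monoid \<rho>"
  by (auto simp: dual_monoid_def)

lemma restrict_pt:
  "\<rho> \<subseteq> \<sigma> \<Longrightarrow> restrict (pt u x \<rho>) (monalg (dual_monoid \<sigma>)) = pt u x \<sigma>"
  using dual_monoid_mono[of \<rho> \<sigma>] unfolding pt_def by (auto simp: fun_eq_iff restrict_def monalg_def)

lemma shift_into_dual:
  assumes \<sigma>: "\<sigma> \<in> \<Sigma>" and m: "\<And>i. i \<in> cone_rays u \<sigma> \<Longrightarrow> i \<notin> T \<Longrightarrow> 0 < FT u m $ i"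
    "\<And>i. i \<in> T \<Longrightarrow> FT u m $ i = 0"
    and a: "\<And>i. i \<in> T \<Longrightarrow> 0 \<le> FT u a $ i"
  shows "\<exists>N::nat. a + int N *s m \<in> dual_monoid \<sigma>"
proof -
  obtain N :: nat where N: "\<And>i. 0 < FT u m $ i \<Longrightarrow> 0 \<le> FT u a $ i + int N * FT u m $ i"
    using shift_nonneg[of "FT u m" "FT u a"] by blast
  show ?thesis
  proof (intro exI[of _ N])
    have "0 \<le> FT u a $ i + int N * FT u m $ i" if "i \<in> cone_rays u \<sigma>" for i
      using N[of i] m a that by (cases "i \<in> T") auto
    then show "a + int N *s m \<in> dual_monoid \<sigma>"
      by (simp add: dual_monoid_iff[OF \<sigma>] FT_add FT_smult)
  qed
qed

text \<open>A character exposing the face \<open>\<rho>\<close> of \<open>\<sigma>\<close> becomes a unit on the chart of \<open>\<rho>\<close>.\<close>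

lemma pt_extension_unique:
  assumes x: "lifts x \<tau>" and \<sigma>: "\<sigma> \<in> \<Sigma>" and \<rho>: "\<rho> \<in> \<Sigma>" "\<rho> \<subseteq> \<sigma>" and \<tau>\<sigma>: "\<tau> \<subseteq> \<sigma>"
    and \<theta>: "\<theta> \<in> chart_points \<rho>" "restrict \<theta> (monalg (dual_monoid \<sigma>)) = pt u x \<sigma>"
  shows "\<tau> \<subseteq> \<rho>" "\<theta> = pt u x \<rho>"
proof -
  let ?R = "monalg (dual_monoid \<rho>)"
  note D = submonoid_dual[of \<rho>]
  have \<theta>a: "alg_point ?R \<theta>" and ext: "\<theta> \<in> extensional ?R" using \<theta>(1) by (auto simp: chart_points_iff)
  have \<theta>m: "\<theta> (a * b) = \<theta> a * \<theta> b" if "a \<in> ?R" "b \<in> ?R" for a b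
    using \<theta>a that by (auto simp: alg_point_def)
  have \<theta>x: "\<theta> (mon m) = mval x (FT u m)" if "m \<in> dual_monoid \<sigma>" for m
    using fun_cong[OF \<theta>(2), of "mon m"] that by (simp add: pt_def)
  have zx: "i \<in> cone_rays u \<tau> \<longleftrightarrow> x $ i = 0" for i using x by (auto simp: lifts_def)
  obtain m where m: "\<And>i. i \<in> cone_rays u \<rho> \<Longrightarrow> FT u m $ i = 0"
    "\<And>i. i \<in> cone_rays u \<sigma> \<Longrightarrow> i \<notin> cone_rays u \<rho> \<Longrightarrow> 0 < FT u m $ i"
    using face_functional[OF \<sigma> \<rho>] by blast
  have m\<sigma>: "m \<in> dual_monoid \<sigma>" unfolding dual_monoid_iff[OF \<sigma>] using m by (metis less_le order_refl)
  have m\<rho>: "m \<in> dual_monoid \<rho>" "- m \<in> dual_monoid \<rho>" using m by (auto simp: dual_monoid_iff[OF \<rho>(1)] FT_uminus)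
  \<comment> \<open>\<open>m\<close> vanishes on the rays of \<open>\<rho>\<close>, so its character
    is a unit there and has a nonzero value. Hence \<open>m\<close> pairs to 0 with every ray at
    which \<open>x\<close> vanishes, which forces those rays into \<open>\<rho>\<close>.\<close>
  have "\<theta> (mon m) * \<theta> (mon (- m)) = \<theta> (mon m * mon (- m))"
    using m\<rho> by (intro \<theta>m[symmetric]) auto
  also have "\<dots> = \<theta> (cst 1)" by simp
  also have "\<dots> = 1" using \<theta>a unfolding alg_point_def by blast
  finally have nz: "mval x (FT u m) \<noteq> 0" using \<theta>x[OF m\<sigma>] by auto
  have \<tau>\<sigma>': "cone_rays u \<tau> \<subseteq> cone_rays u \<sigma>"
    using cone_rays_subset[OF \<sigma>] x \<tau>\<sigma> by (auto simp: lifts_def)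
  have \<tau>\<rho>: "cone_rays u \<tau> \<subseteq> cone_rays u \<rho>"
  proof
    fix i assume i: "i \<in> cone_rays u \<tau>"
    then have "FT u m $ i = 0" using nz zx by (auto simp: mval_eq_0_iff)
    then show "i \<in> cone_rays u \<rho>" using m(2)[of i] i \<tau>\<sigma>' by force
  qed
  then show "\<tau> \<subseteq> \<rho>" using cone_rays_subset[OF \<rho>(1)] x by (auto simp: lifts_def)
  have mon_eq: "\<theta> (mon a) = mval x (FT u a)" if a: "a \<in> dual_monoid \<rho>" for a
  proof -
    obtain N :: nat where N: "a + int N *s m \<in> dual_monoid \<sigma>"
      using shift_into_dual[OF \<sigma>, of "cone_rays u \<rho>" m a] m a dual_monoid_iff[OF \<rho>(1)] by blast
    \<comment> \<open>A character of the smaller chart becomes one of the chart of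
      \<open>\<sigma>\<close> after multiplication by a power of the unit \<open>mon m\<close>;
      there the value is known, and the power is divided out.\<close>
    have "\<theta> (mon a) * mval x (FT u m) ^ N = \<theta> (mon a) * \<theta> (mon m ^ N)"
      using alg_point_power[OF D \<theta>a, of "mon m" N] m\<rho>(1) \<theta>x[OF m\<sigma>] by simp
    also have "\<dots> = \<theta> (mon a * mon m ^ N)"
      using a m\<rho>(1) monalg_power[OF D] by (intro \<theta>m[symmetric]) auto
    also have "\<dots> = mval x (FT u (a + int N *s m))"
      using \<theta>x[OF N] by (simp add: mon_power)
    also have "\<dots> = laurent_eval x (mon (FT u a) * mon (FT u m) ^ N)"
      by (simp add: mon_power FT_add FT_smult)
    also have "\<dots> = mval x (FT u a) * mval x (FT u m) ^ N"
    proof -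
      have "mval x (FT u a + int N *s FT u m) = mval x (FT u a) * mval x (int N *s FT u m)"
        using a m(1) \<tau>\<rho> zx by (intro mval_add) (auto simp: dual_monoid_iff[OF \<rho>(1)])
      moreover have "mval x (int N *s FT u m) = mval x (FT u m) ^ N"
        by (simp add: mval_def power_int_mult prod_power_distrib mult.commute[of "int N"])
      ultimately show ?thesis by (simp add: mon_power)
    qed
    finally show ?thesis using nz by simp
  qed
  show "\<theta> = pt u x \<rho>"
  proof (rule extensionalityI[OF ext])
    show "pt u x \<rho> \<in> extensional ?R" by (simp add: pt_def)
    fix p assume p: "p \<in> ?R"
    then have "\<theta> p = lext (\<lambda>c. c) (\<lambda>m. \<theta> (mon m)) p" by (rule alg_point_lext[OF D \<theta>a])
    also have "\<dots> = lext (\<lambda>c. c) (\<lambda>m. mval x (FT u m)) p"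
      unfolding lext_def using p mon_eq by (intro sum.cong refl) (auto simp: monalg_def)
    finally show "\<theta> p = pt u x \<rho> p" using p by (simp add: pt_def laurent_eval_cox)
  qed
qed

text \<open>The characters with nonzero value at \<open>\<phi>\<close> are those orthogonal to a
  face \<open>\<tau>\<close>. On the group of all characters orthogonal to \<open>\<tau>\<close>,
  \<open>\<phi>\<close> extends by forming quotients; moved to exponent vectors by the injective map
  \<open>FT u\<close> and extended to all of them, it provides the coordinates off
  \<open>\<tau>\<close>, and the coordinates at the rays of \<open>\<tau>\<close> are set to
  0.\<close>

lemma chart_point_lift:
  assumes \<sigma>: "\<sigma> \<in> \<Sigma>" and \<phi>: "\<phi> \<in> chart_points \<sigma>"
  obtains x \<tau> where "lifts x \<tau>" "\<tau> \<subseteq> \<sigma>" "\<phi> = pt u x \<sigma>"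
proof -
  let ?D = "dual_monoid \<sigma>"
  note D = submonoid_dual[of \<sigma>]
  have \<phi>a: "alg_point (monalg ?D) \<phi>" and ext: "\<phi> \<in> extensional (monalg ?D)" using \<phi> by (auto simp: chart_points_iff)
  define f where "f m = \<phi> (mon m)" for m
  have f_add: "f (a + b) = f a * f b" if "a \<in> ?D" "b \<in> ?D" for a b
  proof -
    have "\<phi> (mon a * mon b) = \<phi> (mon a) * \<phi> (mon b)"
      using \<phi>a that monalg_mon unfolding alg_point_def by blast
    then show ?thesis by (simp add: f_def)
  qed
  have f_0: "f 0 = 1"
  proof -
    have "\<phi> (cst 1) = 1" using \<phi>a unfolding alg_point_def by blast
    then show ?thesis by (simp add: f_def)
  qed
  have D0: "0 \<in> ?D" and Dadd: "\<And>a b. a \<in> ?D \<Longrightarrow> b \<in> ?D \<Longrightarrow> a + b \<in> ?D"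
    using D by (auto simp: submonoid_of_def)
  have Dsm: "int N *s a \<in> ?D" if "a \<in> ?D" for N a
    using that by (induction N) (auto simp: vector_sadd_rdistrib D0 Dadd)
  have f_pow: "f (int N *s a) = f a ^ N" if "a \<in> ?D" for N a
    using that by (induction N) (auto simp: vector_sadd_rdistrib f_0 f_add Dsm)
  define Z where "Z = {m \<in> ?D. f m \<noteq> 0}"
  define T where "T = {i \<in> cone_rays u \<sigma>. \<forall>m\<in>Z. FT u m $ i = 0}"
  have Zadd: "a + b \<in> Z" if "a \<in> Z" "b \<in> Z" for a b
    using that by (auto simp: Z_def Dadd f_add)
  have Z0: "0 \<in> Z" using f_0 D0 by (simp add: Z_def)
  have "\<forall>i. \<exists>m. i \<in> cone_rays u \<sigma> - T \<longrightarrow> m \<in> Z \<and> 0 < FT u m $ i"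
    unfolding T_def by (auto simp: Z_def dual_monoid_iff[OF \<sigma>]) (metis less_le)
  from choice[OF this] obtain w where w: "\<And>i. i \<in> cone_rays u \<sigma> - T \<Longrightarrow> w i \<in> Z \<and> 0 < FT u (w i) $ i" by blast
  \<comment> \<open>Every ray of \<open>\<sigma>\<close> outside \<open>T\<close> pairs positively
    with some element of \<open>Z\<close>. The sum of such elements is a single element of
    \<open>Z\<close> that is positive at all these rays, and it exposes the face
    \<open>\<tau>\<close>.\<close>
  define m0 where "m0 = (\<Sum>i\<in>cone_rays u \<sigma> - T. w i)"
  have "(\<Sum>i\<in>A. w i) \<in> Z" if "A \<subseteq> cone_rays u \<sigma> - T" for A
    using that by (induction A rule: infinite_finite_induct) (auto simp: Z0 Zadd w)
  then have m0Z: "m0 \<in> Z" unfolding m0_def by blast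
  then have m0D: "m0 \<in> ?D" and fm0: "f m0 \<noteq> 0" by (auto simp: Z_def)
  have m0T: "FT u m0 $ i = 0" if "i \<in> T" for i using m0Z that by (auto simp: T_def)
  have m0pos: "0 < FT u m0 $ i" if i: "i \<in> cone_rays u \<sigma>" "i \<notin> T" for i
  proof -
    have "FT u m0 $ i = (\<Sum>j\<in>cone_rays u \<sigma> - T. FT u (w j) $ i)"
      by (simp add: m0_def FT_sum)
    moreover have "0 \<le> FT u (w j) $ i" if "j \<in> cone_rays u \<sigma> - T" for j
      using w[OF that] i(1) by (auto simp: Z_def dual_monoid_iff[OF \<sigma>])
    moreover have "0 < FT u (w i) $ i" using w[of i] i by blast
    ultimately show ?thesis
      using i by (subst \<open>FT u m0 $ i = _\<close>, intro sum_pos2[of _ i]) auto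
  qed
  \<comment> \<open>If \<open>m\<close> is orthogonal to \<open>T\<close>, then some
    \<open>- m + N m0\<close> is in the dual monoid as well. Its value times that of
    \<open>m\<close> is a power of the nonzero value at \<open>m0\<close>.\<close>
  have Z_iff: "m \<in> Z \<longleftrightarrow> (\<forall>i\<in>T. FT u m $ i = 0)" if m: "m \<in> ?D" for m
  proof
    show "m \<in> Z \<Longrightarrow> \<forall>i\<in>T. FT u m $ i = 0" by (auto simp: T_def)
    assume mT: "\<forall>i\<in>T. FT u m $ i = 0"
    obtain N :: nat where N: "- m + int N *s m0 \<in> ?D"
      using shift_into_dual[OF \<sigma>, of T m0 "- m"] m0pos m0T mT by (auto simp: FT_uminus)
    have "f (m + (- m + int N *s m0)) = f m0 ^ N" using f_pow[OF m0D] by simp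
    then have "f m * f (- m + int N *s m0) = f m0 ^ N" using f_add[OF m N] by simp
    then show "m \<in> Z" using fm0 m by (auto simp: Z_def)
  qed
  define \<tau> where "\<tau> = \<sigma> \<inter> {x. inner (real_vec m0) x = 0}"
  have "convex \<sigma>" using cone_rays_generate[OF \<sigma>] convex_convex_cone_hull by metis
  then have face: "\<tau> face_of \<sigma>"
    unfolding \<tau>_def using m0D by (intro face_of_Int_supporting_hyperplane_ge) (auto simp: dual_monoid_def)
  have "0 \<in> \<tau>" using cone_zero[OF \<sigma>] by (simp add: \<tau>_def)
  then have \<tau>: "\<tau> \<in> \<Sigma>" using face_in_fan[OF \<sigma> face] by blast
  have T\<tau>: "cone_rays u \<tau> = T"
  proof
    show "cone_rays u \<tau> \<subseteq> T"
    proof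
      fix i assume i: "i \<in> cone_rays u \<tau>"
      then have "i \<in> cone_rays u \<sigma>" using face face_of_trans by (auto simp: cone_rays_def)
      moreover have "FT u m0 $ i = 0" using real_vec_in_cone[OF i] by (simp add: \<tau>_def inner_real_vec)
      ultimately show "i \<in> T" using m0pos[of i] by force
    qed
    show "T \<subseteq> cone_rays u \<tau>"
    proof
      fix i assume i: "i \<in> T"
      then have i': "i \<in> cone_rays u \<sigma>" by (simp add: T_def)
      then have "real_vec (u i) \<in> \<tau>" using real_vec_in_cone[OF i'] m0T[OF i] by (simp add: \<tau>_def inner_real_vec)
      then show "i \<in> cone_rays u \<tau>" using i' by (intro ray_in_subcone[OF \<tau>, of i \<sigma>]) (auto simp: \<tau>_def)
    qed
  qed
  define G where "G = {m. \<forall>i\<in>T. FT u m $ i = 0}"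
  have "\<forall>m. \<exists>N::nat. m \<in> G \<longrightarrow> m + int N *s m0 \<in> ?D"
    using shift_into_dual[OF \<sigma>, of T m0] m0pos m0T by (auto simp: G_def)
  from choice[OF this] obtain N where N: "\<And>m. m \<in> G \<Longrightarrow> m + int (N m) *s m0 \<in> ?D" by blast
  have Nf: "f (m + int k *s m0) \<noteq> 0" if "m \<in> G" "m + int k *s m0 \<in> ?D" for m k
    using Z_iff[OF that(2)] that m0T by (auto simp: Z_def G_def FT_add FT_smult)
  \<comment> \<open>Elements of \<open>G\<close> are differences of an element of the dual monoid
    and a multiple of \<open>m0\<close>, so \<open>f\<close> extends to \<open>G\<close> as a
    fraction; \<open>\<omega>_eq\<close> shows that the multiple does not matter.\<close>
  define \<omega> where "\<omega> m = f (m + int (N m) *s m0) / f m0 ^ N m" for m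
  have \<omega>_eq: "\<omega> m = f (m + int k *s m0) / f m0 ^ k" if m: "m \<in> G" and k: "m + int k *s m0 \<in> ?D" for m k
  proof -
    have "f ((m + int (N m) *s m0) + int k *s m0) = f ((m + int k *s m0) + int (N m) *s m0)"
      by (simp add: add_ac)
    then have "f (m + int (N m) *s m0) * f m0 ^ k = f (m + int k *s m0) * f m0 ^ N m"
      using N[OF m] k Dsm[OF m0D] by (simp add: f_add f_pow[OF m0D])
    then show ?thesis using fm0 by (simp add: \<omega>_def field_simps)
  qed
  have Gadd: "a + b \<in> G" if "a \<in> G" "b \<in> G" for a b using that by (auto simp: G_def FT_add)
  have \<omega>_add: "\<omega> (a + b) = \<omega> a * \<omega> b" if ab: "a \<in> G" "b \<in> G" for a b
  proof -
    have e: "(a + int (N a) *s m0) + (b + int (N b) *s m0) = (a + b) + int (N a + N b) *s m0"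
      by (simp add: vector_sadd_rdistrib add_ac)
    have "\<omega> (a + b) = f ((a + b) + int (N a + N b) *s m0) / f m0 ^ (N a + N b)"
      using Dadd[OF N[OF ab(1)] N[OF ab(2)]] unfolding e by (intro \<omega>_eq Gadd ab)
    also have "f ((a + b) + int (N a + N b) *s m0) = f (a + int (N a) *s m0) * f (b + int (N b) *s m0)"
      unfolding e[symmetric] by (intro f_add N ab)
    finally show ?thesis by (simp add: \<omega>_def power_add)
  qed
  define H where "H = FT u ` G"
  have H: "subgroup_of H"
    unfolding subgroup_of_def H_def
  proof (intro conjI ballI)
    show "0 \<in> FT u ` G" by (rule image_eqI[of _ _ 0]) (auto simp: G_def)
    show "a + b \<in> FT u ` G" if ab: "a \<in> FT u ` G" "b \<in> FT u ` G" for a b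
    proof -
      obtain m m' where "a = FT u m" "b = FT u m'" "m \<in> G" "m' \<in> G" using ab by blast
      then show ?thesis using Gadd[of m m'] by (intro image_eqI[of _ _ "m + m'"]) (auto simp: FT_add)
    qed
    show "- a \<in> FT u ` G" if a: "a \<in> FT u ` G" for a
    proof -
      obtain m where "a = FT u m" "m \<in> G" using a by blast
      then show ?thesis by (intro image_eqI[of _ _ "- m"]) (auto simp: G_def FT_uminus)
    qed
  qed
  define \<omega>' where "\<omega>' h = \<omega> (the_inv (FT u) h)" for h
  have \<omega>'FT: "\<omega>' (FT u m) = \<omega> m" for m by (simp add: \<omega>'_def the_inv_f_f[OF inj_FT])
  have "character_on H \<omega>'"
    unfolding character_on_def
  proof (intro conjI ballI)
    show "\<omega>' (a + b) = \<omega>' a * \<omega>' b" if ab: "a \<in> H" "b \<in> H" for a b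
    proof -
      obtain m m' where m: "a = FT u m" "b = FT u m'" "m \<in> G" "m' \<in> G" using ab by (auto simp: H_def)
      show ?thesis unfolding m FT_add[symmetric] \<omega>'FT by (rule \<omega>_add[OF m(3,4)])
    qed
    show "\<omega>' a \<noteq> 0" if a: "a \<in> H" for a
    proof -
      obtain m where m: "a = FT u m" "m \<in> G" using a by (auto simp: H_def)
      show ?thesis unfolding m \<omega>'FT \<omega>_def using Nf[OF m(2) N[OF m(2)]] fm0 by simp
    qed
  qed
  from extend_character[OF H this] obtain y :: "complex^'k" where y: "\<And>i. y $ i \<noteq> 0"
    "\<And>h. h \<in> H \<Longrightarrow> \<omega>' h = mval y h" by blast
  \<comment> \<open>Characters in \<open>G\<close> have exponent 0 at \<open>T\<close>, so their
    values are unaffected by the zeros put there.\<close>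
  define x :: "complex^'k" where "x = (\<chi> i. if i \<in> T then 0 else y $ i)"
  have x0: "x $ i = 0 \<longleftrightarrow> i \<in> T" for i using y(1) by (simp add: x_def)
  have lx: "lifts x \<tau>" using \<tau> T\<tau> x0 by (simp add: lifts_def)
  have mon_eq: "f m = mval x (FT u m)" if m: "m \<in> ?D" for m
  proof (cases "m \<in> Z")
    case True
    then have mG: "m \<in> G" using Z_iff[OF m] by (simp add: G_def)
    have "mval x (FT u m) = mval y (FT u m)"
      unfolding mval_def using mG by (intro prod.cong refl) (auto simp: x_def G_def)
    also have "\<dots> = \<omega>' (FT u m)" using y(2) mG by (simp add: H_def)
    also have "\<dots> = f m" unfolding \<omega>'FT using \<omega>_eq[OF mG, of 0] m by simp
    finally show ?thesis by simp
  next
    case False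
    then obtain i where "i \<in> T" "FT u m $ i \<noteq> 0" using Z_iff[OF m] by blast
    then have "mval x (FT u m) = 0" using x0 by (auto simp: mval_eq_0_iff)
    then show ?thesis using False m by (simp add: Z_def)
  qed
  have "\<phi> = pt u x \<sigma>"
  proof (rule extensionalityI[OF ext])
    show "pt u x \<sigma> \<in> extensional (monalg ?D)" by (simp add: pt_def)
    fix p assume p: "p \<in> monalg ?D"
    then have "\<phi> p = lext (\<lambda>c. c) (\<lambda>m. \<phi> (mon m)) p" by (rule alg_point_lext[OF D \<phi>a])
    also have "\<dots> = lext (\<lambda>c. c) (\<lambda>m. mval x (FT u m)) p"
      unfolding lext_def using p mon_eq by (intro sum.cong refl) (auto simp: monalg_def f_def)
    finally show "\<phi> p = pt u x \<sigma> p" using p by (simp add: pt_def laurent_eval_cox)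
  qed
  moreover have "\<tau> \<subseteq> \<sigma>" by (auto simp: \<tau>_def)
  ultimately show ?thesis using that[OF lx] by blast
qed

text \<open>The gluing class in explicit form: one homomorphism for each chart that contains the
  orbit of \<open>\<tau>\<close>.\<close>

definition point_class :: "complex^'k \<Rightarrow> (real^'n) set \<Rightarrow> 'n toric_point" where
  "point_class x \<tau> = {(\<sigma>, pt u x \<sigma>) |\<sigma>. \<sigma> \<in> \<Sigma> \<and> \<tau> \<subseteq> \<sigma>}"

text \<open>A point of the chart of an intersection that restricts to \<open>pt u x \<sigma>\<close>
  is determined by \<open>pt_extension_unique\<close>, and it exists only if the intersection
  contains \<open>\<tau>\<close>.\<close>

lemma glue_class:
  assumes x: "lifts x \<tau>" and \<sigma>: "\<sigma> \<in> \<Sigma>" "\<tau> \<subseteq> \<sigma>"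
  shows "glue \<Sigma> `` {(\<sigma>, pt u x \<sigma>)} = point_class x \<tau>"
proof
  show "glue \<Sigma> `` {(\<sigma>, pt u x \<sigma>)} \<subseteq> point_class x \<tau>"
  proof
    fix z assume "z \<in> glue \<Sigma> `` {(\<sigma>, pt u x \<sigma>)}"
    then obtain \<sigma>' \<theta> where \<theta>: "\<sigma>' \<in> \<Sigma>" "\<theta> \<in> chart_points (\<sigma> \<inter> \<sigma>')"
      "restrict \<theta> (monalg (dual_monoid \<sigma>)) = pt u x \<sigma>" "z = (\<sigma>', restrict \<theta> (monalg (dual_monoid \<sigma>')))"
      by (auto simp: glue_def)
    have "\<tau> \<subseteq> \<sigma> \<inter> \<sigma>'" "\<theta> = pt u x (\<sigma> \<inter> \<sigma>')"
      using pt_extension_unique[OF x \<sigma>(1) inter_in_fan[OF \<sigma>(1) \<theta>(1)] _ \<sigma>(2) \<theta>(2,3)] by auto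
    then show "z \<in> point_class x \<tau>"
      using \<theta>(1,4) by (auto simp: point_class_def restrict_pt)
  qed
  show "point_class x \<tau> \<subseteq> glue \<Sigma> `` {(\<sigma>, pt u x \<sigma>)}"
  proof
    fix z assume "z \<in> point_class x \<tau>"
    then obtain \<sigma>' where \<sigma>': "\<sigma>' \<in> \<Sigma>" "\<tau> \<subseteq> \<sigma>'" "z = (\<sigma>', pt u x \<sigma>')" by (auto simp: point_class_def)
    have "pt u x (\<sigma> \<inter> \<sigma>') \<in> chart_points (\<sigma> \<inter> \<sigma>')"
      using lifts_subset[OF x inter_in_fan[OF \<sigma>(1) \<sigma>'(1)]] \<sigma>(2) \<sigma>'(2)
      by (intro pt_chart_point inter_in_fan \<sigma> \<sigma>') auto
    then have "((\<sigma>, pt u x \<sigma>), (\<sigma>', pt u x \<sigma>')) \<in> glue \<Sigma>"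
      unfolding glue_def using \<sigma> \<sigma>'
      by (auto intro!: bexI[of _ "pt u x (\<sigma> \<inter> \<sigma>')"] simp: restrict_pt)
    then show "z \<in> glue \<Sigma> `` {(\<sigma>, pt u x \<sigma>)}" using \<sigma>'(3) by blast
  qed
qed

lemma toric_point_lift:
  assumes "\<zeta> \<in> toric_variety \<Sigma>"
  obtains x \<tau> where "lifts x \<tau>" "\<zeta> = point_class x \<tau>"
proof -
  obtain \<sigma> \<phi> where \<sigma>: "\<sigma> \<in> \<Sigma>" "\<phi> \<in> chart_points \<sigma>" "\<zeta> = glue \<Sigma> `` {(\<sigma>, \<phi>)}"
    using assms unfolding toric_variety_def quotient_def by blast
  obtain x \<tau> where x: "lifts x \<tau>" "\<tau> \<subseteq> \<sigma>" "\<phi> = pt u x \<sigma>" using chart_point_lift[OF \<sigma>(1,2)] by blast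
  have "\<zeta> = point_class x \<tau>" using glue_class[OF x(1) \<sigma>(1) x(2)] \<sigma>(3) x(3) by simp
  then show ?thesis using that x(1) by blast
qed

lemma point_class_in_variety:
  assumes "lifts x \<tau>"
  shows "point_class x \<tau> \<in> toric_variety \<Sigma>"
proof -
  have \<tau>: "\<tau> \<in> \<Sigma>" using assms by (simp add: lifts_def)
  have "pt u x \<tau> \<in> chart_points \<tau>" using assms by (intro pt_chart_point) (auto simp: lifts_def)
  then show ?thesis
    unfolding toric_variety_def using \<tau> glue_class[OF assms \<tau>]
    by (auto simp: quotient_def intro!: bexI[of _ "(\<tau>, pt u x \<tau>)"])
qed

lemma in_affine_chart_iff:
  assumes "lifts x \<tau>"
  shows "point_class x \<tau> \<in> affine_chart \<Sigma> \<sigma> \<longleftrightarrow> \<sigma> \<in> \<Sigma> \<and> \<tau> \<subseteq> \<sigma>"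
  using point_class_in_variety[OF assms] by (auto simp: affine_chart_def point_class_def)

lemma ev_point_class:
  assumes "lifts x \<tau>" "\<sigma> \<in> \<Sigma>" "\<tau> \<subseteq> \<sigma>" "p \<in> monalg (dual_monoid \<sigma>)"
  shows "ev \<sigma> (point_class x \<tau>) p = laurent_eval x (cox_substitution u p)"
proof -
  have "(THE \<phi>. (\<sigma>, \<phi>) \<in> point_class x \<tau>) = pt u x \<sigma>"
    by (rule the_equality) (use assms in \<open>auto simp: point_class_def\<close>)
  then show ?thesis using assms(4) by (simp add: ev_def pt_def)
qed

lemma poly_eval_hat:
  "poly_eval x (Poly_Mapping.single (hat_exponent u \<sigma>) 1) \<noteq> 0 \<longleftrightarrow> {i. x $ i = 0} \<subseteq> cone_rays u \<sigma>"
  by (auto simp: poly_eval_lext mval_int_vec hat_exponent_def prod_zero_iff)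

lemma cox_quotient_lift:
  assumes "lifts x \<tau>"
  shows "cox_quotient \<Sigma> u x = point_class x \<tau>" "x \<in> cox_domain \<Sigma> u"
proof -
  have \<tau>: "\<tau> \<in> \<Sigma>" using assms by (simp add: lifts_def)
  have S: "{\<sigma>\<in>\<Sigma>. poly_eval x (Poly_Mapping.single (hat_exponent u \<sigma>) 1) \<noteq> 0} = {\<sigma> \<in> \<Sigma>. \<tau> \<subseteq> \<sigma>}"
    using lifts_subset[OF assms] by (auto simp: poly_eval_hat)
  have "cox_quotient \<Sigma> u x = (\<Union>\<sigma>\<in>{\<sigma> \<in> \<Sigma>. \<tau> \<subseteq> \<sigma>}. glue \<Sigma> `` {(\<sigma>, pt u x \<sigma>)})"
    unfolding cox_quotient_def S by (simp add: pt_def)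
  also have "\<dots> = (\<Union>\<sigma>\<in>{\<sigma> \<in> \<Sigma>. \<tau> \<subseteq> \<sigma>}. point_class x \<tau>)"
    using glue_class[OF assms] by (intro SUP_cong) auto
  also have "\<dots> = point_class x \<tau>" using \<tau> by auto
  finally show "cox_quotient \<Sigma> u x = point_class x \<tau>" .
  have "Poly_Mapping.single (hat_exponent u \<tau>) 1 \<in> irrelevant_ideal \<Sigma> u"
    unfolding irrelevant_ideal_def genideal_def using \<tau> by blast
  moreover have "poly_eval x (Poly_Mapping.single (hat_exponent u \<tau>) 1) \<noteq> 0"
    using assms by (auto simp: poly_eval_hat lifts_def)
  ultimately show "x \<in> cox_domain \<Sigma> u" by (auto simp: cox_domain_def)
qed

lemma not_in_hypersurface:
  assumes "lifts x \<tau>" "point_class x \<tau> \<notin> hypersurface \<Sigma> u f"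
  shows "poly_eval x f \<noteq> 0"
  using assms cox_quotient_lift[OF assms(1)] point_class_in_variety[OF assms(1)]
  by (auto simp: hypersurface_def)

end

section \<open>The local algebra at an isolated point\<close>

text \<open>An affine chart with a zero \<open>\<phi>\<close> of the ideal \<open>J\<close>. The
  finite set \<open>P\<close> covers all zeros of \<open>J\<close>, which makes
  \<open>\<phi>\<close> isolated, and \<open>G\<close> generates the monoid, expressed as an
  induction principle.\<close>

locale local_algebra =
  fixes D :: "'m::{comm_monoid_add,countable} set" and J :: "('m \<Rightarrow>\<^sub>0 complex) set"
    and \<phi> :: "('m \<Rightarrow>\<^sub>0 complex) \<Rightarrow> complex"
    and P :: "(('m \<Rightarrow>\<^sub>0 complex) \<Rightarrow> complex) set" and G :: "'m set"
  assumes D: "submonoid_of D" and J: "ideal_of (monalg D) J" and \<phi>: "alg_point (monalg D) \<phi>"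
    and \<phi>J: "\<And>a. a \<in> J \<Longrightarrow> \<phi> a = 0"
    and finP: "finite P"
    and P: "\<And>\<psi>. alg_point (monalg D) \<psi> \<Longrightarrow> (\<forall>a\<in>J. \<psi> a = 0) \<Longrightarrow> \<exists>\<psi>'\<in>P. \<forall>a\<in>monalg D. \<psi> a = \<psi>' a"
    and finG: "finite G" and GD: "G \<subseteq> D"
    and gen: "\<And>S m. 0 \<in> S \<Longrightarrow> (\<And>s g. s \<in> S \<Longrightarrow> g \<in> G \<Longrightarrow> s + g \<in> S) \<Longrightarrow> m \<in> D \<Longrightarrow> m \<in> S"
begin

abbreviation "R \<equiv> monalg D"

text \<open>The kernel of the localization map: the local ring turns out to be the quotient by \<open>K\<close>.\<close>

definition K :: "('m \<Rightarrow>\<^sub>0 complex) set" where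
  "K = {p \<in> R. \<exists>r\<in>R. \<phi> r \<noteq> 0 \<and> r * p \<in> J}"

lemmas Rs = monalg_0[of D] monalg_add[of _ D] monalg_mult[OF D] monalg_diff[of _ D] monalg_cst[OF D] monalg_1[OF D]
  monalg_power[OF D] monalg_uminus[of _ D]

lemma \<phi>_simps:
  "a \<in> R \<Longrightarrow> b \<in> R \<Longrightarrow> \<phi> (a + b) = \<phi> a + \<phi> b" "a \<in> R \<Longrightarrow> b \<in> R \<Longrightarrow> \<phi> (a * b) = \<phi> a * \<phi> b" "\<phi> (cst c) = c"
  using \<phi> unfolding alg_point_def by blast+

lemma \<phi>_1: "\<phi> 1 = 1"
  using \<phi>_simps(3)[of 1] by (simp only: single_one)

lemma \<phi>_diff: "a \<in> R \<Longrightarrow> b \<in> R \<Longrightarrow> \<phi> (a - b) = \<phi> a - \<phi> b"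
  using \<phi>_simps(1)[of "a - b" b] Rs(4) by (simp add: algebra_simps)

lemma \<phi>_power: "a \<in> R \<Longrightarrow> \<phi> (a ^ n) = \<phi> a ^ n"
  by (rule alg_point_power[OF D \<phi>])

lemma X: "pm.subspace R"
  unfolding pm.subspace_def by (simp add: Rs(1-3,5))

lemma K_ideal: "ideal_of R K"
  unfolding ideal_of_def
proof (intro conjI ballI)
  show "K \<subseteq> R" by (auto simp: K_def)
  show "0 \<in> K" using ideal_ofD(2)[OF J] \<phi>_1 Rs(6) by (auto simp: K_def intro!: bexI[of _ 1])
  show "a + b \<in> K" if ab: "a \<in> K" "b \<in> K" for a b
  proof -
    obtain r s where rs: "r \<in> R" "s \<in> R" "\<phi> r \<noteq> 0" "\<phi> s \<noteq> 0" "r * a \<in> J" "s * b \<in> J" "a \<in> R" "b \<in> R"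
      using ab by (auto simp: K_def)
    have "(r * s) * (a + b) = s * (r * a) + r * (s * b)" by (simp add: algebra_simps)
    also have "\<dots> \<in> J"
      by (rule ideal_ofD(3)[OF J ideal_ofD(4)[OF J rs(2,5)] ideal_ofD(4)[OF J rs(1,6)]])
    finally show ?thesis using rs Rs by (auto simp: K_def \<phi>_simps intro!: bexI[of _ "r * s"])
  qed
  show "c * a \<in> K" if c: "c \<in> R" and a: "a \<in> K" for c a
  proof -
    obtain r where r: "r \<in> R" "\<phi> r \<noteq> 0" "r * a \<in> J" "a \<in> R" using a by (auto simp: K_def)
    have "r * (c * a) = c * (r * a)" by (simp add: algebra_simps)
    also have "\<dots> \<in> J" by (rule ideal_ofD(4)[OF J c r(3)])
    finally show ?thesis using r c Rs by (auto simp: K_def)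
  qed
qed

lemma K: "pm.subspace K"
  by (rule ideal_of_subspace[OF D K_ideal])

lemma KR: "K \<subseteq> R"
  using K_ideal by (simp add: ideal_of_def)

lemma JK: "J \<subseteq> K"
  using ideal_ofD(1)[OF J] \<phi>_1 Rs(6) by (auto simp: K_def intro!: bexI[of _ 1])

text \<open>Elements that do not vanish at \<open>\<phi>\<close> can be cancelled modulo
  \<open>K\<close>, as they become units in the local ring.\<close>

lemma K_unitD:
  assumes "r \<in> R" "\<phi> r \<noteq> 0" "r * p \<in> K" "p \<in> R"
  shows "p \<in> K"
proof -
  obtain s where s: "s \<in> R" "\<phi> s \<noteq> 0" "s * (r * p) \<in> J" using assms(3) by (auto simp: K_def)
  then show ?thesis
    using assms Rs by (auto simp: K_def \<phi>_simps mult.assoc intro!: bexI[of _ "s * r"])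
qed

text \<open>For each of the finitely many other zeros \<open>\<psi>\<close>, some element
  \<open>w \<psi>\<close> takes different values at \<open>\<psi>\<close> and \<open>\<phi>\<close>;
  \<open>e\<close> is the product of the differences
  \<open>w \<psi> - \<psi> (w \<psi>)\<close>.\<close>

lemma ex_separating:
  obtains e where "e \<in> R" "\<phi> e \<noteq> 0"
    "\<And>\<psi>. alg_point R \<psi> \<Longrightarrow> (\<forall>a\<in>J. \<psi> a = 0) \<Longrightarrow> (\<forall>a\<in>R. \<psi> a = \<phi> a) \<or> \<psi> e = 0"
proof -
  define P' where "P' = {\<psi> \<in> P. alg_point R \<psi> \<and> \<not> (\<forall>a\<in>R. \<psi> a = \<phi> a)}"
  have "\<forall>\<psi>. \<exists>a. \<psi> \<in> P' \<longrightarrow> a \<in> R \<and> \<psi> a \<noteq> \<phi> a" unfolding P'_def by blast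
  from choice[OF this] obtain w where w: "\<And>\<psi>. \<psi> \<in> P' \<Longrightarrow> w \<psi> \<in> R \<and> \<psi> (w \<psi>) \<noteq> \<phi> (w \<psi>)" by blast
  define e where "e = (\<Prod>\<psi>\<in>P'. w \<psi> - cst (\<psi> (w \<psi>)))"
  have prodR: "(\<Prod>\<psi>\<in>A. w \<psi> - cst (\<psi> (w \<psi>))) \<in> R" if "A \<subseteq> P'" for A
    using that w by (intro monalg_prod[OF D] Rs) blast
  have val: "\<psi>' (\<Prod>\<psi>\<in>A. w \<psi> - cst (\<psi> (w \<psi>))) = (\<Prod>\<psi>\<in>A. \<psi>' (w \<psi>) - \<psi> (w \<psi>))"
    if "finite A" "A \<subseteq> P'" "alg_point R \<psi>'" for A \<psi>'
    using that(1,2)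
  proof (induction A rule: finite_induct)
    case empty
    have "\<psi>' (cst 1) = 1" using that(3) unfolding alg_point_def by blast
    then show ?case by (simp add: single_one)
  next
    case (insert \<psi> A)
    have wR: "w \<psi> \<in> R" using insert.prems w by blast
    have "\<psi>' ((w \<psi> - cst (\<psi> (w \<psi>))) + cst (\<psi> (w \<psi>))) = \<psi>' (w \<psi> - cst (\<psi> (w \<psi>))) + \<psi>' (cst (\<psi> (w \<psi>)))"
      using that(3) wR Rs(4,5) unfolding alg_point_def by blast
    moreover have "\<psi>' (cst c) = c" for c using that(3) unfolding alg_point_def by blast
    ultimately have "\<psi>' (w \<psi> - cst (\<psi> (w \<psi>))) = \<psi>' (w \<psi>) - \<psi> (w \<psi>)" by simp
    moreover have "\<psi>' ((w \<psi> - cst (\<psi> (w \<psi>))) * (\<Prod>\<psi>\<in>A. w \<psi> - cst (\<psi> (w \<psi>))))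
        = \<psi>' (w \<psi> - cst (\<psi> (w \<psi>))) * \<psi>' (\<Prod>\<psi>\<in>A. w \<psi> - cst (\<psi> (w \<psi>)))"
    proof -
      have "(w \<psi> - cst (\<psi> (w \<psi>))) \<in> R" "(\<Prod>\<psi>\<in>A. w \<psi> - cst (\<psi> (w \<psi>))) \<in> R"
        using wR Rs(4,5) prodR[of A] insert.prems by blast+
      then show ?thesis using that(3) unfolding alg_point_def by blast
    qed
    ultimately show ?case using insert by simp
  qed
  have finP': "finite P'" using finP by (simp add: P'_def)
  show ?thesis
  proof (rule that[of e])
    show "e \<in> R" unfolding e_def by (rule prodR) blast
    have "\<phi> e = (\<Prod>\<psi>\<in>P'. \<phi> (w \<psi>) - \<psi> (w \<psi>))"
      unfolding e_def by (rule val[OF finP' _ \<phi>]) blast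
    then show "\<phi> e \<noteq> 0" using w finP' by (auto simp: prod_zero_iff) metis
    fix \<psi> assume \<psi>: "alg_point R \<psi>" "\<forall>a\<in>J. \<psi> a = 0"
    obtain \<psi>' where \<psi>': "\<psi>' \<in> P" "\<And>a. a \<in> R \<Longrightarrow> \<psi> a = \<psi>' a" using P[OF \<psi>] by blast
    have "alg_point R \<psi>'"
      using \<psi>(1) \<psi>'(2) Rs(2,3,5) unfolding alg_point_def by metis
    show "(\<forall>a\<in>R. \<psi> a = \<phi> a) \<or> \<psi> e = 0"
    proof (cases "\<psi>' \<in> P'")
      case True
      have "\<psi> e = (\<Prod>\<psi>''\<in>P'. \<psi> (w \<psi>'') - \<psi>'' (w \<psi>''))"
        unfolding e_def by (rule val[OF finP' _ \<psi>(1)]) blast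
      also have "\<dots> = 0" using True finP' \<psi>'(2) w[OF True] by (intro prod_zero) auto
      finally show ?thesis by blast
    next
      case False
      then show ?thesis using \<psi>' \<open>alg_point R \<psi>'\<close> unfolding P'_def by auto
    qed
  qed
qed

lemma nilpotent:
  assumes p: "p \<in> R" "\<phi> p = 0"
  obtains N where "N > 0" "p ^ N \<in> K"
proof -
  obtain e where e: "e \<in> R" "\<phi> e \<noteq> 0"
    "\<And>\<psi>. alg_point R \<psi> \<Longrightarrow> (\<forall>a\<in>J. \<psi> a = 0) \<Longrightarrow> (\<forall>a\<in>R. \<psi> a = \<phi> a) \<or> \<psi> e = 0"
    using ex_separating by blast
  have "\<exists>N. (p * e) ^ N \<in> J"
  proof (rule ccontr)
    assume "\<not> ?thesis"
    then obtain \<psi> where \<psi>: "alg_point R \<psi>" "\<And>a. a \<in> J \<Longrightarrow> \<psi> a = 0" "\<psi> (p * e) \<noteq> 0"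
      using nullstellensatz[OF D J Rs(3)[OF p(1) e(1)]] by blast
    have "\<psi> (p * e) = \<psi> p * \<psi> e" using \<psi>(1) p(1) e(1) unfolding alg_point_def by blast
    moreover have "(\<forall>a\<in>R. \<psi> a = \<phi> a) \<or> \<psi> e = 0" using e(3) \<psi> by blast
    ultimately show False using \<psi>(3) p by auto
  qed
  then obtain N where N: "(p * e) ^ N \<in> J" by blast
  \<comment> \<open>One more factor \<open>p\<close> makes the exponent positive even for
    \<open>N = 0\<close>.\<close>
  have "p * (p * e) ^ N \<in> J" by (rule ideal_ofD(4)[OF J p(1) N])
  then have "e ^ N * p ^ Suc N \<in> J" by (simp add: power_mult_distrib mult_ac)
  then have "p ^ Suc N \<in> K"
    unfolding K_def using Rs(7)[OF e(1)] Rs(7)[OF p(1), of "Suc N"] e(2) \<phi>_power[OF e(1)]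
    by (intro CollectI conjI bexI[of _ "e ^ N"]) simp_all
  then show ?thesis by (intro that[of "Suc N"]) auto
qed

text \<open>Up to a scalar, \<open>s\<close> is \<open>1 - x\<close> with \<open>x\<close> nilpotent
  modulo \<open>K\<close>, and a finite geometric series inverts it.\<close>

lemma unit_inverse:
  assumes s: "s \<in> R" "\<phi> s \<noteq> 0"
  obtains s' where "s' \<in> R" "s * s' - 1 \<in> K"
proof -
  define x where "x = 1 - cst (inverse (\<phi> s)) * s"
  have x: "x \<in> R" unfolding x_def by (intro Rs s)
  have "\<phi> x = 0"
    unfolding x_def using s Rs by (simp add: \<phi>_diff \<phi>_simps \<phi>_1)
  then obtain N where N: "x ^ N \<in> K" using nilpotent x by blast
  let ?s' = "cst (inverse (\<phi> s)) * (\<Sum>i<N. x ^ i)"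
  have "1 - x ^ N = (1 - x) * (\<Sum>i<N. x ^ i)" by (rule one_diff_power_eq)
  also have "\<dots> = s * ?s'" by (simp add: x_def mult_ac)
  finally have eq: "1 - x ^ N = s * ?s'" .
  have "s * ?s' - 1 = - (x ^ N)" unfolding eq[symmetric] by simp
  also have "\<dots> \<in> K" by (rule ideal_of_uminus[OF D K_ideal N])
  finally show ?thesis
    using x by (intro that[of ?s']) (intro Rs monalg_sum, auto)
qed

text \<open>After subtraction of their values at \<open>\<phi>\<close>, the finitely many monoid
  generators become nilpotent modulo \<open>K\<close>. Monomials in them with exponents below the
  nilpotency orders span everything modulo \<open>K\<close>.\<close>

lemma finite_codim:
  obtains B where "finite B" "B \<subseteq> R" "R \<subseteq> pm.span (K \<union> B)"
proof -
  define y where "y g = mon g - cst (\<phi> (mon g))" for g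
  have yR: "y g \<in> R" if "g \<in> G" for g
    using that GD unfolding y_def by (intro Rs) auto
  have "\<phi> (y g) = 0" if "g \<in> G" for g
    using that GD unfolding y_def by (subst \<phi>_diff) (auto simp: Rs \<phi>_simps)
  then have "\<forall>g. \<exists>N. g \<in> G \<longrightarrow> N > 0 \<and> y g ^ N \<in> K" using nilpotent yR by metis
  from choice[OF this] obtain N where N: "\<And>g. g \<in> G \<Longrightarrow> N g > 0 \<and> y g ^ N g \<in> K" by blast
  define b where "b a = (\<Prod>g\<in>G. y g ^ a g)" for a
  define B where "B = b ` (\<Pi>\<^sub>E g\<in>G. {..<N g})"
  have bR: "b a \<in> R" for a unfolding b_def using yR by (intro monalg_prod[OF D] Rs)
  define W where "W = pm.span (K \<union> B)"
  \<comment> \<open>Raising one exponent stays among the chosen monomials, or the exponent reaches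
    \<open>N g\<close> and the product falls into \<open>K\<close>.\<close>
  have yb: "y g * b a \<in> W" if g: "g \<in> G" and a: "a \<in> (\<Pi>\<^sub>E g\<in>G. {..<N g})" for g a
  proof -
    have eq: "y g * b a = b (a(g := Suc (a g)))"
    proof -
      have "b a = y g ^ a g * (\<Prod>g'\<in>G - {g}. y g' ^ a g')"
        unfolding b_def by (rule prod.remove[OF finG g])
      moreover have "b (a(g := Suc (a g))) = y g ^ Suc (a g) * (\<Prod>g'\<in>G - {g}. y g' ^ (a(g := Suc (a g))) g')"
        unfolding b_def using prod.remove[OF finG g, of "\<lambda>g'. y g' ^ (a(g := Suc (a g))) g'"] by simp
      moreover have "(\<Prod>g'\<in>G - {g}. y g' ^ (a(g := Suc (a g))) g') = (\<Prod>g'\<in>G - {g}. y g' ^ a g')"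
        by (intro prod.cong) auto
      ultimately show ?thesis by (simp add: mult.assoc)
    qed
    show ?thesis
    proof (cases "Suc (a g) < N g")
      case True
      then have "a(g := Suc (a g)) \<in> (\<Pi>\<^sub>E g\<in>G. {..<N g})" using a g by (auto simp: PiE_iff extensional_def)
      then show ?thesis unfolding eq W_def B_def by (intro pm.span_base) blast
    next
      case False
      moreover have "a g < N g" using a g by auto
      ultimately have Ng: "Suc (a g) = N g" by simp
      have "b (a(g := Suc (a g))) = (\<Prod>g'\<in>G - {g}. y g' ^ (a(g := Suc (a g))) g') * y g ^ N g"
        unfolding b_def using prod.remove[OF finG g, of "\<lambda>g'. y g' ^ (a(g := Suc (a g))) g'"] Ng by (simp add: mult.commute)
      also have "\<dots> \<in> K"
        using N[OF g] yR by (intro ideal_ofD(4)[OF K_ideal] monalg_prod[OF D] Rs) auto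
      finally show ?thesis unfolding eq W_def by (intro pm.span_base) blast
    qed
  qed
  have closed: "mon g * v \<in> W" if g: "g \<in> G" and v: "v \<in> W" for g v
    using v unfolding W_def
  proof (induction v rule: pm.span_induct_alt)
    case base
    then show ?case by (simp add: pm.span_zero)
  next
    case (step c z v)
    have "mon g * z \<in> pm.span (K \<union> B)"
    proof (cases "z \<in> K")
      case True
      have "mon g * z \<in> K" using g GD True by (intro ideal_ofD(4)[OF K_ideal]) auto
      then show ?thesis by (intro pm.span_base) blast
    next
      case False
      then obtain a where a: "a \<in> (\<Pi>\<^sub>E g\<in>G. {..<N g})" "z = b a" using step.hyps by (auto simp: B_def)
      have "mon g * z = y g * b a + cst (\<phi> (mon g)) * b a"
        by (simp add: y_def a(2) algebra_simps)
      also have "\<dots> \<in> W"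
        using yb[OF g a(1)] unfolding W_def B_def
        by (intro pm.span_add pm.span_scale) (auto intro!: pm.span_base a)
      finally show ?thesis by (simp add: W_def)
    qed
    moreover have "mon g * (cst c * z + v) = cst c * (mon g * z) + mon g * v" by (simp add: algebra_simps)
    ultimately show ?case using step.IH by (simp add: pm.span_add pm.span_scale)
  qed
  have "mon m \<in> W" if m: "m \<in> D" for m
  proof -
    have "m \<in> {m. mon m \<in> W}"
    proof (rule gen[OF _ _ m])
      have "b (restrict (\<lambda>_. 0) G) = 1" by (simp add: b_def)
      \<comment> \<open>The exponents \<open>N g\<close> are positive, so the zero exponent vector
        is admissible and 1 is among the monomials.\<close>
      moreover have "restrict (\<lambda>_. 0) G \<in> (\<Pi>\<^sub>E g\<in>G. {..<N g})" using N by auto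
      ultimately have "1 \<in> B" unfolding B_def by (metis imageI)
      then show "0 \<in> {m. mon m \<in> W}" by (simp add: W_def pm.span_base single_one)
      fix s g assume "s \<in> {m. mon m \<in> W}" "g \<in> G"
      then have "mon g * mon s \<in> W" by (intro closed) auto
      then show "s + g \<in> {m. mon m \<in> W}" by (simp add: add.commute)
    qed
    then show ?thesis by simp
  qed
  then have "pm.span (mon ` D) \<subseteq> W" unfolding W_def by (intro pm.span_minimal pm.subspace_span) auto
  then have "R \<subseteq> W" using monalg_span by blast
  moreover have "finite B" unfolding B_def using finG by (intro finite_imageI finite_PiE) auto
  moreover have "B \<subseteq> R" using bR by (auto simp: B_def)
  ultimately show ?thesis unfolding W_def by (intro that)
qed

text \<open>\<open>a\<close> is the scalar \<open>\<phi> a\<close> plus an element that is nilpotent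
  modulo \<open>K\<close>. A flag for the nilpotent part makes the matrix of multiplication by
  \<open>a\<close> upper triangular with constant diagonal.\<close>

lemma multiplication_functionals:
  assumes a: "a \<in> R"
  obtains \<mu> e l U where "\<And>r. r < \<mu> \<Longrightarrow> e r \<in> R" "indep_mod K e \<mu>" "spans_mod R K e \<mu>"
    "\<And>r. r < \<mu> \<Longrightarrow> linear_mod R K (l r)"
    "\<And>x. x \<in> R \<Longrightarrow> (\<And>r. r < \<mu> \<Longrightarrow> l r x = 0) \<Longrightarrow> x \<in> K"
    "\<And>r x. r < \<mu> \<Longrightarrow> x \<in> R \<Longrightarrow> l r (a * x) = (\<Sum>s<\<mu>. U r s * l s x)"
    "\<And>r s. s < r \<Longrightarrow> r < \<mu> \<Longrightarrow> U r s = (0::complex)" "\<And>r. r < \<mu> \<Longrightarrow> U r r = \<phi> a"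
proof -
  define y where "y = a - cst (\<phi> a)"
  have yR: "y \<in> R" unfolding y_def by (intro Rs a)
  have "\<phi> y = 0" unfolding y_def using a by (simp add: \<phi>_diff Rs \<phi>_simps)
  then obtain k where k: "y ^ k \<in> K" using nilpotent yR by blast
  have pow: "((*) y ^^ j) x = y ^ j * x" for j x
    by (induction j) (auto simp: mult.assoc)
  obtain B where B: "finite B" "B \<subseteq> R" "R \<subseteq> pm.span (K \<union> B)" using finite_codim by blast
  have nil: "\<exists>k. ((*) y ^^ k) x \<in> K" if "x \<in> R" for x
    using ideal_ofD(5)[OF K_ideal that k] by (intro exI[of _ k]) (simp add: pow)
  obtain \<mu> e l N where *: "\<And>r. r < \<mu> \<Longrightarrow> e r \<in> R" "indep_mod K e \<mu>" "spans_mod R K e \<mu>"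
    "\<And>r. r < \<mu> \<Longrightarrow> linear_mod R K (l r)"
    "\<And>x. x \<in> R \<Longrightarrow> (\<And>r. r < \<mu> \<Longrightarrow> l r x = 0) \<Longrightarrow> x \<in> K"
    "\<And>r x. r < \<mu> \<Longrightarrow> x \<in> R \<Longrightarrow> l r (y * x) = (\<Sum>s<\<mu>. N r s * l s x)"
    "\<And>r s. s \<le> r \<Longrightarrow> r < \<mu> \<Longrightarrow> N r s = (0::complex)"
    by (rule nilpotent_functionals[OF B(1) K KR B(3) X, of "(*) y"])
      (use nil yR Rs(3) ideal_ofD(4)[OF K_ideal yR] in \<open>auto simp: distrib_left mult.left_commute\<close>)
  show ?thesis
  proof (rule that[OF *(1-5), where U = "\<lambda>r s. N r s + (if r = s then \<phi> a else 0)"])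
    fix r x assume r: "r < \<mu>" and x: "x \<in> R"
    have "a * x = y * x + cst (\<phi> a) * x" by (simp add: y_def algebra_simps)
    then have "l r (a * x) = l r (y * x) + \<phi> a * l r x"
      using *(4)[OF r] x Rs(3)[OF yR x] Rs(3)[OF Rs(5) x] by (simp add: linear_mod_def)
    also have "\<dots> = (\<Sum>s<\<mu>. (N r s + (if r = s then \<phi> a else 0)) * l s x)"
      using *(6)[OF r x] r by (simp add: distrib_right sum.distrib if_distrib[of "\<lambda>z. z * _"] cong: if_cong)
    finally show "l r (a * x) = (\<Sum>s<\<mu>. (N r s + (if r = s then \<phi> a else 0)) * l s x)" .
  qed (use *(7) in auto)
qed

end

section \<open>Ideals of the Cox ring\<close>

lemma class_idealD:
  fixes J :: "'a::comm_ring_1 set"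
  assumes "ideal J class_ring"
  shows "0 \<in> J" "a \<in> J \<Longrightarrow> b \<in> J \<Longrightarrow> a + b \<in> J" "a \<in> J \<Longrightarrow> r * a \<in> J"
proof -
  interpret ideal J class_ring by (rule assms)
  show "0 \<in> J" using zero_closed by (simp add: class_ring_simps)
  show "a \<in> J \<Longrightarrow> b \<in> J \<Longrightarrow> a + b \<in> J" using a_closed[of a b] by (simp add: class_ring_simps)
  show "a \<in> J \<Longrightarrow> r * a \<in> J" using I_l_closed[of a r] by (simp add: class_ring_simps)
qed

lemma class_idealI:
  fixes J :: "'a::comm_ring_1 set"
  assumes "0 \<in> J" "\<And>a b. a \<in> J \<Longrightarrow> b \<in> J \<Longrightarrow> a + b \<in> J" "\<And>a r. a \<in> J \<Longrightarrow> r * a \<in> J"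
  shows "ideal J class_ring"
proof (rule idealI)
  show "ring (class_ring :: 'a ring)" by unfold_locales
  have "- a \<in> J" if "a \<in> J" for a using assms(3)[OF that, of "- 1"] by simp
  then have "\<ominus>\<^bsub>class_ring\<^esub> a \<in> J" if "a \<in> J" for a using that by (simp add: class_ring_simps)
  then show "subgroup J (add_monoid class_ring)"
    using assms(1,2) by (simp add: subgroup_def a_inv_def class_ring_simps)
  show "x \<otimes>\<^bsub>class_ring\<^esub> a \<in> J" if "a \<in> J" for a x
    using assms(3)[OF that] by (simp add: class_ring_simps)
  show "a \<otimes>\<^bsub>class_ring\<^esub> x \<in> J" if "a \<in> J" for a x
    using assms(3)[OF that, of x] by (simp add: class_ring_simps mult.commute)
qed

lemma class_genideal:
  fixes S :: "'a::comm_ring_1 set"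
  shows "ideal (Idl\<^bsub>class_ring\<^esub> S) class_ring"
    "ideal J class_ring \<Longrightarrow> S \<subseteq> J \<Longrightarrow> Idl\<^bsub>class_ring\<^esub> S \<subseteq> J"
proof -
  have r: "ring (class_ring :: 'a ring)" by unfold_locales
  show "ideal (Idl\<^bsub>class_ring\<^esub> S) class_ring"
    by (rule ring.genideal_ideal[OF r]) (simp add: class_ring_simps)
  show "ideal J class_ring \<Longrightarrow> S \<subseteq> J \<Longrightarrow> Idl\<^bsub>class_ring\<^esub> S \<subseteq> J"
    by (rule ring.genideal_minimal[OF r])
qed

text \<open>If a power of each generator multiplies \<open>f\<close> into \<open>J\<close>, so does
  every product of sufficiently many generators. The induction is on the sum of the exponents:
  splitting one generator off a product and multiplying \<open>f\<close> by it lowers one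
  exponent.\<close>

lemma saturation_memI:
  fixes J :: "'a::comm_ring_1 set"
  assumes J: "ideal J class_ring" and fin: "finite A"
    and N: "\<And>a. a \<in> A \<Longrightarrow> x a ^ N a * f \<in> J"
  shows "f \<in> saturation J (Idl\<^bsub>class_ring\<^esub> (x ` A))"
proof -
  let ?B = "Idl\<^bsub>class_ring\<^esub> (x ` A)"
  have "f * b \<in> J" if "b \<in> ideal_power ?B (Suc (sum N A))" for b
    using N that
  proof (induction "sum N A" arbitrary: N f b)
    case (0 N f b)
    \<comment> \<open>\<open>A\<close> may be empty, so \<open>f\<close> itself need not lie in
      \<open>J\<close> when the sum is 0; the one factor from the ideal that is still left takes
      care of this case.\<close>
    have f: "x a * f \<in> J" if "a \<in> A" for a
      using 0 fin that class_idealD(3)[OF J, of f "x a"] by simp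
    show ?case using 0(3)[unfolded ideal_power.simps]
    proof (induction rule: ideal_prod.induct)
      case (prod i j)
      have "ideal {i. i * f \<in> J} class_ring"
        using class_idealD[OF J] by (intro class_idealI) (auto simp: distrib_right mult.assoc)
      then have "?B \<subseteq> {i. i * f \<in> J}"
        using f by (intro class_genideal(2)) auto
      then have "j * (i * f) \<in> J" using prod class_idealD(3)[OF J] by blast
      then show ?case by (simp add: class_ring_simps mult_ac)
    next
      case (sum s1 s2)
      then show ?case using class_idealD(2)[OF J] by (simp add: class_ring_simps distrib_left)
    qed
  next
    case (Suc n N f b)
    show ?case using Suc.prems(2)[unfolded ideal_power.simps(2)[of _ "sum N A"]]
    proof (induction rule: ideal_prod.induct)
      case (prod i j)
      have "x a * f * j \<in> J" if a: "a \<in> A" for a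
      proof (cases "N a")
        case 0
        then have "(j * x a) * f \<in> J" using Suc.prems(1)[OF a] class_idealD(3)[OF J] by simp
        then show ?thesis by (simp add: mult_ac)
      next
        case (Suc k)
        let ?N = "N(a := k)"
        have n: "n = sum ?N A"
        proof -
          have "sum N A = N a + sum N (A - {a})" using fin a by (rule sum.remove)
          moreover have "sum ?N A = ?N a + sum ?N (A - {a})" using fin a by (rule sum.remove)
          moreover have "sum ?N (A - {a}) = sum N (A - {a})" by (intro sum.cong) auto
          ultimately show ?thesis using Suc Suc.hyps(2) by simp
        qed
        have "x a' ^ ?N a' * (x a * f) \<in> J" if a': "a' \<in> A" for a'
        proof (cases "a' = a")
          case True
          then show ?thesis using Suc.prems(1)[OF a] Suc by (simp add: mult_ac)
        next
          case False
          have "x a * (x a' ^ N a' * f) \<in> J" using Suc.prems(1)[OF a'] class_idealD(3)[OF J] by blast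
          then show ?thesis using False by (simp add: mult_ac)
        qed
        moreover have "j \<in> ideal_power ?B (Suc (sum ?N A))"
          using prod(2) Suc.hyps(2) n by simp
        ultimately show ?thesis using Suc.hyps(1)[OF n] by blast
      qed
      moreover have "ideal {i. i * f * j \<in> J} class_ring"
        using class_idealD[OF J] by (intro class_idealI) (auto simp: distrib_right mult.assoc)
      ultimately have "?B \<subseteq> {i. i * f * j \<in> J}"
        by (intro class_genideal(2)) auto
      then show ?case using prod(1) by (auto simp: class_ring_simps mult_ac)
    next
      case (sum s1 s2)
      then show ?case using class_idealD(2)[OF J] by (simp add: class_ring_simps distrib_left)
    qed
  qed
  then show ?thesis unfolding saturation_def by blast
qed

section \<open>Cox polynomials inside the Laurent polynomials\<close>

lemma keys_nonneg_to_laurent: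
  fixes q :: "'k::finite cox_laurent"
  assumes "\<And>e i. e \<in> Poly_Mapping.keys q \<Longrightarrow> 0 \<le> e $ i"
  obtains f where "to_laurent f = q"
proof -
  define f where "f = (\<Sum>e\<in>Poly_Mapping.keys q. Poly_Mapping.single (\<chi> i. nat (e $ i)) (Poly_Mapping.lookup q e))"
  have "to_laurent (sum h A) = (\<Sum>a\<in>A. to_laurent (h a))" for h :: "int^'k \<Rightarrow> 'k cox_poly" and A
    unfolding to_laurent_lext by (rule ccst.lext_sum)
  then have "to_laurent f = (\<Sum>e\<in>Poly_Mapping.keys q. Poly_Mapping.single (int_vec (\<chi> i. nat (e $ i))) (Poly_Mapping.lookup q e))"
    by (simp add: f_def)
  also have "\<dots> = (\<Sum>e\<in>Poly_Mapping.keys q. Poly_Mapping.single e (Poly_Mapping.lookup q e))"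
  proof (rule sum.cong[OF refl])
    fix e assume "e \<in> Poly_Mapping.keys q"
    then have "int_vec (\<chi> i. nat (e $ i)) = e"
      using assms by (simp add: int_vec_def Finite_Cartesian_Product.vec_eq_iff)
    then show "Poly_Mapping.single (int_vec (\<chi> i. nat (e $ i))) (Poly_Mapping.lookup q e) = Poly_Mapping.single e (Poly_Mapping.lookup q e)"
      by simp
  qed
  also have "\<dots> = q" by (rule sum_single_lookup)
  finally show ?thesis using that by blast
qed

lemma inj_int_vec: "inj int_vec"
  by (auto simp: inj_def int_vec_def Finite_Cartesian_Product.vec_eq_iff)

lemma lookup_to_laurent: "Poly_Mapping.lookup (to_laurent f) (int_vec e) = Poly_Mapping.lookup f e"
proof -
  have "Poly_Mapping.lookup (to_laurent f) (int_vec e) = (\<Sum>e'\<in>Poly_Mapping.keys f. if e' = e then Poly_Mapping.lookup f e else 0)"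
    unfolding to_laurent_def lookup_sum
    by (intro sum.cong) (auto simp: lookup_single when_def dest: injD[OF inj_int_vec])
  then show ?thesis by (simp add: not_in_keys_iff_lookup_eq_zero)
qed

lemma to_laurent_inject: "to_laurent f = to_laurent g \<longleftrightarrow> f = g"
  by (metis lookup_to_laurent poly_mapping_eqI)

lemma keys_to_laurent: "Poly_Mapping.keys (to_laurent f) \<subseteq> int_vec ` Poly_Mapping.keys f"
  unfolding to_laurent_def by (rule order_trans[OF keys_sum]) auto

lemma keys_mult_mon: "Poly_Mapping.keys (q * mon e) \<subseteq> (\<lambda>a. a + e) ` Poly_Mapping.keys q"
  using keys_mult[of q "mon e"] by auto

lemma keys_mult_mon_iff:
  fixes e :: "'m::ab_group_add"
  shows "a \<in> Poly_Mapping.keys (q * mon e) \<longleftrightarrow> a - e \<in> Poly_Mapping.keys q"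
proof
  show "a \<in> Poly_Mapping.keys (q * mon e) \<Longrightarrow> a - e \<in> Poly_Mapping.keys q"
    using keys_mult_mon[of q e] by auto
  have "q * mon e * mon (- e) = q" by (simp add: mult.assoc)
  then show "a - e \<in> Poly_Mapping.keys q \<Longrightarrow> a \<in> Poly_Mapping.keys (q * mon e)"
    using keys_mult_mon[of "q * mon e" "- e"] by auto
qed

section \<open>Laurent polynomials of degree zero and characters\<close>

context toric
begin

lemma cs_dehom0:
  assumes "Poly_Mapping.keys q \<subseteq> range (FT u)"
  shows "cox_substitution u (dehom0 u q) = q"
proof -
  have lk: "Poly_Mapping.lookup (dehom0 u q) m = Poly_Mapping.lookup q (FT u m)" for m
    unfolding dehom0_def using inj_FT by (simp add: map_key.rep_eq)
  have k: "Poly_Mapping.keys q = FT u ` Poly_Mapping.keys (dehom0 u q)"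
  proof (intro subset_antisym subsetI)
    fix e assume e: "e \<in> Poly_Mapping.keys q"
    then obtain m where "e = FT u m" using assms by blast
    then show "e \<in> FT u ` Poly_Mapping.keys (dehom0 u q)" using e lk by (auto simp: in_keys_iff)
  qed (use lk in \<open>auto simp: in_keys_iff\<close>)
  have "cox_substitution u (dehom0 u q)
     = (\<Sum>m\<in>Poly_Mapping.keys (dehom0 u q). Poly_Mapping.single (FT u m) (Poly_Mapping.lookup q (FT u m)))"
    unfolding cox_substitution_def by (simp add: lk)
  also have "\<dots> = (\<Sum>e\<in>Poly_Mapping.keys q. Poly_Mapping.single e (Poly_Mapping.lookup q e))"
    unfolding k using inj_FT by (subst sum.reindex) (auto intro: inj_on_subset)
  also have "\<dots> = q" by (rule sum_single_lookup)
  finally show ?thesis .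
qed

lemma lookup_cs: "Poly_Mapping.lookup (cox_substitution u p) (FT u m) = Poly_Mapping.lookup p m"
proof -
  have "Poly_Mapping.lookup (cox_substitution u p) (FT u m) = (\<Sum>m'\<in>Poly_Mapping.keys p. if m' = m then Poly_Mapping.lookup p m else 0)"
    unfolding cox_substitution_def lookup_sum
    by (intro sum.cong) (auto simp: lookup_single when_def dest: injD[OF inj_FT])
  then show ?thesis by (simp add: not_in_keys_iff_lookup_eq_zero)
qed

lemma dehom0_cs: "dehom0 u (cox_substitution u p) = p"
  by (rule poly_mapping_eqI) (simp add: dehom0_def map_key.rep_eq inj_FT lookup_cs)

lemma keys_cs: "Poly_Mapping.keys (cox_substitution u p) = FT u ` Poly_Mapping.keys p"
proof
  show "Poly_Mapping.keys (cox_substitution u p) \<subseteq> FT u ` Poly_Mapping.keys p"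
    unfolding cox_substitution_def by (rule order_trans[OF keys_sum]) auto
  show "FT u ` Poly_Mapping.keys p \<subseteq> Poly_Mapping.keys (cox_substitution u p)"
    by (auto simp: in_keys_iff lookup_cs)
qed

lemma divisor_class_0: "divisor_class u 0 = range (FT u)"
  by (auto simp: divisor_class_def elt_set_plus_def)

definition hat :: "(real^'n) set \<Rightarrow> int^'k" where
  "hat \<sigma> = int_vec (hat_exponent u \<sigma>)"

lemma hat_nth: "hat \<sigma> $ i = (if i \<in> cone_rays u \<sigma> then 0 else 1)"
  by (simp add: hat_def int_vec_def hat_exponent_def)

lemma dehom0_in_monalg:
  assumes "\<sigma> \<in> \<Sigma>" "Poly_Mapping.keys q \<subseteq> range (FT u)"
    "\<And>e i. e \<in> Poly_Mapping.keys q \<Longrightarrow> i \<in> cone_rays u \<sigma> \<Longrightarrow> 0 \<le> e $ i"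
  shows "dehom0 u q \<in> monalg (dual_monoid \<sigma>)"
proof -
  have "FT u m \<in> Poly_Mapping.keys q" if "m \<in> Poly_Mapping.keys (dehom0 u q)" for m
    using that keys_cs[of "dehom0 u q"] cs_dehom0[OF assms(2)] by auto
  then show ?thesis using assms(3) by (auto simp: monalg_def dual_monoid_iff[OF assms(1)])
qed

end

locale toric_ideal = toric \<Sigma> u for \<Sigma> :: "(real^'n::finite) set set" and u :: "'k::finite \<Rightarrow> int^'n" +
  fixes I :: "'k cox_poly set"
  assumes homI: "homogeneous_ideal u I" and finI: "finite (ideal_points \<Sigma> u I)"
begin

lemma I_ideal: "ideal I class_ring"
  using homI class_genideal(1) unfolding homogeneous_ideal_def by auto

lemmas ID = class_idealD[OF I_ideal]

text \<open>Membership without denominators: some power of the monomial of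
  \<open>hat \<sigma>\<close> multiplies \<open>q\<close> into the ideal.\<close>

lemma loc_iff: "q \<in> localization u \<sigma> I \<longleftrightarrow> (\<exists>f\<in>I. \<exists>l::nat. q * mon (int l *s hat \<sigma>) = to_laurent f)"
proof -
  have *: "to_laurent f * mon (- hat \<sigma>) ^ l = q \<longleftrightarrow> q * mon (int l *s hat \<sigma>) = to_laurent f" for f l
  proof -
    have 1: "mon (- hat \<sigma>) ^ l * mon (int l *s hat \<sigma>) = 1"
      by (simp add: mon_power vector_smult_rneg)
    show ?thesis
    proof
      assume "to_laurent f * mon (- hat \<sigma>) ^ l = q"
      then show "q * mon (int l *s hat \<sigma>) = to_laurent f" using 1 by (auto simp: mult.assoc)
    next
      assume "q * mon (int l *s hat \<sigma>) = to_laurent f"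
      then have "to_laurent f * mon (- hat \<sigma>) ^ l = q * mon (int l *s hat \<sigma>) * mon (- hat \<sigma>) ^ l"
        by simp
      also have "\<dots> = q * (mon (- hat \<sigma>) ^ l * mon (int l *s hat \<sigma>))"
        by (simp only: mult.assoc mult.commute[of "mon (int l *s hat \<sigma>)"])
      finally show "to_laurent f * mon (- hat \<sigma>) ^ l = q" using 1 by simp
    qed
  qed
  have "q \<in> localization u \<sigma> I \<longleftrightarrow> (\<exists>f\<in>I. \<exists>l. to_laurent f * mon (- hat \<sigma>) ^ l = q)"
    unfolding localization_def hat_def by blast
  then show ?thesis unfolding * .
qed

text \<open>Only the variables at rays of \<open>\<sigma>\<close> need nonnegative exponents; the
  others divide the monomial of \<open>hat \<sigma>\<close> and are invertible.\<close>

lemma loc_memI: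
  assumes f: "f \<in> I" and e: "\<And>i. i \<in> cone_rays u \<sigma> \<Longrightarrow> 0 \<le> e $ i"
  shows "to_laurent f * mon e \<in> localization u \<sigma> I"
proof -
  obtain N :: nat where N: "\<And>i. 0 < hat \<sigma> $ i \<Longrightarrow> 0 \<le> e $ i + int N * hat \<sigma> $ i"
    using shift_nonneg[of "hat \<sigma>" e] by blast
  have "0 \<le> (e + int N *s hat \<sigma>) $ i" for i
    using N[of i] e[of i] by (cases "i \<in> cone_rays u \<sigma>") (auto simp: hat_nth)
  then obtain w where w: "to_laurent w = mon (e + int N *s hat \<sigma>)"
    using keys_nonneg_to_laurent[of "mon (e + int N *s hat \<sigma>)"] by auto
  have "to_laurent f * mon e * mon (int N *s hat \<sigma>) = to_laurent (w * f)"
    by (simp add: to_laurent_mult w mult.assoc mult.commute)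
  then show ?thesis unfolding loc_iff using ID(3)[OF f] by blast
qed

lemma loc_0: "0 \<in> localization u \<sigma> I"
  unfolding loc_iff using ID(1) by (intro bexI[of _ 0] exI[of _ 0]) (auto simp: to_laurent_def)

lemma loc_add:
  assumes "p \<in> localization u \<sigma> I" "q \<in> localization u \<sigma> I"
  shows "p + q \<in> localization u \<sigma> I"
proof -
  obtain f l where f: "f \<in> I" "p * mon (int l *s hat \<sigma>) = to_laurent f" using assms(1) unfolding loc_iff by blast
  obtain g k where g: "g \<in> I" "q * mon (int k *s hat \<sigma>) = to_laurent g" using assms(2) unfolding loc_iff by blast
  have h: "mon (int j *s hat \<sigma>) = to_laurent (Poly_Mapping.single (hat_exponent u \<sigma>) 1 ^ j)" for j
  proof -
    have "to_laurent (Poly_Mapping.single (hat_exponent u \<sigma>) 1 ^ j) = mon (hat \<sigma>) ^ j"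
    proof (induction j)
      case 0
      have "to_laurent (cst 1) = cst 1" by (simp only: to_laurent_single int_vec_0)
      then show ?case by (simp only: power_0 single_one)
    qed (simp add: to_laurent_mult hat_def)
    then show ?thesis by (simp add: mon_power)
  qed
  let ?x = "Poly_Mapping.single (hat_exponent u \<sigma>) 1 :: 'k cox_poly"
  have "(p + q) * mon (int (l + k) *s hat \<sigma>)
      = mon (int k *s hat \<sigma>) * (p * mon (int l *s hat \<sigma>)) + mon (int l *s hat \<sigma>) * (q * mon (int k *s hat \<sigma>))"
    by (simp add: vector_sadd_rdistrib distrib_right mult.commute mult.left_commute add.commute flip: mon_mult)
  also have "\<dots> = to_laurent (?x ^ k * f + ?x ^ l * g)"
    unfolding f(2) g(2) by (simp add: h to_laurent_mult to_laurent_add)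
  finally show ?thesis unfolding loc_iff using ID(2)[OF ID(3)[OF f(1)] ID(3)[OF g(1)]] by blast
qed

lemma loc_mult_mon:
  assumes q: "q \<in> localization u \<sigma> I" and e: "\<And>i. i \<in> cone_rays u \<sigma> \<Longrightarrow> 0 \<le> e $ i"
  shows "q * mon e \<in> localization u \<sigma> I"
proof -
  obtain f l where f: "f \<in> I" "q * mon (int l *s hat \<sigma>) = to_laurent f" using q unfolding loc_iff by blast
  have "q = q * mon (int l *s hat \<sigma>) * mon (- (int l *s hat \<sigma>))"
    by (simp add: mult.assoc)
  then have "q * mon e = to_laurent f * mon (e - int l *s hat \<sigma>)"
    unfolding f(2) by (simp add: mult.assoc)
  then show ?thesis using e by (auto intro!: loc_memI[OF f(1)] simp: hat_nth)
qed

lemma loc_cst: "q \<in> localization u \<sigma> I \<Longrightarrow> cst c * q \<in> localization u \<sigma> I"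
proof -
  assume "q \<in> localization u \<sigma> I"
  then obtain f l where f: "f \<in> I" "q * mon (int l *s hat \<sigma>) = to_laurent f" unfolding loc_iff by blast
  have "cst c * q * mon (int l *s hat \<sigma>) = to_laurent (cst c * f)"
    by (simp add: mult.assoc f(2) to_laurent_mult)
  then show ?thesis unfolding loc_iff using ID(3)[OF f(1)] by blast
qed

lemma loc_mult:
  assumes q: "q \<in> localization u \<sigma> I" and w: "\<And>e i. e \<in> Poly_Mapping.keys w \<Longrightarrow> i \<in> cone_rays u \<sigma> \<Longrightarrow> 0 \<le> e $ i"
  shows "w * q \<in> localization u \<sigma> I"
proof -
  have "(\<Sum>e\<in>A. Poly_Mapping.single e (Poly_Mapping.lookup w e)) * q \<in> localization u \<sigma> I"
    if "finite A" "A \<subseteq> Poly_Mapping.keys w" for A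
    using that
  proof (induction A rule: finite_induct)
    case empty
    then show ?case by (simp add: loc_0)
  next
    case (insert e A)
    have "cst (Poly_Mapping.lookup w e) * (q * mon e) \<in> localization u \<sigma> I"
      using insert.prems w by (intro loc_cst loc_mult_mon q) auto
    moreover have "cst (Poly_Mapping.lookup w e) * (q * mon e) = Poly_Mapping.single e (Poly_Mapping.lookup w e) * q"
      unfolding cst_mon[of "Poly_Mapping.lookup w e" e, symmetric]
      by (simp only: mult.assoc mult.commute[of q])
    ultimately show ?case using insert by (simp add: distrib_right loc_add)
  qed
  from this[of "Poly_Mapping.keys w"] show ?thesis by (simp add: sum_single_lookup)
qed

lemma loc_keys:
  assumes "q \<in> localization u \<sigma> I" "e \<in> Poly_Mapping.keys q" "i \<in> cone_rays u \<sigma>"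
  shows "0 \<le> e $ i"
proof -
  obtain f l where f: "f \<in> I" "q * mon (int l *s hat \<sigma>) = to_laurent f" using assms(1) unfolding loc_iff by blast
  have "e + int l *s hat \<sigma> \<in> Poly_Mapping.keys (q * mon (int l *s hat \<sigma>))"
    unfolding keys_mult_mon_iff using assms(2) by simp
  then obtain e' where "e + int l *s hat \<sigma> = int_vec e'" using keys_to_laurent f(2) by fastforce
  then have "(e + int l *s hat \<sigma>) $ i = int (e' $ i)" by (simp add: int_vec_def)
  then show ?thesis using assms(3) by (simp add: hat_nth)
qed

text \<open>\<open>cox_substitution\<close> and \<open>dehom0\<close> are mutually inverse in degree
  zero. All work on chart ideals thus takes place among Laurent polynomials, where different charts
  can be compared.\<close>

lemma chart_ideal_iff: "p \<in> chart_ideal u \<sigma> I \<longleftrightarrow> cox_substitution u p \<in> localization u \<sigma> I"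
proof
  assume "p \<in> chart_ideal u \<sigma> I"
  then show "cox_substitution u p \<in> localization u \<sigma> I"
    unfolding chart_ideal_def divisor_class_0 using cs_dehom0 by auto
next
  assume "cox_substitution u p \<in> localization u \<sigma> I"
  then show "p \<in> chart_ideal u \<sigma> I"
    unfolding chart_ideal_def divisor_class_0
    by (intro image_eqI[of _ _ "cox_substitution u p"]) (auto simp: dehom0_cs keys_cs)
qed

lemma keys_cs_nonneg:
  assumes "\<sigma> \<in> \<Sigma>" "p \<in> monalg (dual_monoid \<sigma>)" "e \<in> Poly_Mapping.keys (cox_substitution u p)" "i \<in> cone_rays u \<sigma>"
  shows "0 \<le> e $ i"
proof -
  obtain m where m: "e = FT u m" "m \<in> Poly_Mapping.keys p" using assms(3) by (auto simp: keys_cs)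
  then have "m \<in> dual_monoid \<sigma>" using assms(2) by (auto simp: monalg_def)
  then show ?thesis using m(1) assms(4) by (simp add: dual_monoid_iff[OF assms(1)])
qed

lemma chart_ideal_ideal:
  assumes \<sigma>: "\<sigma> \<in> \<Sigma>"
  shows "ideal_of (monalg (dual_monoid \<sigma>)) (chart_ideal u \<sigma> I)"
  unfolding ideal_of_def
proof (intro conjI ballI)
  show "chart_ideal u \<sigma> I \<subseteq> monalg (dual_monoid \<sigma>)"
  proof
    fix p assume p: "p \<in> chart_ideal u \<sigma> I"
    have "m \<in> dual_monoid \<sigma>" if m: "m \<in> Poly_Mapping.keys p" for m
    proof -
      have "FT u m \<in> Poly_Mapping.keys (cox_substitution u p)" using m by (simp add: keys_cs)
      then show ?thesis
        using loc_keys[OF p[unfolded chart_ideal_iff]] by (simp add: dual_monoid_iff[OF \<sigma>])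
    qed
    then show "p \<in> monalg (dual_monoid \<sigma>)" by (auto simp: monalg_def)
  qed
  show "0 \<in> chart_ideal u \<sigma> I" unfolding chart_ideal_iff using loc_0 by (simp add: cox_substitution_def)
  show "a + b \<in> chart_ideal u \<sigma> I" if "a \<in> chart_ideal u \<sigma> I" "b \<in> chart_ideal u \<sigma> I" for a b
    using that unfolding chart_ideal_iff cs_add by (rule loc_add)
  show "r * a \<in> chart_ideal u \<sigma> I" if r: "r \<in> monalg (dual_monoid \<sigma>)" and a: "a \<in> chart_ideal u \<sigma> I" for r a
    using a unfolding chart_ideal_iff cs_mult by (rule loc_mult) (rule keys_cs_nonneg[OF \<sigma> r])
qed

end

lemma shift_nonneg_all:
  fixes e :: "int^'k::finite"
  assumes "finite A"
  obtains N0 :: nat where "\<And>N w i. N0 \<le> N \<Longrightarrow> w \<in> A \<Longrightarrow> 0 < e $ i \<Longrightarrow> 0 \<le> w $ i + int N * e $ i"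
proof -
  have "\<exists>N::nat. \<forall>i. 0 < e $ i \<longrightarrow> 0 \<le> w $ i + int N * e $ i" for w by (rule shift_nonneg)
  then obtain M :: "int^'k \<Rightarrow> nat" where M: "\<And>w i. 0 < e $ i \<Longrightarrow> 0 \<le> w $ i + int (M w) * e $ i" by metis
  show ?thesis
  proof (rule that[of "\<Sum>w\<in>A. M w"])
    fix N w i assume N: "(\<Sum>w\<in>A. M w) \<le> N" and w: "w \<in> A" and e: "0 < e $ i"
    have "M w \<le> (\<Sum>w\<in>A. M w)" using w assms by (intro member_le_sum) auto
    then have "int (M w) * e $ i \<le> int N * e $ i" using N e by (intro mult_right_mono) auto
    then show "0 \<le> w $ i + int N * e $ i" using M[OF e, of w] by linarith
  qed
qed

lemma UN_const_eq:
  assumes "x \<in> A" "\<And>a. a \<in> A \<Longrightarrow> f a = c"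
  shows "(\<Union>a\<in>A. f a) = c"
proof -
  have "(\<Union>a\<in>A. f a) = (\<Union>a\<in>A. c)" using assms(2) by (intro SUP_cong refl)
  then show ?thesis using assms(1) by auto
qed

lemma UN_pair_const:
  assumes "A \<noteq> {}" "\<And>a s. (a, s) \<in> A \<Longrightarrow> f a s = c"
  shows "(\<Union>(a, s)\<in>A. f a s) = c"
proof -
  have "(\<Union>(a, s)\<in>A. f a s) = (\<Union>z\<in>A. c)"
    using assms(2) by (intro SUP_cong refl) auto
  then show ?thesis using assms(1) by simp
qed

section \<open>Passage between charts, zeros of the ideal and saturation\<close>

context toric_ideal
begin

text \<open>Transfer of the localized ideal from one chart to another around the orbit of
  \<open>\<tau>\<close>: a high power of a character that is invertible along the orbit clears the
  denominators at the remaining rays of \<open>\<sigma>1\<close>. The claim covers all large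
  exponents, so that it can be combined with other lower bounds.\<close>

lemma loc_shift:
  assumes q: "q \<in> localization u \<sigma> I" and \<tau>\<sigma>: "cone_rays u \<tau> \<subseteq> cone_rays u \<sigma>"
    and m: "\<And>i. i \<in> cone_rays u \<tau> \<Longrightarrow> FT u m $ i = 0"
      "\<And>i. i \<in> cone_rays u \<sigma>1 \<Longrightarrow> i \<notin> cone_rays u \<tau> \<Longrightarrow> 0 < FT u m $ i"
    and w: "\<And>i. i \<in> cone_rays u \<tau> \<Longrightarrow> 0 \<le> w $ i"
  obtains N0 :: nat where "\<And>N. N0 \<le> N \<Longrightarrow> q * mon (w + int N *s FT u m) \<in> localization u \<sigma>1 I"
proof -
  obtain f l where f: "f \<in> I" "q * mon (int l *s hat \<sigma>) = to_laurent f" using q unfolding loc_iff by blast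
  obtain N0 :: nat where N0: "\<And>N i. N0 \<le> N \<Longrightarrow> 0 < FT u m $ i \<Longrightarrow> 0 \<le> (w - int l *s hat \<sigma>) $ i + int N * FT u m $ i"
    by (rule shift_nonneg_all[of "{w - int l *s hat \<sigma>}" "FT u m"]) (simp, blast)
  show ?thesis
  proof (rule that[of N0])
    fix N assume N: "N0 \<le> N"
    have "q * mon (w + int N *s FT u m) = to_laurent f * mon ((w - int l *s hat \<sigma>) + int N *s FT u m)"
      unfolding f(2)[symmetric] by (simp add: mult.assoc)
    also have "\<dots> \<in> localization u \<sigma>1 I"
    proof (rule loc_memI[OF f(1)])
      fix i assume i: "i \<in> cone_rays u \<sigma>1"
      show "0 \<le> ((w - int l *s hat \<sigma>) + int N *s FT u m) $ i"
      proof (cases "i \<in> cone_rays u \<tau>")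
        case True
        then show ?thesis using m(1)[OF True] w[OF True] \<tau>\<sigma> by (auto simp: hat_nth)
      next
        case False
        then show ?thesis using N0[OF N m(2)[OF i False]] by simp
      qed
    qed
    finally show "q * mon (w + int N *s FT u m) \<in> localization u \<sigma>1 I" .
  qed
qed

lemma zero_set:
  "lifts x \<tau> \<Longrightarrow> x $ i = 0 \<longleftrightarrow> i \<in> cone_rays u \<tau>"
  by (auto simp: lifts_def)

lemma cone_rays_mono: "lifts x \<tau> \<Longrightarrow> \<sigma> \<in> \<Sigma> \<Longrightarrow> \<tau> \<subseteq> \<sigma> \<Longrightarrow> cone_rays u \<tau> \<subseteq> cone_rays u \<sigma>"
  using cone_rays_subset by (auto simp: lifts_def)

lemma laurent_eval_cs_shift:
  assumes x: "lifts x \<tau>" and \<sigma>: "\<sigma> \<in> \<Sigma>" "\<tau> \<subseteq> \<sigma>" and p: "p \<in> monalg (dual_monoid \<sigma>)"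
    and m: "\<And>i. i \<in> cone_rays u \<tau> \<Longrightarrow> FT u m $ i = 0"
  shows "laurent_eval x (cox_substitution u (p * mon m)) = laurent_eval x (cox_substitution u p) * mval x (FT u m)"
    "mval x (FT u m) \<noteq> 0"
proof -
  show "laurent_eval x (cox_substitution u (p * mon m)) = laurent_eval x (cox_substitution u p) * mval x (FT u m)"
    unfolding cs_mult cs_single
    using keys_cs_nonneg[OF \<sigma>(1) p] cone_rays_mono[OF x \<sigma>] m zero_set[OF x]
    by (subst laurent_eval_mult) auto
  show "mval x (FT u m) \<noteq> 0"
    using m zero_set[OF x] by (auto simp: mval_eq_0_iff)
qed

text \<open>\<open>ideal_points\<close> asks for vanishing on a single chart. Multiplication by a
  character that is nonzero at the point carries an element of any other chart ideal into the ideal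
  of that chart.\<close>

lemma vanish_all_charts:
  assumes x: "lifts x \<tau>" and pt: "point_class x \<tau> \<in> ideal_points \<Sigma> u I"
    and \<sigma>: "\<sigma> \<in> \<Sigma>" "\<tau> \<subseteq> \<sigma>" and p: "p \<in> chart_ideal u \<sigma> I"
  shows "laurent_eval x (cox_substitution u p) = 0"
proof -
  have \<tau>: "\<tau> \<in> \<Sigma>" using x by (simp add: lifts_def)
  obtain \<sigma>1 where \<sigma>1: "\<sigma>1 \<in> \<Sigma>" "\<tau> \<subseteq> \<sigma>1" and van: "\<And>p. p \<in> chart_ideal u \<sigma>1 I \<Longrightarrow> ev \<sigma>1 (point_class x \<tau>) p = 0"
    using pt in_affine_chart_iff[OF x] unfolding ideal_points_def by blast
  obtain m where m: "\<And>i. i \<in> cone_rays u \<tau> \<Longrightarrow> FT u m $ i = 0"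
    "\<And>i. i \<in> cone_rays u \<sigma>1 \<Longrightarrow> i \<notin> cone_rays u \<tau> \<Longrightarrow> 0 < FT u m $ i"
    using face_functional[OF \<sigma>1(1) \<tau> \<sigma>1(2)] by blast
  obtain N0 where N0: "\<And>N. N0 \<le> N \<Longrightarrow> cox_substitution u p * mon (0 + int N *s FT u m) \<in> localization u \<sigma>1 I"
    using loc_shift[OF p[unfolded chart_ideal_iff] cone_rays_mono[OF x \<sigma>] m, of \<sigma>1 0] by auto
  let ?m = "int N0 *s m"
  have p': "p * mon ?m \<in> chart_ideal u \<sigma>1 I"
    unfolding chart_ideal_iff using N0[of N0] by (simp add: cs_mult FT_smult)
  have pR: "p \<in> monalg (dual_monoid \<sigma>)" using chart_ideal_ideal[OF \<sigma>(1)] p ideal_ofD(1) by blast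
  have p'R: "p * mon ?m \<in> monalg (dual_monoid \<sigma>1)" using chart_ideal_ideal[OF \<sigma>1(1)] p' ideal_ofD(1) by blast
  have "laurent_eval x (cox_substitution u (p * mon ?m)) = 0"
    using van[OF p'] ev_point_class[OF x \<sigma>1 p'R] by simp
  moreover have m': "FT u ?m $ i = 0" if "i \<in> cone_rays u \<tau>" for i using m(1)[OF that] by (simp add: FT_smult)
  ultimately show ?thesis using laurent_eval_cs_shift[OF x \<sigma> pR m'] by simp
qed

lemma point_in_ideal_points:
  assumes \<sigma>: "\<sigma> \<in> \<Sigma>" and \<psi>: "alg_point (monalg (dual_monoid \<sigma>)) \<psi>" and van: "\<And>a. a \<in> chart_ideal u \<sigma> I \<Longrightarrow> \<psi> a = 0"
  obtains x \<tau> where "lifts x \<tau>" "\<tau> \<subseteq> \<sigma>" "point_class x \<tau> \<in> ideal_points \<Sigma> u I"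
    "\<And>p. p \<in> monalg (dual_monoid \<sigma>) \<Longrightarrow> \<psi> p = laurent_eval x (cox_substitution u p)"
proof -
  let ?R = "monalg (dual_monoid \<sigma>)"
  note D = submonoid_dual[of \<sigma>]
  have "restrict \<psi> ?R \<in> chart_points \<sigma>"
    using \<psi> monalg_mult[OF D] monalg_cst[OF D] unfolding chart_points_iff alg_point_def
    by (auto simp: monalg_add)
  then obtain x \<tau> where x: "lifts x \<tau>" "\<tau> \<subseteq> \<sigma>" "restrict \<psi> ?R = pt u x \<sigma>" using chart_point_lift[OF \<sigma>] by blast
  have eq: "\<psi> p = laurent_eval x (cox_substitution u p)" if "p \<in> ?R" for p
    using fun_cong[OF x(3), of p] that by (simp add: pt_def)
  have "ev \<sigma> (point_class x \<tau>) p = 0" if p: "p \<in> chart_ideal u \<sigma> I" for p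
  proof -
    have "p \<in> ?R" using chart_ideal_ideal[OF \<sigma>] p ideal_ofD(1) by blast
    then show ?thesis using ev_point_class[OF x(1) \<sigma> x(2)] eq van[OF p] by simp
  qed
  then have "point_class x \<tau> \<in> ideal_points \<Sigma> u I"
    unfolding ideal_points_def using \<sigma> in_affine_chart_iff[OF x(1)] x(2) by blast
  then show ?thesis using that x(1,2) eq by blast
qed

text \<open>The conductor of \<open>f\<close> into the ideal on a chart has no zeros, so it is the unit ideal.\<close>

lemma locally_zero_imp_saturation:
  assumes loc: "\<And>x \<tau>. lifts x \<tau> \<Longrightarrow> point_class x \<tau> \<in> ideal_points \<Sigma> u I \<Longrightarrow>
      \<exists>\<sigma> b r. \<sigma> \<in> \<Sigma> \<and> \<tau> \<subseteq> \<sigma> \<and> (\<forall>i\<in>cone_rays u \<tau>. b $ i = 0) \<and> r \<in> monalg (dual_monoid \<sigma>) \<and>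
        laurent_eval x (cox_substitution u r) \<noteq> 0 \<and>
        cox_substitution u r * (to_laurent f * mon b) \<in> localization u \<sigma> I"
  shows "f \<in> saturation I (irrelevant_ideal \<Sigma> u)"
proof -
  have fl: "to_laurent f \<in> localization u \<sigma> I" if \<sigma>: "\<sigma> \<in> \<Sigma>" for \<sigma>
  proof (rule ccontr)
    let ?R = "monalg (dual_monoid \<sigma>)"
    note D = submonoid_dual[of \<sigma>]
    assume nf: "to_laurent f \<notin> localization u \<sigma> I"
    \<comment> \<open>The conductor of \<open>f\<close> on this chart. It contains the chart ideal,
      so every zero of it is a point of the subscheme, and there the local hypothesis will produce
      an element of \<open>J\<close> that does not vanish.\<close>
    define J where "J = {c \<in> ?R. cox_substitution u c * to_laurent f \<in> localization u \<sigma> I}"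
    have fk: "0 \<le> e $ i" if "e \<in> Poly_Mapping.keys (to_laurent f)" for e i
      using that keys_to_laurent[of f] by (auto simp: int_vec_def)
    have cIJ: "chart_ideal u \<sigma> I \<subseteq> J"
    proof
      fix c assume c: "c \<in> chart_ideal u \<sigma> I"
      have "to_laurent f * cox_substitution u c \<in> localization u \<sigma> I"
        using fk by (intro loc_mult c[unfolded chart_ideal_iff])
      moreover have "c \<in> ?R" using chart_ideal_ideal[OF \<sigma>] c ideal_ofD(1) by blast
      ultimately show "c \<in> J" by (simp add: J_def mult.commute)
    qed
    have J: "ideal_of ?R J"
      unfolding ideal_of_def
    proof (intro conjI ballI)
      show "J \<subseteq> ?R" by (auto simp: J_def)
      show "0 \<in> J" using cIJ ideal_ofD(2)[OF chart_ideal_ideal[OF \<sigma>]] by blast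
      show "a + b \<in> J" if "a \<in> J" "b \<in> J" for a b
        using that by (simp add: J_def monalg_add cs_add distrib_right loc_add)
      show "r * a \<in> J" if r: "r \<in> ?R" and a: "a \<in> J" for r a
      proof -
        have "cox_substitution u a * to_laurent f \<in> localization u \<sigma> I" using a by (simp add: J_def)
        then have "cox_substitution u r * (cox_substitution u a * to_laurent f) \<in> localization u \<sigma> I"
          by (rule loc_mult) (rule keys_cs_nonneg[OF \<sigma> r])
        then show ?thesis using r a monalg_mult[OF D] by (simp add: J_def cs_mult mult.assoc)
      qed
    qed
    have "cox_substitution u 1 = 1"
      using cs_single[of u 0 1] by (simp only: FT_0 single_one)
    then have "1 \<notin> J" using nf by (simp add: J_def)
    then have "1 ^ n \<notin> J" for n :: nat by simp
    then obtain \<psi> where \<psi>: "alg_point ?R \<psi>" "\<And>a. a \<in> J \<Longrightarrow> \<psi> a = 0"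
      using nullstellensatz[OF D J monalg_1[OF D]] by blast
    obtain x \<tau> where x: "lifts x \<tau>" "\<tau> \<subseteq> \<sigma>" "point_class x \<tau> \<in> ideal_points \<Sigma> u I"
      and \<psi>x: "\<And>p. p \<in> ?R \<Longrightarrow> \<psi> p = laurent_eval x (cox_substitution u p)"
      using point_in_ideal_points[OF \<sigma> \<psi>(1)] \<psi>(2) cIJ by blast
    obtain \<sigma>1 b r where \<sigma>1: "\<sigma>1 \<in> \<Sigma>" "\<tau> \<subseteq> \<sigma>1" and b: "\<And>i. i \<in> cone_rays u \<tau> \<Longrightarrow> b $ i = 0"
      and r: "r \<in> monalg (dual_monoid \<sigma>1)" "laurent_eval x (cox_substitution u r) \<noteq> 0"
        "cox_substitution u r * (to_laurent f * mon b) \<in> localization u \<sigma>1 I"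
      using loc[OF x(1,3)] by blast
    have \<tau>: "\<tau> \<in> \<Sigma>" using x(1) by (simp add: lifts_def)
    obtain m where m: "\<And>i. i \<in> cone_rays u \<tau> \<Longrightarrow> FT u m $ i = 0"
      "\<And>i. i \<in> cone_rays u \<sigma> \<Longrightarrow> i \<notin> cone_rays u \<tau> \<Longrightarrow> 0 < FT u m $ i"
      using face_functional[OF \<sigma> \<tau> x(2)] by blast
    obtain N0 where N0: "\<And>N. N0 \<le> N \<Longrightarrow>
        cox_substitution u r * (to_laurent f * mon b) * mon (- b + int N *s FT u m) \<in> localization u \<sigma> I"
      using loc_shift[OF r(3) cone_rays_mono[OF x(1) \<sigma>1] m, of \<sigma> "- b"] b by auto
    obtain N1 where N1: "\<And>N w i. N1 \<le> N \<Longrightarrow> w \<in> Poly_Mapping.keys (cox_substitution u r) \<Longrightarrow> 0 < FT u m $ i \<Longrightarrow>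
        0 \<le> w $ i + int N * FT u m $ i"
      by (rule shift_nonneg_all[of "Poly_Mapping.keys (cox_substitution u r)" "FT u m"]) (simp, blast)
    define N where "N = max N0 N1"
    \<comment> \<open>The local multiplier \<open>r\<close> moved to the chart of
      \<open>\<sigma>\<close>: the bound \<open>N0\<close> puts \<open>c\<close> times
      \<open>f\<close> into the localized ideal, the bound \<open>N1\<close> makes \<open>c\<close>
      regular on the chart. The added character is nonzero at the point, so \<open>c\<close> does
      not vanish there.\<close>
    define c where "c = r * mon (int N *s m)"
    have cR: "c \<in> ?R"
    proof -
      have "a \<in> dual_monoid \<sigma>" if a: "a \<in> Poly_Mapping.keys c" for a
      proof -
        have a': "a - int N *s m \<in> Poly_Mapping.keys r" using a by (simp add: c_def keys_mult_mon_iff)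
        then have k: "FT u (a - int N *s m) \<in> Poly_Mapping.keys (cox_substitution u r)" by (simp add: keys_cs)
        have "0 \<le> FT u a $ i" if i: "i \<in> cone_rays u \<sigma>" for i
        proof (cases "i \<in> cone_rays u \<tau>")
          case True
          then have "0 \<le> FT u (a - int N *s m) $ i"
            using keys_cs_nonneg[OF \<sigma>1(1) r(1) k] cone_rays_mono[OF x(1) \<sigma>1] by blast
          then show ?thesis using m(1)[OF True] by (simp add: FT_diff FT_smult)
        next
          case False
          then show ?thesis using N1[OF _ k m(2)[OF i False], of N] by (simp add: N_def FT_diff FT_smult)
        qed
        then show ?thesis by (simp add: dual_monoid_iff[OF \<sigma>])
      qed
      then show ?thesis by (auto simp: monalg_def)
    qed
    have "cox_substitution u r * (to_laurent f * mon b) * mon (- b + int N *s FT u m)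
        = cox_substitution u c * to_laurent f"
    proof -
      have "mon b * mon (- b + int N *s FT u m) = mon (int N *s FT u m)" by simp
      then have "cox_substitution u r * (to_laurent f * mon b) * mon (- b + int N *s FT u m)
          = cox_substitution u r * (to_laurent f * mon (int N *s FT u m))"
        by (simp only: mult.assoc)
      then show ?thesis
        by (simp only: c_def cs_mult cs_single FT_smult mult.assoc mult.commute[of "to_laurent f"])
    qed
    moreover have "N0 \<le> N" by (simp add: N_def)
    ultimately have "c \<in> J" using N0[of N] cR by (simp add: J_def)
    then have "laurent_eval x (cox_substitution u c) = 0" using \<psi>(2) \<psi>x[OF cR] by simp
    moreover have m': "FT u (int N *s m) $ i = 0" if "i \<in> cone_rays u \<tau>" for i
      using m(1)[OF that] by (simp add: FT_smult)
    ultimately show False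
      using laurent_eval_cs_shift[OF x(1) \<sigma>1 r(1) m'] r(2) by (simp add: c_def)
  qed
  \<comment> \<open>Membership of \<open>f\<close> in the localized ideal of each chart says that a
    power of each generator of the irrelevant ideal multiplies \<open>f\<close> into
    \<open>I\<close>.\<close>
  have "\<exists>N. Poly_Mapping.single (hat_exponent u \<sigma>) 1 ^ N * f \<in> I" if \<sigma>: "\<sigma> \<in> \<Sigma>" for \<sigma>
  proof -
    obtain g l where g: "g \<in> I" "to_laurent f * mon (int l *s hat \<sigma>) = to_laurent g"
      using fl[OF \<sigma>] unfolding loc_iff by blast
    have "to_laurent (mon (hat_exponent u \<sigma>) ^ l) = mon (hat \<sigma>) ^ l"
    proof (induction l)
      case 0
      have "to_laurent (cst 1) = cst 1" by (simp only: to_laurent_single int_vec_0)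
      then show ?case by (simp only: power_0 single_one)
    qed (simp add: to_laurent_mult hat_def)
    then have "to_laurent (mon (hat_exponent u \<sigma>) ^ l * f) = to_laurent g"
      using g(2) by (simp add: to_laurent_mult mon_power mult.commute)
    then show ?thesis using g(1) by (auto simp: to_laurent_inject intro!: exI[of _ l])
  qed
  then obtain N where N: "\<And>\<sigma>. \<sigma> \<in> \<Sigma> \<Longrightarrow> Poly_Mapping.single (hat_exponent u \<sigma>) 1 ^ N \<sigma> * f \<in> I" by metis
  have "finite \<Sigma>" using fan by (simp add: fan_def)
  then show ?thesis
    unfolding irrelevant_ideal_def using N by (intro saturation_memI[OF I_ideal])
qed

text \<open>Every zero of the chart ideal, as an algebra homomorphism, is evaluation at a point of
  the subscheme, and there are finitely many of these. The generators \<open>G\<close> come from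
  \<open>hilbert_basis\<close>.\<close>

lemma local_algebra_point:
  assumes x: "lifts x \<tau>" and pt: "point_class x \<tau> \<in> ideal_points \<Sigma> u I" and \<sigma>: "\<sigma> \<in> \<Sigma>" "\<tau> \<subseteq> \<sigma>"
  obtains P G where "local_algebra (dual_monoid \<sigma>) (chart_ideal u \<sigma> I) (pt u x \<sigma>) P G"
proof -
  note D = submonoid_dual[of \<sigma>]
  obtain G where G: "finite G" "G \<subseteq> dual_monoid \<sigma>"
    "\<And>S m. 0 \<in> S \<Longrightarrow> (\<And>s g. s \<in> S \<Longrightarrow> g \<in> G \<Longrightarrow> s + g \<in> S) \<Longrightarrow> m \<in> dual_monoid \<sigma> \<Longrightarrow> m \<in> S"
  proof -
    have eq: "dual_monoid \<sigma> = {m. \<forall>i\<in>cone_rays u \<sigma>. 0 \<le> FT u m $ i}"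
      using dual_monoid_iff[OF \<sigma>(1)] by blast
    show ?thesis by (rule hilbert_basis[of "cone_rays u \<sigma>" u, folded eq]) (rule that, assumption, assumption, blast)
  qed
  have "local_algebra (dual_monoid \<sigma>) (chart_ideal u \<sigma> I) (pt u x \<sigma>) (ev \<sigma> ` ideal_points \<Sigma> u I) G"
  proof
    show "submonoid_of (dual_monoid \<sigma>)" by (rule D)
    show "ideal_of (monalg (dual_monoid \<sigma>)) (chart_ideal u \<sigma> I)" by (rule chart_ideal_ideal[OF \<sigma>(1)])
    have "pt u x \<sigma> \<in> chart_points \<sigma>" using lifts_subset[OF x \<sigma>(1)] \<sigma> by (intro pt_chart_point) auto
    then show "alg_point (monalg (dual_monoid \<sigma>)) (pt u x \<sigma>)" by (simp add: chart_points_iff)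
    show "pt u x \<sigma> a = 0" if a: "a \<in> chart_ideal u \<sigma> I" for a
    proof -
      have "a \<in> monalg (dual_monoid \<sigma>)" using chart_ideal_ideal[OF \<sigma>(1)] a ideal_ofD(1) by blast
      then show ?thesis using vanish_all_charts[OF x pt \<sigma> a] by (simp add: pt_def)
    qed
    show "finite (ev \<sigma> ` ideal_points \<Sigma> u I)" using finI by simp
    show "\<exists>\<psi>'\<in>ev \<sigma> ` ideal_points \<Sigma> u I. \<forall>a\<in>monalg (dual_monoid \<sigma>). \<psi> a = \<psi>' a"
      if \<psi>: "alg_point (monalg (dual_monoid \<sigma>)) \<psi>" "\<forall>a\<in>chart_ideal u \<sigma> I. \<psi> a = 0" for \<psi>
    proof -
      obtain x' \<tau>' where x': "lifts x' \<tau>'" "\<tau>' \<subseteq> \<sigma>" "point_class x' \<tau>' \<in> ideal_points \<Sigma> u I"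
        "\<And>p. p \<in> monalg (dual_monoid \<sigma>) \<Longrightarrow> \<psi> p = laurent_eval x' (cox_substitution u p)"
        using point_in_ideal_points[OF \<sigma>(1) \<psi>(1)] \<psi>(2) by blast
      then show ?thesis
        using ev_point_class[OF x'(1) \<sigma>(1) x'(2)] by (intro bexI[OF _ imageI[OF x'(3)]]) auto
    qed
    show "finite G" "G \<subseteq> dual_monoid \<sigma>" by (rule G(1), rule G(2))
    show "m \<in> S" if "0 \<in> S" "\<And>s g. s \<in> S \<Longrightarrow> g \<in> G \<Longrightarrow> s + g \<in> S" "m \<in> dual_monoid \<sigma>" for S m
      using G(3)[OF that] .
  qed
  then show ?thesis by (rule that)
qed

section \<open>The local ring as a quotient of the coordinate ring\<close>

text \<open>Denominators are invertible modulo \<open>K\<close>, so every fraction equals one with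
  denominator 1. The local ring is therefore already a quotient of the coordinate ring, and
  \<open>multiplicity_at\<close> is the codimension of \<open>K\<close>.\<close>

lemma local_ring_quotient:
  assumes x: "lifts x \<tau>" and pt: "point_class x \<tau> \<in> ideal_points \<Sigma> u I" and \<sigma>: "\<sigma> \<in> \<Sigma>" "\<tau> \<subseteq> \<sigma>"
  shows "quotient_vs (monalg (dual_monoid \<sigma>)) (local_algebra.K (dual_monoid \<sigma>) (chart_ideal u \<sigma> I) (pt u x \<sigma>))
     (local_ring u I \<sigma> (point_class x \<tau>)) (\<lambda>p. fraction_rel u I \<sigma> (point_class x \<tau>) `` {(p, 1)})"
proof -
  obtain P G where L: "local_algebra (dual_monoid \<sigma>) (chart_ideal u \<sigma> I) (pt u x \<sigma>) P G"
    using local_algebra_point[OF assms] .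
  interpret L: local_algebra "dual_monoid \<sigma>" "chart_ideal u \<sigma> I" "pt u x \<sigma>" P G by (rule L)
  let ?\<zeta> = "point_class x \<tau>" and ?R = "monalg (dual_monoid \<sigma>)"
  let ?E = "fraction_rel u I \<sigma> ?\<zeta>" and ?V = "local_ring u I \<sigma> ?\<zeta>"
  define \<Phi> where "\<Phi> p = ?E `` {(p, 1)}" for p
  have ev: "ev \<sigma> ?\<zeta> p = pt u x \<sigma> p" if "p \<in> ?R" for p
    using ev_point_class[OF x \<sigma> that] that by (simp add: pt_def)
  have frac: "(p, s) \<in> fractions \<sigma> ?\<zeta> \<longleftrightarrow> p \<in> ?R \<and> s \<in> ?R \<and> pt u x \<sigma> s \<noteq> 0" for p s
    using ev by (auto simp: fractions_def)
  have rel: "((p, s), (q, t)) \<in> ?E \<longleftrightarrow> p \<in> ?R \<and> s \<in> ?R \<and> pt u x \<sigma> s \<noteq> 0 \<and> q \<in> ?R \<and> t \<in> ?R \<and> pt u x \<sigma> t \<noteq> 0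
      \<and> p * t - q * s \<in> L.K" for p s q t
  proof (cases "p \<in> ?R \<and> s \<in> ?R \<and> pt u x \<sigma> s \<noteq> 0 \<and> q \<in> ?R \<and> t \<in> ?R \<and> pt u x \<sigma> t \<noteq> 0")
    case True
    then have "p * t - q * s \<in> ?R" by (intro L.Rs) auto
    then show ?thesis using True ev by (auto simp: fraction_rel_def frac L.K_def)
  qed (auto simp: fraction_rel_def frac)
  have one: "1 \<in> ?R" "pt u x \<sigma> 1 \<noteq> 0" using L.Rs(6) L.\<phi>_1 by auto
  have Kadd: "a + b \<in> L.K" if "a \<in> L.K" "b \<in> L.K" for a b using ideal_ofD(3)[OF L.K_ideal that] .
  have Kmul: "r * a \<in> L.K" if "r \<in> ?R" "a \<in> L.K" for a r using ideal_ofD(4)[OF L.K_ideal that] .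
  have Kneg: "- a \<in> L.K" if "a \<in> L.K" for a using ideal_of_uminus[OF L.D L.K_ideal that] .
  have equiv: "equiv (fractions \<sigma> ?\<zeta>) ?E"
  proof (rule equivI)
    show "?E \<subseteq> fractions \<sigma> ?\<zeta> \<times> fractions \<sigma> ?\<zeta>" by (auto simp: fraction_rel_def)
    show "refl_on (fractions \<sigma> ?\<zeta>) ?E"
      unfolding refl_on_def using ideal_ofD(2)[OF L.K_ideal] by (auto simp: rel frac)
    show "sym ?E"
    proof (rule symI)
      fix a b assume ab: "(a, b) \<in> ?E"
      obtain p s q t where [simp]: "a = (p, s)" "b = (q, t)" by (metis surj_pair)
      show "(b, a) \<in> ?E" using ab Kneg[of "p * t - q * s"] by (auto simp: rel)
    qed
    show "trans ?E"
    proof (rule transI)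
      fix a b c assume abc: "(a, b) \<in> ?E" "(b, c) \<in> ?E"
      obtain p s q t w v where [simp]: "a = (p, s)" "b = (q, t)" "c = (w, v)" by (metis surj_pair)
      have R: "p \<in> ?R" "s \<in> ?R" "t \<in> ?R" "v \<in> ?R" "w \<in> ?R" "pt u x \<sigma> t \<noteq> 0" using abc by (auto simp: rel)
      have "t * (p * v - w * s) = v * (p * t - q * s) + s * (q * v - w * t)" by (simp add: algebra_simps)
      also have "\<dots> \<in> L.K" using abc R by (intro Kadd Kmul) (auto simp: rel)
      finally have "t * (p * v - w * s) \<in> L.K" .
      then have "p * v - w * s \<in> L.K" by (rule L.K_unitD[OF R(3,6)]) (simp add: L.Rs R)
      then show "(a, c) \<in> ?E" using abc by (auto simp: rel)
    qed
  qed
  have eqcl: "?E `` {a} = ?E `` {b} \<longleftrightarrow> (a, b) \<in> ?E" if "a \<in> fractions \<sigma> ?\<zeta>" "b \<in> fractions \<sigma> ?\<zeta>" for a b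
    using eq_equiv_class_iff[OF equiv that] .
  have in\<Phi>: "(a, s) \<in> \<Phi> p \<longleftrightarrow> p \<in> ?R \<and> a \<in> ?R \<and> s \<in> ?R \<and> pt u x \<sigma> s \<noteq> 0 \<and> p * s - a \<in> L.K" for a s p
    using one by (auto simp: \<Phi>_def rel)
  have cl\<Phi>: "?E `` {(a, s)} = \<Phi> p" if "(a, s) \<in> \<Phi> p" for a s p
    unfolding \<Phi>_def using that one Kneg[of "p * s - a"]
    by (subst eqcl) (auto simp: frac in\<Phi> rel)
  have ne: "\<Phi> p \<noteq> {}" if "p \<in> ?R" for p
  proof -
    have "(p, 1) \<in> \<Phi> p" using that one ideal_ofD(2)[OF L.K_ideal] by (simp add: in\<Phi>)
    then show ?thesis by blast
  qed
  have "quotient_vs ?R L.K ?V \<Phi>"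
  proof
    show "pm.subspace ?R" by (rule L.X)
    show "pm.subspace L.K" by (rule L.K)
    show "L.K \<subseteq> ?R" by (rule L.KR)
    show "carrier ?V = \<Phi> ` ?R"
    proof
      show "carrier ?V \<subseteq> \<Phi> ` ?R"
      proof
        fix A assume "A \<in> carrier ?V"
        then obtain p s where ps: "A = ?E `` {(p, s)}" "p \<in> ?R" "s \<in> ?R" "pt u x \<sigma> s \<noteq> 0"
          by (auto simp: local_ring_def Let_def quotient_def frac)
        \<comment> \<open>\<open>s'\<close> inverts \<open>s\<close> modulo \<open>K\<close>, so the
          fraction of \<open>p\<close> and \<open>s\<close> is the class of
          \<open>p * s'\<close>.\<close>
        obtain s' where s': "s' \<in> ?R" "s * s' - 1 \<in> L.K" using L.unit_inverse ps by blast
        have "p * (s * s' - 1) \<in> L.K" by (rule Kmul[OF ps(2) s'(2)])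
        then have "(p, s) \<in> \<Phi> (p * s')"
          using ps s' by (simp add: in\<Phi> algebra_simps L.Rs)
        then have "A = \<Phi> (p * s')" using ps(1) cl\<Phi> by simp
        then show "A \<in> \<Phi> ` ?R" using ps(2) s'(1) L.Rs(3) by blast
      qed
      show "\<Phi> ` ?R \<subseteq> carrier ?V"
      proof
        fix A assume "A \<in> \<Phi> ` ?R"
        then obtain p where p: "A = ?E `` {(p, 1)}" "p \<in> ?R" by (auto simp: \<Phi>_def)
        then have "(p, 1) \<in> fractions \<sigma> ?\<zeta>" using one by (simp add: frac)
        then show "A \<in> carrier ?V" unfolding p(1) by (simp add: local_ring_def Let_def quotientI)
      qed
    qed
    show "\<Phi> p \<oplus>\<^bsub>?V\<^esub> \<Phi> q = \<Phi> (p + q)" if pq: "p \<in> ?R" "q \<in> ?R" for p q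
    proof -
      \<comment> \<open>The operations of the record are unions over all pairs of representatives.
        Each pair gives the same class, so the union over the nonempty classes collapses to
        it.\<close>
      have E: "?E `` {(a * t + b * s, s * t)} = \<Phi> (p + q)" if as: "(a, s) \<in> \<Phi> p" and bt: "(b, t) \<in> \<Phi> q" for a s b t
      proof (rule cl\<Phi>)
        have "t * (p * s - a) + s * (q * t - b) \<in> L.K" using as bt by (intro Kadd Kmul) (auto simp: in\<Phi>)
        moreover have "t * (p * s - a) + s * (q * t - b) = (p + q) * (s * t) - (a * t + b * s)"
          by (simp add: algebra_simps)
        ultimately show "(a * t + b * s, s * t) \<in> \<Phi> (p + q)"
          using as bt pq L.\<phi>_simps(2) by (simp add: in\<Phi> L.Rs)
      qed
      have E': "(\<Union>(b, t)\<in>\<Phi> q. ?E `` {(a * t + b * s, s * t)}) = \<Phi> (p + q)" if as: "(a, s) \<in> \<Phi> p" for a s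
        by (rule UN_pair_const[OF ne[OF pq(2)]]) (rule E[OF as])
      have "(\<Union>(a, s)\<in>\<Phi> p. \<Union>(b, t)\<in>\<Phi> q. ?E `` {(a * t + b * s, s * t)}) = \<Phi> (p + q)"
        by (rule UN_pair_const[OF ne[OF pq(1)]]) (rule E')
      then show ?thesis by (simp add: local_ring_def Let_def)
    qed
    show "\<zero>\<^bsub>?V\<^esub> = \<Phi> 0" by (simp add: local_ring_def Let_def \<Phi>_def)
    show "c \<odot>\<^bsub>?V\<^esub> \<Phi> p = \<Phi> (cst c * p)" if p: "p \<in> ?R" for c p
    proof -
      have E: "?E `` {(cst c * a, s)} = \<Phi> (cst c * p)" if as: "(a, s) \<in> \<Phi> p" for a s
      proof (rule cl\<Phi>)
        have "cst c * (p * s - a) \<in> L.K" using as by (intro Kmul L.Rs) (auto simp: in\<Phi>)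
        then show "(cst c * a, s) \<in> \<Phi> (cst c * p)"
          using as p by (simp add: in\<Phi> algebra_simps L.Rs)
      qed
      have "(\<Union>(a, s)\<in>\<Phi> p. ?E `` {(cst c * a, s)}) = \<Phi> (cst c * p)"
        by (rule UN_pair_const[OF ne[OF p]]) (rule E)
      then show ?thesis by (simp add: local_ring_def Let_def)
    qed
    show "(\<Phi> p = \<Phi> q) = (p - q \<in> L.K)" if "p \<in> ?R" "q \<in> ?R" for p q
      unfolding \<Phi>_def using that one by (subst eqcl) (auto simp: frac rel)
  qed
  then show ?thesis unfolding \<Phi>_def .
qed

section \<open>Graded pieces\<close>

lemma coset_mem: "g \<in> f +o W \<longleftrightarrow> g - f \<in> W" for f :: "'a::ab_group_add"
  unfolding elt_set_plus_def by (force intro: bexI[of _ "g - f"])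

lemma coset_eq:
  fixes f :: "'m::comm_monoid_add \<Rightarrow>\<^sub>0 complex"
  assumes W: "pm.subspace W"
  shows "f +o W = g +o W \<longleftrightarrow> f - g \<in> W"
proof
  assume "f +o W = g +o W"
  moreover have "f \<in> f +o W" using pm.subspace_0[OF W] by (simp only: coset_mem diff_self)
  ultimately show "f - g \<in> W" using coset_mem by blast
next
  assume fg: "f - g \<in> W"
  have "h - f \<in> W \<longleftrightarrow> h - g \<in> W" for h
  proof
    assume "h - f \<in> W"
    from pm.subspace_add[OF W this fg] show "h - g \<in> W" by simp
  next
    assume "h - g \<in> W"
    from pm.subspace_diff[OF W this fg] show "h - f \<in> W" by simp
  qed
  then show "f +o W = g +o W" using coset_mem by blast
qed

lemma graded_piece_mult:
  assumes "f \<in> graded_piece \<alpha>" "g \<in> graded_piece \<beta>"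
  shows "f * g \<in> graded_piece (\<alpha> + \<beta>)"
  unfolding graded_piece_def
proof (intro CollectI ballI)
  fix e assume "e \<in> Poly_Mapping.keys (f * g)"
  then obtain a b where "e = a + b" "a \<in> Poly_Mapping.keys f" "b \<in> Poly_Mapping.keys g"
    using keys_mult[of f g] by blast
  then show "int_vec e \<in> \<alpha> + \<beta>"
    using assms by (auto simp: int_vec_add graded_piece_def)
qed

lemma I_subspace: "pm.subspace I"
  unfolding pm.subspace_def using ID by blast

lemma graded_piece_subspace: "pm.subspace (graded_piece \<beta> :: 'k cox_poly set)"
proof -
  have "Poly_Mapping.keys (cst c * p) \<subseteq> Poly_Mapping.keys p" for c and p :: "'k cox_poly"
    using keys_mult[of "cst c" p] by (auto split: if_splits)
  then show ?thesis
    unfolding pm.subspace_def graded_piece_def using keys_add by fastforce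
qed

lemma graded_quotient_vs:
  "quotient_vs (graded_piece \<beta>) (I \<inter> graded_piece \<beta>) (graded_quotient I \<beta>) (\<lambda>f. f +o (I \<inter> graded_piece \<beta>))"
proof -
  let ?S = "graded_piece \<beta> :: 'k cox_poly set"
  let ?W = "I \<inter> ?S"
  have S: "pm.subspace ?S" by (rule graded_piece_subspace)
  have W: "pm.subspace ?W" using I_subspace S by (rule pm.subspace_inter)
  note mem = coset_mem and eq = coset_eq[OF W]
  show ?thesis
  proof
    show "pm.subspace ?S" "pm.subspace ?W" "?W \<subseteq> ?S" by (rule S, rule W, blast)
    show "carrier (graded_quotient I \<beta>) = (\<lambda>f. f +o ?W) ` ?S" by (simp add: graded_quotient_def Let_def)
    show "(p +o ?W) \<oplus>\<^bsub>graded_quotient I \<beta>\<^esub> (q +o ?W) = (p + q) +o ?W" for p q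
    proof -
      have "?W + ?W = ?W"
      proof
        show "?W + ?W \<subseteq> ?W" using pm.subspace_add[OF W] by (blast elim: set_plus_elim)
        show "?W \<subseteq> ?W + ?W" using set_plus_intro[OF _ pm.subspace_0[OF W], of _ ?W] by auto
      qed
      then show ?thesis by (simp add: graded_quotient_def Let_def set_plus_rearrange)
    qed
    show "\<zero>\<^bsub>graded_quotient I \<beta>\<^esub> = 0 +o ?W" by (simp add: graded_quotient_def Let_def)
    show "c \<odot>\<^bsub>graded_quotient I \<beta>\<^esub> (p +o ?W) = (cst c * p) +o ?W" for c p
    proof -
      have 1: "(cst c * f) +o ?W = (cst c * p) +o ?W" if "f \<in> p +o ?W" for f
        using pm.subspace_scale[OF W that[unfolded mem], of c] unfolding eq by (simp add: right_diff_distrib)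
      have 2: "p \<in> p +o ?W" using pm.subspace_0[OF W] by (simp only: mem diff_self)
      have "(\<Union>f\<in>p +o ?W. (cst c * f) +o ?W) = (cst c * p) +o ?W" by (rule UN_const_eq[OF 2 1])
      then show ?thesis by (simp add: graded_quotient_def Let_def)
    qed
    show "(p +o ?W = q +o ?W) = (p - q \<in> ?W)" for p q by (rule eq)
  qed
qed

lemma mult_map_eq:
  assumes g: "g \<in> graded_piece \<alpha>\<^sub>0"
  shows "mult_map I (\<alpha> + \<alpha>\<^sub>0) g (f +o (I \<inter> graded_piece \<alpha>)) = (f * g) +o (I \<inter> graded_piece (\<alpha> + \<alpha>\<^sub>0))"
proof -
  have 1: "(f' * g) +o (I \<inter> graded_piece (\<alpha> + \<alpha>\<^sub>0)) = (f * g) +o (I \<inter> graded_piece (\<alpha> + \<alpha>\<^sub>0))"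
    if "f' \<in> f +o (I \<inter> graded_piece \<alpha>)" for f'
  proof -
    have w: "f' - f \<in> I" "f' - f \<in> graded_piece \<alpha>" using that unfolding coset_mem by auto
    have "(f' - f) * g \<in> graded_piece (\<alpha> + \<alpha>\<^sub>0)" using w(2) g by (rule graded_piece_mult)
    moreover have "(f' - f) * g \<in> I" using ID(3)[OF w(1), of g] by (simp add: mult.commute)
    ultimately show ?thesis
      using coset_eq[OF pm.subspace_inter[OF I_subspace graded_piece_subspace]] by (simp add: left_diff_distrib)
  qed
  have 2: "f \<in> f +o (I \<inter> graded_piece \<alpha>)"
    using ID(1) pm.subspace_0[OF graded_piece_subspace, of \<alpha>] by (simp add: coset_mem)
  show ?thesis unfolding mult_map_def by (rule UN_const_eq[OF 2 1])
qed

end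

section \<open>Local trivializations of graded pieces\<close>

lemma coset_diff:
  assumes "\<beta> \<in> class_group u" "a \<in> \<beta>" "b \<in> \<beta>"
  shows "a - b \<in> range (FT u)"
proof -
  obtain c where "\<beta> = c +o range (FT u)" using assms(1) by (auto simp: class_group_def divisor_class_def)
  then obtain m n where "a = c + FT u m" "b = c + FT u n" using assms(2,3) by (auto simp: elt_set_plus_def)
  then have "a - b = FT u (m - n)" by (simp add: FT_diff)
  then show ?thesis by blast
qed

lemma range_FT_add: "a \<in> range (FT u) \<Longrightarrow> b \<in> range (FT u) \<Longrightarrow> a + b \<in> range (FT u)"
  by (auto simp: FT_add[symmetric])

context toric_ideal
begin

text \<open>The regular function that expresses \<open>f\<close> in the trivialization by
  \<open>x\<close> to the power \<open>b\<close>, which brings it to degree zero.\<close>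

definition section_at :: "int^'k \<Rightarrow> 'k cox_poly \<Rightarrow> 'n character_poly" where
  "section_at b f = dehom0 u (to_laurent f * mon b)"

text \<open>\<open>x\<^sup>b\<close> is a local generator in degree \<open>-\<beta>\<close> at a point of the orbit of \<open>\<tau>\<close>.\<close>

definition trivializes :: "(real^'n) set \<Rightarrow> (real^'n) set \<Rightarrow> (int^'k) set \<Rightarrow> int^'k \<Rightarrow> bool" where
  "trivializes \<tau> \<sigma> \<beta> b \<longleftrightarrow> (\<forall>i\<in>cone_rays u \<tau>. b $ i = 0) \<and> (\<forall>i\<in>cone_rays u \<sigma>. 0 \<le> b $ i) \<and>
     (\<forall>k\<in>\<beta>. k + b \<in> range (FT u))"

text \<open>A section that is nonzero at \<open>x\<close> contains a monomial that is nonzero at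
  \<open>x\<close>, hence has exponent 0 at the rays of \<open>\<tau>\<close>. The inverse of this
  monomial, times a power of a character that clears its negative exponents on
  \<open>\<sigma>\<close>, has the required properties.\<close>

lemma ex_trivializes:
  assumes x: "lifts x \<tau>" and \<sigma>: "\<sigma> \<in> \<Sigma>" "\<tau> \<subseteq> \<sigma>" and \<beta>: "\<beta> \<in> class_group u"
    and nb: "\<not> basepoint \<Sigma> u \<beta> (point_class x \<tau>)"
  obtains b where "trivializes \<tau> \<sigma> \<beta> b"
proof -
  have \<tau>: "\<tau> \<in> \<Sigma>" using x by (simp add: lifts_def)
  obtain f where f: "f \<in> graded_piece \<beta>" "poly_eval x f \<noteq> 0"
    using nb not_in_hypersurface[OF x] unfolding basepoint_def by blast
  have "\<exists>e\<in>Poly_Mapping.keys f. mval x (int_vec e) \<noteq> 0"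
  proof (rule ccontr)
    assume "\<not> ?thesis"
    then have "poly_eval x f = 0" by (simp add: poly_eval_lext lext_def)
    then show False using f(2) by simp
  qed
  then obtain e where e: "e \<in> Poly_Mapping.keys f" "mval x (int_vec e) \<noteq> 0" by blast
  have e0: "int_vec e $ i = 0" if "i \<in> cone_rays u \<tau>" for i
    using e(2) zero_set[OF x] that by (auto simp: mval_eq_0_iff)
  have e\<beta>: "int_vec e \<in> \<beta>" using f(1) e(1) by (simp add: graded_piece_def)
  obtain m where m: "\<And>i. i \<in> cone_rays u \<tau> \<Longrightarrow> FT u m $ i = 0"
    "\<And>i. i \<in> cone_rays u \<sigma> \<Longrightarrow> i \<notin> cone_rays u \<tau> \<Longrightarrow> 0 < FT u m $ i"
    using face_functional[OF \<sigma>(1) \<tau> \<sigma>(2)] by blast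
  obtain N :: nat where N: "\<And>i. 0 < FT u m $ i \<Longrightarrow> 0 \<le> (- int_vec e) $ i + int N * FT u m $ i"
    using shift_nonneg[of "FT u m" "- int_vec e"] by blast
  have "trivializes \<tau> \<sigma> \<beta> (- int_vec e + FT u (int N *s m))"
    unfolding trivializes_def
  proof (intro conjI ballI)
    show "(- int_vec e + FT u (int N *s m)) $ i = 0" if "i \<in> cone_rays u \<tau>" for i
      using m(1)[OF that] e0[OF that] by (simp add: FT_smult)
    show "0 \<le> (- int_vec e + FT u (int N *s m)) $ i" if i: "i \<in> cone_rays u \<sigma>" for i
    proof (cases "i \<in> cone_rays u \<tau>")
      case True
      then show ?thesis using m(1)[OF True] e0[OF True] by (simp add: FT_smult)
    next
      case False
      then show ?thesis using N[OF m(2)[OF i False]] by (simp add: FT_smult)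
    qed
    show "k + (- int_vec e + FT u (int N *s m)) \<in> range (FT u)" if "k \<in> \<beta>" for k
      using range_FT_add[OF coset_diff[OF \<beta> that e\<beta>], of "FT u (int N *s m)"] by (simp add: algebra_simps)
  qed
  then show ?thesis by (rule that)
qed

lemma trivializes_add:
  assumes "trivializes \<tau> \<sigma> \<beta> b" "trivializes \<tau> \<sigma> \<beta>' b'"
  shows "trivializes \<tau> \<sigma> (\<beta> + \<beta>') (b + b')"
  unfolding trivializes_def
proof (intro conjI ballI)
  fix k assume "k \<in> \<beta> + \<beta>'"
  then obtain k1 k2 where k: "k = k1 + k2" "k1 \<in> \<beta>" "k2 \<in> \<beta>'" by (rule set_plus_elim)
  have "(k1 + b) + (k2 + b') \<in> range (FT u)"
    by (rule range_FT_add) (use assms k in \<open>auto simp: trivializes_def\<close>)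
  then show "k + (b + b') \<in> range (FT u)" by (simp add: k add_ac)
qed (use assms in \<open>auto simp: trivializes_def\<close>)

context
  fixes x \<tau> \<sigma> \<beta> b
  assumes x: "lifts x \<tau>" and \<sigma>: "\<sigma> \<in> \<Sigma>" "\<tau> \<subseteq> \<sigma>" and b: "trivializes \<tau> \<sigma> \<beta> b"
begin

lemma section_keys:
  assumes "f \<in> graded_piece \<beta>"
  shows "Poly_Mapping.keys (to_laurent f * mon b) \<subseteq> range (FT u)"
    "e \<in> Poly_Mapping.keys (to_laurent f * mon b) \<Longrightarrow> i \<in> cone_rays u \<sigma> \<Longrightarrow> 0 \<le> e $ i"
proof -
  have k: "\<exists>k. int_vec k \<in> \<beta> \<and> e = int_vec k + b" if "e \<in> Poly_Mapping.keys (to_laurent f * mon b)" for e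
  proof -
    have "e - b \<in> int_vec ` Poly_Mapping.keys f" using that keys_to_laurent[of f] by (auto simp: keys_mult_mon_iff)
    then obtain k where "k \<in> Poly_Mapping.keys f" "e - b = int_vec k" by blast
    then show ?thesis using assms by (intro exI[of _ k]) (auto simp: graded_piece_def algebra_simps)
  qed
  show "Poly_Mapping.keys (to_laurent f * mon b) \<subseteq> range (FT u)"
    using k b unfolding trivializes_def by blast
  show "0 \<le> e $ i" if e: "e \<in> Poly_Mapping.keys (to_laurent f * mon b)" "i \<in> cone_rays u \<sigma>"
  proof -
    obtain k where "e = int_vec k + b" using k[OF e(1)] by blast
    then show ?thesis using b e(2) by (auto simp: trivializes_def int_vec_def)
  qed
qed

lemma cs_section: "f \<in> graded_piece \<beta> \<Longrightarrow> cox_substitution u (section_at b f) = to_laurent f * mon b"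
  unfolding section_at_def by (rule cs_dehom0[OF section_keys(1)])

lemma section_in_monalg: "f \<in> graded_piece \<beta> \<Longrightarrow> section_at b f \<in> monalg (dual_monoid \<sigma>)"
  unfolding section_at_def by (rule dehom0_in_monalg[OF \<sigma>(1) section_keys]) auto

lemma mval_section_nonzero: "mval x b \<noteq> 0"
  using b zero_set[OF x] by (auto simp: mval_eq_0_iff trivializes_def)

lemma pt_section:
  assumes f: "f \<in> graded_piece \<beta>"
  shows "pt u x \<sigma> (section_at b f) = poly_eval x f * mval x b"
proof -
  have "laurent_eval x (to_laurent f * mon b) = laurent_eval x (to_laurent f) * mval x b"
    using keys_to_laurent[of f] b zero_set[OF x]
    by (subst laurent_eval_mult) (auto simp: int_vec_def trivializes_def)
  then show ?thesis using section_in_monalg[OF f] by (simp add: pt_def cs_section[OF f] laurent_eval_to_laurent)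
qed

lemma section_chart_ideal:
  assumes f: "f \<in> graded_piece \<beta>" "f \<in> I"
  shows "section_at b f \<in> chart_ideal u \<sigma> I"
  unfolding chart_ideal_iff cs_section[OF f(1)]
  using b by (intro loc_memI[OF f(2)]) (auto simp: trivializes_def)

end

lemma section_add: "section_at b (f + g) = section_at b f + section_at b g"
  by (simp add: section_at_def to_laurent_add distrib_right dehom0_def map_key_plus[OF inj_FT])

lemma section_cst:
  assumes "f \<in> graded_piece \<beta>" "trivializes \<tau> \<sigma> \<beta> b" "lifts x \<tau>" "\<sigma> \<in> \<Sigma>" "\<tau> \<subseteq> \<sigma>"
  shows "section_at b (cst c * f) = cst c * section_at b f"
proof -
  have "to_laurent (cst c * f) * mon b = cst c * (to_laurent f * mon b)"
    by (simp add: to_laurent_mult mult.assoc)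
  also have "\<dots> = cox_substitution u (cst c * section_at b f)"
    using cs_section[OF assms(3-5,2,1)] by (simp add: cs_mult)
  finally show ?thesis by (simp add: section_at_def[of b "cst c * f"] dehom0_cs)
qed

lemma section_mult:
  assumes x: "lifts x \<tau>" and \<sigma>: "\<sigma> \<in> \<Sigma>" "\<tau> \<subseteq> \<sigma>" and b: "trivializes \<tau> \<sigma> \<beta> b" "trivializes \<tau> \<sigma> \<beta>' b'"
    and f: "f \<in> graded_piece \<beta>" "g \<in> graded_piece \<beta>'"
  shows "section_at (b + b') (f * g) = section_at b f * section_at b' g"
proof -
  have "to_laurent (f * g) * mon (b + b') = (to_laurent f * mon b) * (to_laurent g * mon b')"
    unfolding mon_mult[symmetric] to_laurent_mult by (simp only: mult_ac)
  also have "\<dots> = cox_substitution u (section_at b f * section_at b' g)"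
    using cs_section[OF x \<sigma> b(1) f(1)] cs_section[OF x \<sigma> b(2) f(2)] by (simp add: cs_mult)
  finally show ?thesis by (simp add: section_at_def[of "b + b'"] dehom0_cs)
qed

text \<open>\<open>f\<close> is zero in the local ring of the subscheme at the point. Any chart, any
  Laurent monomial that is a unit at the point and any nonvanishing multiplier \<open>r\<close> may
  witness it.\<close>

definition loc_zero :: "complex^'k \<Rightarrow> (real^'n) set \<Rightarrow> 'k cox_poly \<Rightarrow> bool" where
  "loc_zero x \<tau> f \<longleftrightarrow> (\<exists>\<sigma> b r. \<sigma> \<in> \<Sigma> \<and> \<tau> \<subseteq> \<sigma> \<and> (\<forall>i\<in>cone_rays u \<tau>. b $ i = 0) \<and> r \<in> monalg (dual_monoid \<sigma>) \<and>
        laurent_eval x (cox_substitution u r) \<noteq> 0 \<and>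
        cox_substitution u r * (to_laurent f * mon b) \<in> localization u \<sigma> I)"

text \<open>One lift of each point suffices. Two lifts of the same point share the cone
  \<open>\<tau>\<close>, since the point lies in the same charts, and regular functions have the
  same values at both.\<close>

lemma loc_zero_imp_saturation:
  assumes "\<And>\<zeta>. \<zeta> \<in> ideal_points \<Sigma> u I \<Longrightarrow> \<exists>x \<tau>. lifts x \<tau> \<and> \<zeta> = point_class x \<tau> \<and> loc_zero x \<tau> f"
  shows "f \<in> saturation I (irrelevant_ideal \<Sigma> u)"
proof (rule locally_zero_imp_saturation)
  fix x \<tau> assume x: "lifts x \<tau>" and pt: "point_class x \<tau> \<in> ideal_points \<Sigma> u I"
  obtain x' \<tau>' where x': "lifts x' \<tau>'" "point_class x \<tau> = point_class x' \<tau>'" "loc_zero x' \<tau>' f"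
    using assms[OF pt] by blast
  have sub: "\<sigma> \<in> \<Sigma> \<Longrightarrow> \<tau> \<subseteq> \<sigma> \<longleftrightarrow> \<tau>' \<subseteq> \<sigma>" for \<sigma>
    using in_affine_chart_iff[OF x, of \<sigma>] in_affine_chart_iff[OF x'(1), of \<sigma>] x'(2) by simp
  have "\<tau> \<in> \<Sigma>" "\<tau>' \<in> \<Sigma>" using x x'(1) by (auto simp: lifts_def)
  then have \<tau>: "\<tau>' = \<tau>" using sub by blast
  obtain \<sigma> b r where *: "\<sigma> \<in> \<Sigma>" "\<tau> \<subseteq> \<sigma>" "\<forall>i\<in>cone_rays u \<tau>. b $ i = 0" "r \<in> monalg (dual_monoid \<sigma>)"
    "laurent_eval x' (cox_substitution u r) \<noteq> 0"
    "cox_substitution u r * (to_laurent f * mon b) \<in> localization u \<sigma> I"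
    using x'(3) unfolding loc_zero_def \<tau> by blast
  have "laurent_eval x (cox_substitution u r) = laurent_eval x' (cox_substitution u r)"
    using ev_point_class[OF x *(1,2,4)] ev_point_class[OF x'(1) *(1) _ *(4)] *(2) x'(2) \<tau> by simp
  then show "\<exists>\<sigma> b r. \<sigma> \<in> \<Sigma> \<and> \<tau> \<subseteq> \<sigma> \<and> (\<forall>i\<in>cone_rays u \<tau>. b $ i = 0) \<and> r \<in> monalg (dual_monoid \<sigma>) \<and>
        laurent_eval x (cox_substitution u r) \<noteq> 0 \<and>
        cox_substitution u r * (to_laurent f * mon b) \<in> localization u \<sigma> I"
    using * by (intro exI[of _ \<sigma>] exI[of _ b] exI[of _ r]) auto
qed

lemma section_K_imp_loc_zero:
  assumes x: "lifts x \<tau>" and \<sigma>: "\<sigma> \<in> \<Sigma>" "\<tau> \<subseteq> \<sigma>" and b: "trivializes \<tau> \<sigma> \<beta> b" and f: "f \<in> graded_piece \<beta>"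
    and L: "local_algebra (dual_monoid \<sigma>) (chart_ideal u \<sigma> I) (pt u x \<sigma>) P G"
    and K: "section_at b f \<in> local_algebra.K (dual_monoid \<sigma>) (chart_ideal u \<sigma> I) (pt u x \<sigma>)"
  shows "loc_zero x \<tau> f"
proof -
  obtain r where r: "r \<in> monalg (dual_monoid \<sigma>)" "pt u x \<sigma> r \<noteq> 0" "r * section_at b f \<in> chart_ideal u \<sigma> I"
    using K unfolding local_algebra.K_def[OF L] by blast
  have "cox_substitution u r * (to_laurent f * mon b) \<in> localization u \<sigma> I"
    using r(3) unfolding chart_ideal_iff cs_mult cs_section[OF x \<sigma> b f] .
  moreover have "laurent_eval x (cox_substitution u r) \<noteq> 0" using r(1,2) by (simp add: pt_def)
  ultimately show ?thesis
    unfolding loc_zero_def using \<sigma> r(1) b by (intro exI[of _ \<sigma>] exI[of _ b] exI[of _ r]) (auto simp: trivializes_def)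
qed

text \<open>In local trivializations \<open>h\<close> becomes a function that is nonzero at the
  point, so it can be cancelled by \<open>K_unitD\<close>.\<close>

lemma multiplication_loc_injective:
  assumes x: "lifts x \<tau>" and pt: "point_class x \<tau> \<in> ideal_points \<Sigma> u I"
    and \<alpha>: "\<alpha> \<in> class_group u" "\<alpha>\<^sub>0 \<in> class_group u"
    and nb: "\<not> basepoint \<Sigma> u \<alpha> (point_class x \<tau>)" "\<not> basepoint \<Sigma> u \<alpha>\<^sub>0 (point_class x \<tau>)"
    and h: "h \<in> graded_piece \<alpha>\<^sub>0" "poly_eval x h \<noteq> 0" and p: "p \<in> graded_piece \<alpha>" "p * h \<in> I"
  shows "loc_zero x \<tau> p"
proof -
  have \<tau>: "\<tau> \<in> \<Sigma>" "\<tau> \<subseteq> \<tau>" using x by (auto simp: lifts_def)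
  obtain P G where L: "local_algebra (dual_monoid \<tau>) (chart_ideal u \<tau> I) (pt u x \<tau>) P G"
    using local_algebra_point[OF x pt \<tau>] .
  interpret L: local_algebra "dual_monoid \<tau>" "chart_ideal u \<tau> I" "pt u x \<tau>" P G by (rule L)
  obtain b where b: "trivializes \<tau> \<tau> \<alpha> b" using ex_trivializes[OF x \<tau> \<alpha>(1) nb(1)] .
  obtain c where c: "trivializes \<tau> \<tau> \<alpha>\<^sub>0 c" using ex_trivializes[OF x \<tau> \<alpha>(2) nb(2)] .
  have "section_at (b + c) (p * h) \<in> chart_ideal u \<tau> I"
    by (rule section_chart_ideal[OF x \<tau> trivializes_add[OF b c] graded_piece_mult[OF p(1) h(1)] p(2)])
  then have 1: "section_at c h * section_at b p \<in> L.K"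
    using L.JK section_mult[OF x \<tau> b c p(1) h(1)] by (auto simp: mult.commute)
  have 2: "pt u x \<tau> (section_at c h) \<noteq> 0"
    using pt_section[OF x \<tau> c h(1)] mval_section_nonzero[OF x \<tau> c] h(2) by simp
  have "section_at b p \<in> L.K"
    by (rule L.K_unitD[OF section_in_monalg[OF x \<tau> c h(1)] 2 1 section_in_monalg[OF x \<tau> b p(1)]])
  then show ?thesis by (rule section_K_imp_loc_zero[OF x \<tau> b p(1) L])
qed

text \<open>In trivializations the germ of \<open>g / h\<close> is the section of \<open>g\<close>
  times an inverse of the section of \<open>h\<close> modulo \<open>K\<close>. The matrix identity
  is stated for elements \<open>p * h\<close>, on which \<open>t\<close> minus the endomorphism is
  \<open>t * p * h - p * g\<close>, so no inverse on graded pieces is needed here.\<close>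

lemma point_functionals:
  assumes x: "lifts x \<tau>" and pt: "point_class x \<tau> \<in> ideal_points \<Sigma> u I"
    and \<alpha>: "\<alpha> \<in> class_group u" "\<alpha>\<^sub>0 \<in> class_group u"
    and nb: "\<not> basepoint \<Sigma> u \<alpha> (point_class x \<tau>)" "\<not> basepoint \<Sigma> u \<alpha>\<^sub>0 (point_class x \<tau>)"
    and g: "g \<in> graded_piece \<alpha>\<^sub>0" and h: "h \<in> graded_piece \<alpha>\<^sub>0" "poly_eval x h \<noteq> 0"
  defines "\<mu> \<equiv> multiplicity_at \<Sigma> u I (point_class x \<tau>)"
  shows "\<exists>l U. (\<forall>r<\<mu>. linear_mod (graded_piece (\<alpha> + \<alpha>\<^sub>0)) (I \<inter> graded_piece (\<alpha> + \<alpha>\<^sub>0)) (l r)) \<and>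
    (\<forall>f\<in>graded_piece (\<alpha> + \<alpha>\<^sub>0). (\<forall>r<\<mu>. l r f = 0) \<longrightarrow> loc_zero x \<tau> f) \<and>
    (\<forall>r<\<mu>. \<forall>p\<in>graded_piece \<alpha>. l r (cst t * (p * h) - p * g) = (\<Sum>s<\<mu>. U r s * l s (p * h))) \<and>
    (\<forall>r<\<mu>. \<forall>s<r. U r s = (0::complex)) \<and> (\<forall>r<\<mu>. U r r = t - poly_eval x g / poly_eval x h)"
proof -
  \<comment> \<open>The chart chosen by \<open>multiplicity_at\<close>, so that the number of
    functionals is literally the multiplicity.\<close>
  define \<sigma> where "\<sigma> = (SOME \<sigma>. \<sigma> \<in> \<Sigma> \<and> point_class x \<tau> \<in> affine_chart \<Sigma> \<sigma>)"
  have "\<exists>\<sigma>. \<sigma> \<in> \<Sigma> \<and> point_class x \<tau> \<in> affine_chart \<Sigma> \<sigma>"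
    using x in_affine_chart_iff[OF x] by (intro exI[of _ \<tau>]) (auto simp: lifts_def)
  from someI_ex[OF this] have \<sigma>: "\<sigma> \<in> \<Sigma>" "\<tau> \<subseteq> \<sigma>"
    using in_affine_chart_iff[OF x] unfolding \<sigma>_def by auto
  obtain P G where L: "local_algebra (dual_monoid \<sigma>) (chart_ideal u \<sigma> I) (pt u x \<sigma>) P G"
    using local_algebra_point[OF x pt \<sigma>] .
  interpret L: local_algebra "dual_monoid \<sigma>" "chart_ideal u \<sigma> I" "pt u x \<sigma>" P G by (rule L)
  interpret Q: quotient_vs L.R L.K "local_ring u I \<sigma> (point_class x \<tau>)"
    "\<lambda>p. fraction_rel u I \<sigma> (point_class x \<tau>) `` {(p, 1)}" by (rule local_ring_quotient[OF x pt \<sigma>])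
  obtain b where b: "trivializes \<tau> \<sigma> \<alpha> b" using ex_trivializes[OF x \<sigma> \<alpha>(1) nb(1)] .
  obtain c where c: "trivializes \<tau> \<sigma> \<alpha>\<^sub>0 c" using ex_trivializes[OF x \<sigma> \<alpha>(2) nb(2)] .
  note bc = trivializes_add[OF b c]
  let ?s = "section_at c h" and ?S = "graded_piece (\<alpha> + \<alpha>\<^sub>0) :: 'k cox_poly set"
  have s: "?s \<in> L.R" "pt u x \<sigma> ?s = poly_eval x h * mval x c" "pt u x \<sigma> ?s \<noteq> 0"
    using section_in_monalg[OF x \<sigma> c h(1)] pt_section[OF x \<sigma> c h(1)] mval_section_nonzero[OF x \<sigma> c] h(2) by auto
  obtain s' where s': "s' \<in> L.R" "?s * s' - 1 \<in> L.K" using L.unit_inverse[OF s(1,3)] .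
  have sg: "section_at c g \<in> L.R" "pt u x \<sigma> (section_at c g) = poly_eval x g * mval x c"
    using section_in_monalg[OF x \<sigma> c g] pt_section[OF x \<sigma> c g] by auto
  define a where "a = cst t - section_at c g * s'"
  have aR: "a \<in> L.R" unfolding a_def by (intro L.Rs(3,4,5) sg s')
  \<comment> \<open>Elements of \<open>K\<close> vanish at the point, so the value of
    \<open>s'\<close> is the inverse of that of the section of \<open>h\<close>, and the monomial
    factors of the two sections cancel.\<close>
  have "pt u x \<sigma> (?s * s' - 1) = 0"
    using s'(2) L.\<phi>J unfolding L.K_def
    by (auto simp: L.\<phi>_simps dest!: L.\<phi>J)
  then have "pt u x \<sigma> s' = inverse (pt u x \<sigma> ?s)"
    using s s' by (simp add: L.\<phi>_diff L.\<phi>_simps L.Rs L.\<phi>_1 field_simps)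
  then have \<phi>a: "pt u x \<sigma> a = t - poly_eval x g / poly_eval x h"
    using s s' sg mval_section_nonzero[OF x \<sigma> c]
    unfolding a_def by (simp add: L.\<phi>_diff L.\<phi>_simps L.Rs field_simps)
  obtain \<mu>' e l U where *: "\<And>r. r < \<mu>' \<Longrightarrow> e r \<in> L.R" "indep_mod L.K e \<mu>'" "spans_mod L.R L.K e \<mu>'"
    "\<And>r. r < \<mu>' \<Longrightarrow> linear_mod L.R L.K (l r)"
    "\<And>x. x \<in> L.R \<Longrightarrow> (\<And>r. r < \<mu>' \<Longrightarrow> l r x = 0) \<Longrightarrow> x \<in> L.K"
    "\<And>r x. r < \<mu>' \<Longrightarrow> x \<in> L.R \<Longrightarrow> l r (a * x) = (\<Sum>s<\<mu>'. U r s * l s x)"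
    "\<And>r s. s < r \<Longrightarrow> r < \<mu>' \<Longrightarrow> U r s = (0::complex)" "\<And>r. r < \<mu>' \<Longrightarrow> U r r = pt u x \<sigma> a"
    by (rule L.multiplication_functionals[OF aR]) blast
  have \<mu>: "\<mu>' = \<mu>"
    using Q.basis_imageI(3)[OF *(1-3)] unfolding \<mu>_def multiplicity_at_def \<sigma>_def by simp
  define \<Psi> where "\<Psi> = section_at (b + c)"
  have \<Psi>R: "\<Psi> f \<in> L.R" if "f \<in> ?S" for f
    unfolding \<Psi>_def by (rule section_in_monalg[OF x \<sigma> bc that])
  show ?thesis
  proof (intro exI[of _ "\<lambda>r f. l r (\<Psi> f)"] exI[of _ U] conjI allI impI ballI)
    show "linear_mod ?S (I \<inter> ?S) (\<lambda>f. l r (\<Psi> f))" if r: "r < \<mu>" for r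
      unfolding linear_mod_def
    proof (intro conjI ballI allI)
      show "l r (\<Psi> (f + f')) = l r (\<Psi> f) + l r (\<Psi> f')" if "f \<in> ?S" "f' \<in> ?S" for f f'
        using *(4) r \<mu> \<Psi>R that by (simp add: \<Psi>_def section_add linear_mod_def)
      show "l r (\<Psi> (cst k * f)) = k * l r (\<Psi> f)" if "f \<in> ?S" for f k
        using *(4) r \<mu> \<Psi>R that section_cst[OF that bc x \<sigma>] by (simp add: \<Psi>_def linear_mod_def)
      show "l r (\<Psi> f) = 0" if "f \<in> I \<inter> ?S" for f
        using *(4) r \<mu> L.JK section_chart_ideal[OF x \<sigma> bc, of f] that by (auto simp: \<Psi>_def linear_mod_def)
    qed
    show "loc_zero x \<tau> f" if f: "f \<in> ?S" and z: "\<forall>r<\<mu>. l r (\<Psi> f) = 0" for f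
    proof -
      have "\<Psi> f \<in> L.K" using *(5)[OF \<Psi>R[OF f]] z \<mu> by blast
      then show ?thesis using section_K_imp_loc_zero[OF x \<sigma> bc f L] by (simp add: \<Psi>_def)
    qed
    show "l r (\<Psi> (cst t * (p * h) - p * g)) = (\<Sum>s<\<mu>. U r s * l s (\<Psi> (p * h)))"
      if r: "r < \<mu>" and p: "p \<in> graded_piece \<alpha>" for r p
    proof -
      note S = graded_piece_mult[OF p h(1)] graded_piece_mult[OF p g]
      have bp: "section_at b p \<in> L.R" by (rule section_in_monalg[OF x \<sigma> b p])
      have ph: "\<Psi> (p * h) = section_at b p * ?s" and pg: "\<Psi> (p * g) = section_at b p * section_at c g"
        unfolding \<Psi>_def using section_mult[OF x \<sigma> b c p] h(1) g by blast+
      have D: "\<Psi> (cst t * (p * h) - p * g) = cst t * \<Psi> (p * h) - \<Psi> (p * g)"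
      proof -
        have "\<Psi> (cst t * (p * h) - p * g) + \<Psi> (p * g) = \<Psi> (cst t * (p * h))"
          unfolding \<Psi>_def section_add[symmetric] by simp
        then show ?thesis using section_cst[OF S(1) bc x \<sigma>] by (simp add: \<Psi>_def algebra_simps)
      qed
      have "\<Psi> (cst t * (p * h) - p * g) - a * \<Psi> (p * h) = section_at b p * section_at c g * (?s * s' - 1)"
        unfolding D a_def ph pg by (simp add: algebra_simps)
      also have "\<dots> \<in> L.K" using bp sg by (intro ideal_ofD(4)[OF L.K_ideal] L.Rs(3) s'(2))
      finally have "l r (\<Psi> (cst t * (p * h) - p * g)) = l r (a * \<Psi> (p * h))"
        using r \<mu> \<Psi>R S aR L.Rs(3,4,5) D by (intro linear_mod_cong[OF *(4) L.X L.KR]) auto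
      then show ?thesis using *(6)[of r "\<Psi> (p * h)"] r \<mu> \<Psi>R[OF S(1)] by simp
    qed
    show "U r s = 0" if "r < \<mu>" "s < r" for r s using *(7) that \<mu> by simp
    show "U r r = t - poly_eval x g / poly_eval x h" if "r < \<mu>" for r using *(8) that \<mu> \<phi>a by simp
  qed
qed

end

section \<open>The characteristic polynomial\<close>

text \<open>Numbers the functionals of all points consecutively while keeping the order within each
  point, so that a block matrix with triangular blocks is itself triangular.\<close>

lemma ordered_sigma_enumeration:
  fixes \<mu> :: "'i \<Rightarrow> nat"
  assumes "finite A"
  obtains e where "bij_betw e {..<\<Sum>i\<in>A. \<mu> i} (SIGMA i:A. {..<\<mu> i})"
    "\<And>r s. s < r \<Longrightarrow> r < (\<Sum>i\<in>A. \<mu> i) \<Longrightarrow> fst (e r) = fst (e s) \<Longrightarrow> snd (e s) < snd (e r)"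
  using assms
proof (induction A arbitrary: thesis rule: finite_induct)
  case empty
  show ?case by (rule empty[of "\<lambda>_. undefined"]) (auto simp: bij_betw_def)
next
  case (insert a A)
  let ?n = "\<Sum>i\<in>A. \<mu> i"
  obtain e where e: "bij_betw e {..<?n} (SIGMA i:A. {..<\<mu> i})"
    "\<And>r s. s < r \<Longrightarrow> r < ?n \<Longrightarrow> fst (e r) = fst (e s) \<Longrightarrow> snd (e s) < snd (e r)"
    using insert.IH by blast
  define e' where "e' k = (if k < ?n then e k else (a, k - ?n))" for k
  have N: "(\<Sum>i\<in>insert a A. \<mu> i) = ?n + \<mu> a" using insert by simp
  have fstA: "fst (e k) \<in> A" if "k < ?n" for k
  proof -
    have "e k \<in> (SIGMA i:A. {..<\<mu> i})" using that bij_betw_apply[OF e(1)] by blast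
    then show ?thesis by auto
  qed
  show ?case
  proof (rule insert.prems[of e'])
    have "bij_betw e' ({..<?n} \<union> {?n..<?n + \<mu> a}) ((SIGMA i:A. {..<\<mu> i}) \<union> {a} \<times> {..<\<mu> a})"
    proof (rule bij_betw_combine)
      show "bij_betw e' {..<?n} (SIGMA i:A. {..<\<mu> i})"
        using e(1) by (subst bij_betw_cong[of _ e' e]) (auto simp: e'_def)
      show "bij_betw e' {?n..<?n + \<mu> a} ({a} \<times> {..<\<mu> a})"
        by (rule bij_betw_byWitness[of _ "\<lambda>z. snd z + ?n"]) (auto simp: e'_def)
      show "(SIGMA i:A. {..<\<mu> i}) \<inter> {a} \<times> {..<\<mu> a} = {}" using insert.hyps by auto
    qed
    moreover have "{..<?n} \<union> {?n..<?n + \<mu> a} = {..<\<Sum>i\<in>insert a A. \<mu> i}" unfolding N by auto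
    moreover have "(SIGMA i:A. {..<\<mu> i}) \<union> {a} \<times> {..<\<mu> a} = (SIGMA i:insert a A. {..<\<mu> i})" by auto
    ultimately show "bij_betw e' {..<\<Sum>i\<in>insert a A. \<mu> i} (SIGMA i:insert a A. {..<\<mu> i})" by simp
    fix r s assume rs: "s < r" "r < (\<Sum>i\<in>insert a A. \<mu> i)" "fst (e' r) = fst (e' s)"
    show "snd (e' s) < snd (e' r)"
    proof (cases "r < ?n")
      case True
      then show ?thesis using rs e(2)[of s r] by (simp add: e'_def)
    next
      case False
      then have "\<not> s < ?n" using rs fstA[of s] insert.hyps by (auto simp: e'_def)
      then show ?thesis using False rs by (simp add: e'_def)
    qed
  qed
qed

section \<open>Evaluation of \<open>eta\<close> at lifted points and the determinant\<close>

context toric_ideal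
begin

text \<open>\<open>eta\<close> multiplies by a fixed polynomial and divides by a fixed monomial, so
  in Cox coordinates it rescales evaluation by a constant that does not depend on
  \<open>f\<close>.\<close>

lemma ev_eta:
  assumes x: "lifts x \<tau>" and \<sigma>: "\<sigma> \<in> maximal_cones \<Sigma>" "\<tau> \<subseteq> \<sigma>"
    and \<alpha>\<^sub>0: "\<alpha>\<^sub>0 \<in> class_group u" and choice: "eta_choice u I \<alpha>\<^sub>0 h \<sigma> \<gamma> g\<^sub>\<sigma>"
  obtains c where "\<And>f. f \<in> graded_piece \<alpha>\<^sub>0 \<Longrightarrow> eta u \<sigma> \<gamma> g\<^sub>\<sigma> f \<in> monalg (dual_monoid \<sigma>)"
    "\<And>f. f \<in> graded_piece \<alpha>\<^sub>0 \<Longrightarrow> ev \<sigma> (point_class x \<tau>) (eta u \<sigma> \<gamma> g\<^sub>\<sigma> f) = c * poly_eval x f"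
proof -
  have \<sigma>\<Sigma>: "\<sigma> \<in> \<Sigma>" using \<sigma>(1) by (simp add: maximal_cones_def)
  have \<gamma>: "\<gamma> \<in> class_group u" and g: "g\<^sub>\<sigma> \<in> graded_piece (class_diff \<gamma> \<alpha>\<^sub>0)"
    and nz: "dehom u \<sigma> \<gamma> (g\<^sub>\<sigma> * h) \<noteq> 0"
    using choice by (auto simp: eta_choice_def)
  have ex: "\<exists>e. dehom_exponent u \<sigma> \<gamma> e"
    using nz by (auto simp: dehom_def split: if_splits)
  have ep: "(\<forall>i\<in>cone_rays u \<sigma>. e $ i = 0) \<and> e \<in> \<gamma>" if "dehom_exponent u \<sigma> \<gamma> e" for e
    using that unfolding dehom_exponent_def divisor_class_def by (auto simp: elt_set_plus_def add.commute)
  define e where "e = (THE e. dehom_exponent u \<sigma> \<gamma> e)"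
  \<comment> \<open>Two candidates differ by a character that is 0 on all rays of a full-dimensional
    cone, so the definite description in \<open>dehom\<close> is proper.\<close>
  have uniq: "e1 = e2" if e12: "dehom_exponent u \<sigma> \<gamma> e1" "dehom_exponent u \<sigma> \<gamma> e2" for e1 e2
  proof -
    obtain m where m: "e1 - e2 = FT u m" using coset_diff[OF \<gamma>] ep[OF e12(1)] ep[OF e12(2)] by blast
    have "FT u m $ i = 0" if "i \<in> cone_rays u \<sigma>" for i
      using ep[OF e12(1)] ep[OF e12(2)] that
      unfolding m[symmetric] by simp
    then have "m = 0" by (rule maximal_cone_FT_zero[OF \<sigma>(1)])
    then show ?thesis using m by simp
  qed
  have "dehom_exponent u \<sigma> \<gamma> e"
    unfolding e_def using ex uniq by (intro theI'[of "dehom_exponent u \<sigma> \<gamma>"]) blast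
  then have e: "\<And>i. i \<in> cone_rays u \<sigma> \<Longrightarrow> e $ i = 0" "e \<in> \<gamma>" using ep by auto
  have eta: "eta u \<sigma> \<gamma> g\<^sub>\<sigma> f = dehom0 u (to_laurent (g\<^sub>\<sigma> * f) * mon (- e))" for f
    using ex by (simp add: eta_def dehom_def e_def)
  have tr: "trivializes \<tau> \<sigma> (class_diff \<gamma> \<alpha>\<^sub>0 + \<alpha>\<^sub>0) (- e)"
    unfolding trivializes_def
  proof (intro conjI ballI)
    show "(- e) $ i = 0" if "i \<in> cone_rays u \<tau>" for i
      using e(1) cone_rays_mono[OF x \<sigma>\<Sigma> \<sigma>(2)] that by auto
    show "0 \<le> (- e) $ i" if "i \<in> cone_rays u \<sigma>" for i using e(1)[OF that] by simp
    fix k assume "k \<in> class_diff \<gamma> \<alpha>\<^sub>0 + \<alpha>\<^sub>0"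
    then obtain a b b' where k: "k = (a - b) + b'" "a \<in> \<gamma>" "b \<in> \<alpha>\<^sub>0" "b' \<in> \<alpha>\<^sub>0"
      by (auto simp: class_diff_def elim!: set_plus_elim)
    have "(a - e) + (b' - b) \<in> range (FT u)"
      by (rule range_FT_add[OF coset_diff[OF \<gamma> k(2) e(2)] coset_diff[OF \<alpha>\<^sub>0 k(4,3)]])
    then show "k + (- e) \<in> range (FT u)" by (simp add: k(1) algebra_simps)
  qed
  show ?thesis
  proof (rule that[of "poly_eval x g\<^sub>\<sigma> * mval x (- e)"])
    fix f assume f: "f \<in> graded_piece \<alpha>\<^sub>0"
    have gf: "g\<^sub>\<sigma> * f \<in> graded_piece (class_diff \<gamma> \<alpha>\<^sub>0 + \<alpha>\<^sub>0)" by (rule graded_piece_mult[OF g f])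
    show R: "eta u \<sigma> \<gamma> g\<^sub>\<sigma> f \<in> monalg (dual_monoid \<sigma>)"
      using section_in_monalg[OF x \<sigma>\<Sigma> \<sigma>(2) tr gf] by (simp add: eta section_at_def)
    have "ev \<sigma> (point_class x \<tau>) (eta u \<sigma> \<gamma> g\<^sub>\<sigma> f) = pt u x \<sigma> (eta u \<sigma> \<gamma> g\<^sub>\<sigma> f)"
      using ev_point_class[OF x \<sigma>\<Sigma> \<sigma>(2) R] R by (simp add: pt_def)
    also have "\<dots> = poly_eval x (g\<^sub>\<sigma> * f) * mval x (- e)"
      using pt_section[OF x \<sigma>\<Sigma> \<sigma>(2) tr gf] by (simp add: eta section_at_def)
    finally show "ev \<sigma> (point_class x \<tau>) (eta u \<sigma> \<gamma> g\<^sub>\<sigma> f) = poly_eval x g\<^sub>\<sigma> * mval x (- e) * poly_eval x f"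
      by (simp add: poly_eval_mult mult_ac)
  qed
qed

text \<open>The constant of \<open>ev_eta\<close> cancels. It is nonzero because \<open>eta\<close>
  sends \<open>h\<close> to a function that is 1 modulo the chart ideal, hence 1 at the
  point.\<close>

lemma eta_ratio:
  assumes x: "lifts x \<tau>" and pt: "point_class x \<tau> \<in> ideal_points \<Sigma> u I"
    and \<sigma>: "\<sigma> \<in> maximal_cones \<Sigma>" "\<tau> \<subseteq> \<sigma>"
    and \<alpha>\<^sub>0: "\<alpha>\<^sub>0 \<in> class_group u" and choice: "eta_choice u I \<alpha>\<^sub>0 h \<sigma> \<gamma> g\<^sub>\<sigma>"
    and h: "h \<in> graded_piece \<alpha>\<^sub>0" and g: "g \<in> graded_piece \<alpha>\<^sub>0" and h0: "h\<^sub>0 \<in> graded_piece \<alpha>\<^sub>0"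
  shows "ev \<sigma> (point_class x \<tau>) (eta u \<sigma> \<gamma> g\<^sub>\<sigma> g) / ev \<sigma> (point_class x \<tau>) (eta u \<sigma> \<gamma> g\<^sub>\<sigma> h\<^sub>0)
    = poly_eval x g / poly_eval x h\<^sub>0"
proof -
  obtain c where c: "\<And>f. f \<in> graded_piece \<alpha>\<^sub>0 \<Longrightarrow> eta u \<sigma> \<gamma> g\<^sub>\<sigma> f \<in> monalg (dual_monoid \<sigma>)"
    "\<And>f. f \<in> graded_piece \<alpha>\<^sub>0 \<Longrightarrow> ev \<sigma> (point_class x \<tau>) (eta u \<sigma> \<gamma> g\<^sub>\<sigma> f) = c * poly_eval x f"
    by (rule ev_eta[OF x \<sigma> \<alpha>\<^sub>0 choice]) blast
  have \<sigma>\<Sigma>: "\<sigma> \<in> \<Sigma>" using \<sigma>(1) by (simp add: maximal_cones_def)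
  have "eta u \<sigma> \<gamma> g\<^sub>\<sigma> h - 1 \<in> chart_ideal u \<sigma> I" using choice by (simp add: eta_choice_def eta_def)
  then have "laurent_eval x (cox_substitution u (eta u \<sigma> \<gamma> g\<^sub>\<sigma> h - 1)) = 0"
    by (rule vanish_all_charts[OF x pt \<sigma>\<Sigma> \<sigma>(2)])
  moreover have "laurent_eval x (cox_substitution u 1) = 1"
    using cs_single[of u 0 1] laurent_eval_single[of x 0 1] by (simp only: FT_0 single_one mval_0 mult_1)
  ultimately have "laurent_eval x (cox_substitution u (eta u \<sigma> \<gamma> g\<^sub>\<sigma> h)) = 1"
    by (simp add: cs_diff laurent_eval_diff)
  then have "c * poly_eval x h = 1"
    using c(2)[OF h] ev_point_class[OF x \<sigma>\<Sigma> \<sigma>(2) c(1)[OF h]] by simp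
  then have "c \<noteq> 0" by auto
  then show ?thesis using c(2)[OF g] c(2)[OF h0] by simp
qed

lemma regular_injective:
  assumes "\<beta> \<in> regularity \<Sigma> u I" "f \<in> graded_piece \<beta>"
    and "\<And>\<zeta>. \<zeta> \<in> ideal_points \<Sigma> u I \<Longrightarrow> \<exists>x \<tau>. lifts x \<tau> \<and> \<zeta> = point_class x \<tau> \<and> loc_zero x \<tau> f"
  shows "f \<in> I"
proof -
  have "f \<in> saturation I (irrelevant_ideal \<Sigma> u) \<inter> graded_piece \<beta>"
    using loc_zero_imp_saturation[OF assms(3)] assms(2) by blast
  then show ?thesis using assms(1) by (simp add: regularity_def flip: Int_iff) blast
qed

lemma det_multiplication:
  fixes \<zeta> :: "nat \<Rightarrow> 'n toric_point"
  assumes \<zeta>: "bij_betw \<zeta> {1..\<delta>} (ideal_points \<Sigma> u I)"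
    and reg: "regularity_pair \<Sigma> u I \<alpha> \<alpha>\<^sub>0"
    and g: "g \<in> graded_piece \<alpha>\<^sub>0" and h: "h \<in> graded_piece \<alpha>\<^sub>0"
    and x: "\<And>i. i \<in> {1..\<delta>} \<Longrightarrow> lifts (x i) (\<tau> i) \<and> \<zeta> i = point_class (x i) (\<tau> i)"
    and hx: "\<And>i. i \<in> {1..\<delta>} \<Longrightarrow> poly_eval (x i) h \<noteq> 0"
  defines "Q \<equiv> graded_quotient I (\<alpha> + \<alpha>\<^sub>0)" and "M \<equiv> mult_map I (\<alpha> + \<alpha>\<^sub>0)"
  defines "T \<equiv> M g \<circ> inv_into (carrier (graded_quotient I \<alpha>)) (M h)"
  shows "endo_det Q (\<lambda>v. (t \<odot>\<^bsub>Q\<^esub> v) \<ominus>\<^bsub>Q\<^esub> T v)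
     = (\<Prod>i = 1..\<delta>. (t - poly_eval (x i) g / poly_eval (x i) h) ^ multiplicity_at \<Sigma> u I (\<zeta> i))"
proof -
  let ?A = "{1..\<delta>}"
  define \<beta> where "\<beta> = \<alpha> + \<alpha>\<^sub>0"
  define \<mu> where "\<mu> i = multiplicity_at \<Sigma> u I (\<zeta> i)" for i
  define S where "S = (graded_piece \<beta> :: 'k cox_poly set)"
  define W where "W = I \<inter> S"
  have \<alpha>: "\<alpha> \<in> class_group u" "\<alpha>\<^sub>0 \<in> class_group u" and reg\<alpha>: "\<alpha> \<in> regularity \<Sigma> u I" and reg\<beta>: "\<beta> \<in> regularity \<Sigma> u I"
    and nb: "\<And>\<zeta>. \<zeta> \<in> ideal_points \<Sigma> u I \<Longrightarrow> \<not> basepoint \<Sigma> u \<alpha>\<^sub>0 \<zeta>"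
      "\<And>\<zeta>. \<zeta> \<in> ideal_points \<Sigma> u I \<Longrightarrow> \<not> basepoint \<Sigma> u \<alpha> \<zeta>"
    using reg by (auto simp: regularity_pair_def regularity_def \<beta>_def)
  have pts: "\<zeta> i \<in> ideal_points \<Sigma> u I" if "i \<in> ?A" for i using \<zeta> that by (auto simp: bij_betw_def)
  have pts': "point_class (x i) (\<tau> i) \<in> ideal_points \<Sigma> u I" if "i \<in> ?A" for i using pts[OF that] x[OF that] by simp
  have lx: "lifts (x i) (\<tau> i)" if "i \<in> ?A" for i using x[OF that] by simp
  have all_pts: "\<exists>x \<tau>. lifts x \<tau> \<and> \<xi> = point_class x \<tau> \<and> loc_zero x \<tau> f"
    if lz: "\<And>i. i \<in> ?A \<Longrightarrow> loc_zero (x i) (\<tau> i) f" and \<xi>: "\<xi> \<in> ideal_points \<Sigma> u I" for f \<xi>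
  proof -
    have "\<xi> \<in> \<zeta> ` ?A" using bij_betw_imp_surj_on[OF \<zeta>] \<xi> by metis
    then obtain i where "i \<in> ?A" "\<xi> = \<zeta> i" by blast
    then show ?thesis using lz[of i] x[of i] by blast
  qed
  interpret Q: quotient_vs S W Q "\<lambda>f. f +o W"
    unfolding S_def W_def Q_def \<beta>_def by (rule graded_quotient_vs)
  interpret A: quotient_vs "graded_piece \<alpha>" "I \<inter> graded_piece \<alpha>" "graded_quotient I \<alpha>" "\<lambda>f. f +o (I \<inter> graded_piece \<alpha>)"
    by (rule graded_quotient_vs)
  define d where "d = (\<Sum>i\<in>?A. \<mu> i)"
  have deg: "scheme_degree \<Sigma> u I = d"
    unfolding scheme_degree_def d_def \<mu>_def using sum.reindex_bij_betw[OF \<zeta>] by metis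
  have Qd: "Q.fin_dim" "Q.dim = d" and Ad: "A.fin_dim" "A.dim = d"
    using reg\<alpha> reg\<beta> deg by (auto simp: regularity_def Q_def \<beta>_def)
  have Mh: "M h (f +o (I \<inter> graded_piece \<alpha>)) = (f * h) +o W"
    and Mg: "M g (f +o (I \<inter> graded_piece \<alpha>)) = (f * g) +o W" for f
    unfolding M_def W_def S_def \<beta>_def using mult_map_eq[OF h] mult_map_eq[OF g] by blast+
  have Sh: "f * h \<in> S" and Sg: "f * g \<in> S" if "f \<in> graded_piece \<alpha>" for f
    unfolding S_def \<beta>_def using graded_piece_mult[OF that h] graded_piece_mult[OF that g] by blast+

  \<comment> \<open>Multiplication by \<open>h\<close> keeps a basis of degree
    \<open>\<alpha>\<close> independent, by local cancellation and regularity of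
    \<open>\<alpha>\<close>. Both degrees have dimension \<open>d\<close>, so the products form a
    basis again.\<close>
  have surj: "\<exists>p\<in>graded_piece \<alpha>. y - p * h \<in> W" if y: "y \<in> S" for y
  proof -
    obtain f where f: "\<And>i. i < d \<Longrightarrow> f i \<in> graded_piece \<alpha>" "indep_mod (I \<inter> graded_piece \<alpha>) f d"
      using A.obtain_basis[OF Ad(1)] Ad(2) by metis
    have sumf: "(\<Sum>i<d. cst (c i) * f i) \<in> graded_piece \<alpha>" for c
      using f(1) by (intro A.X_sum) auto
    have sum_h: "(\<Sum>i<d. cst (c i) * (f i * h)) = (\<Sum>i<d. cst (c i) * f i) * h" for c
      by (simp add: sum_distrib_right mult.assoc)
    have ind: "indep_mod W (\<lambda>i. f i * h) d"
      unfolding indep_mod_def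
    proof (intro allI impI)
      fix c i assume c: "(\<Sum>i<d. cst (c i) * (f i * h)) \<in> W" and i: "i < d"
      have "(\<Sum>i<d. cst (c i) * f i) \<in> I"
      proof (rule regular_injective[OF reg\<alpha> sumf all_pts])
        show "loc_zero (x i) (\<tau> i) (\<Sum>i<d. cst (c i) * f i)" if i: "i \<in> ?A" for i
          using c unfolding sum_h W_def
          by (intro multiplication_loc_injective[OF lx[OF i] pts'[OF i] \<alpha> _ _ h hx[OF i] sumf])
            (use nb pts'[OF i] in auto)
      qed
      then have "(\<Sum>i<d. cst (c i) * f i) \<in> I \<inter> graded_piece \<alpha>" using sumf by blast
      then show "c i = 0" using f(2) i unfolding indep_mod_def by blast
    qed
    have fhS: "f i * h \<in> S" if "i < d" for i by (rule Sh[OF f(1)[OF that]])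
    note li = Q.indep_mod_imp[OF fhS ind]
    have "Q.basis (((\<lambda>f. f +o W) \<circ> (\<lambda>i. f i * h)) ` {..<d})"
    proof (rule Q.dim_li_is_basis[OF Qd(1) _ _ li(2)])
      show "((\<lambda>f. f +o W) \<circ> (\<lambda>i. f i * h)) ` {..<d} \<subseteq> carrier Q" using fhS by (auto simp: Q.carr)
      show "Q.dim \<le> card (((\<lambda>f. f +o W) \<circ> (\<lambda>i. f i * h)) ` {..<d})" using card_image[OF li(1)] Qd(2) by simp
    qed simp
    then have "spans_mod S W (\<lambda>i. f i * h) d" using Q.basisD(2)[of d "\<lambda>i. f i * h"] fhS li(1) by blast
    then obtain c where "y - (\<Sum>i<d. cst (c i) * (f i * h)) \<in> W" using y unfolding spans_mod_def by blast
    then show ?thesis unfolding sum_h using sumf by blast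
  qed
  \<comment> \<open>\<open>inv_into\<close> picks some preimage class, and \<open>p\<close> is a
    representative of it; only the congruence of \<open>p * h\<close> with \<open>y\<close> is used
    later.\<close>
  have "\<exists>p. y \<in> S \<longrightarrow> p \<in> graded_piece \<alpha> \<and> y - p * h \<in> W \<and> T (y +o W) = (p * g) +o W" for y
  proof (cases "y \<in> S")
    case True
    obtain p0 where p0: "p0 \<in> graded_piece \<alpha>" "y - p0 * h \<in> W" using surj[OF True] by blast
    then have "y +o W = M h (p0 +o (I \<inter> graded_piece \<alpha>))"
      using Q.eq[OF True Sh[OF p0(1)]] by (simp add: Mh)
    then have im: "y +o W \<in> M h ` carrier (graded_quotient I \<alpha>)" using p0(1) by (auto simp: A.carr)
    obtain p where p: "p \<in> graded_piece \<alpha>"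
      "inv_into (carrier (graded_quotient I \<alpha>)) (M h) (y +o W) = p +o (I \<inter> graded_piece \<alpha>)"
      using inv_into_into[OF im] by (auto simp: A.carr)
    have "(p * h) +o W = y +o W" using f_inv_into_f[OF im] unfolding p(2) Mh .
    then have "y - p * h \<in> W" using Q.eq[OF True Sh[OF p(1)]] by simp
    then show ?thesis using p by (auto simp: T_def Mg)
  qed auto
  then obtain p where p: "\<And>y. y \<in> S \<Longrightarrow> p y \<in> graded_piece \<alpha>" "\<And>y. y \<in> S \<Longrightarrow> y - p y * h \<in> W"
    "\<And>y. y \<in> S \<Longrightarrow> T (y +o W) = (p y * g) +o W" by metis
  \<comment> \<open>\<open>t\<close> minus the endomorphism on representatives. \<open>D\<close> is
    linear only modulo \<open>W\<close>, which suffices for \<open>endo_det_eq\<close>.\<close>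
  define D where "D y = cst t * y - p y * g" for y
  have DS: "D y \<in> S" if "y \<in> S" for y
    unfolding D_def using that by (intro Q.Xs(3,4) Sg p)
  have DT: "(t \<odot>\<^bsub>Q\<^esub> (y +o W)) \<ominus>\<^bsub>Q\<^esub> T (y +o W) = D y +o W" if y: "y \<in> S" for y
    using y Q.Xs(4)[OF y] Sg[OF p(1)[OF y]] by (simp add: p(3) Q.smu Q.minus D_def)

  define ok where "ok i l U \<longleftrightarrow> (\<forall>r<\<mu> i. linear_mod S W (l r)) \<and>
    (\<forall>f\<in>S. (\<forall>r<\<mu> i. l r f = 0) \<longrightarrow> loc_zero (x i) (\<tau> i) f) \<and>
    (\<forall>r<\<mu> i. \<forall>p\<in>graded_piece \<alpha>. l r (cst t * (p * h) - p * g) = (\<Sum>s<\<mu> i. U r s * l s (p * h))) \<and>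
    (\<forall>r<\<mu> i. \<forall>s<r. U r s = (0::complex)) \<and> (\<forall>r<\<mu> i. U r r = t - poly_eval (x i) g / poly_eval (x i) h)" for i l U
  have "\<exists>l U. i \<in> ?A \<longrightarrow> ok i l U" for i
  proof (cases "i \<in> ?A")
    case True
    show ?thesis
      using point_functionals[OF lx[OF True] pts'[OF True] \<alpha> nb(2)[OF pts'[OF True]] nb(1)[OF pts'[OF True]] g h hx[OF True], of t]
        x[OF True]
      unfolding ok_def \<mu>_def S_def W_def \<beta>_def by auto
  qed auto
  then obtain l U where "\<And>i. i \<in> ?A \<Longrightarrow> ok i (l i) (U i)" by metis
  then have l: "\<And>i r. i \<in> ?A \<Longrightarrow> r < \<mu> i \<Longrightarrow> linear_mod S W (l i r)"
    "\<And>i f. i \<in> ?A \<Longrightarrow> f \<in> S \<Longrightarrow> (\<And>r. r < \<mu> i \<Longrightarrow> l i r f = 0) \<Longrightarrow> loc_zero (x i) (\<tau> i) f"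
    "\<And>i r p. i \<in> ?A \<Longrightarrow> r < \<mu> i \<Longrightarrow> p \<in> graded_piece \<alpha> \<Longrightarrow>
       l i r (cst t * (p * h) - p * g) = (\<Sum>s<\<mu> i. U i r s * l i s (p * h))"
    "\<And>i r s. i \<in> ?A \<Longrightarrow> r < \<mu> i \<Longrightarrow> s < r \<Longrightarrow> U i r s = 0"
    "\<And>i r. i \<in> ?A \<Longrightarrow> r < \<mu> i \<Longrightarrow> U i r r = t - poly_eval (x i) g / poly_eval (x i) h"
    unfolding ok_def by blast+
  have lD: "l i r (D y) = (\<Sum>s<\<mu> i. U i r s * l i s y)" if i: "i \<in> ?A" and r: "r < \<mu> i" and y: "y \<in> S" for i r y
  proof -
    note py = p(1)[OF y] p(2)[OF y]
    have "D y - (cst t * (p y * h) - p y * g) = cst t * (y - p y * h)" by (simp add: D_def algebra_simps)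
    also have "\<dots> \<in> W" by (rule pm.subspace_scale[OF Q.K py(2)])
    finally have "l i r (D y) = l i r (cst t * (p y * h) - p y * g)"
      by (intro linear_mod_cong[OF l(1)[OF i r] Q.X Q.KX DS[OF y]] Q.Xs(3,4) Sh Sg py(1))
    also have "\<dots> = (\<Sum>s<\<mu> i. U i r s * l i s (p y * h))" by (rule l(3)[OF i r py(1)])
    also have "\<dots> = (\<Sum>s<\<mu> i. U i r s * l i s y)"
    proof (intro sum.cong refl)
      fix s assume "s \<in> {..<\<mu> i}"
      then have "l i s y = l i s (p y * h)"
        using linear_mod_cong[OF l(1)[OF i] Q.X Q.KX y Sh[OF py(1)] py(2)] by auto
      then show "U i r s * l i s (p y * h) = U i r s * l i s y" by simp
    qed
    finally show ?thesis .
  qed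

  obtain e where e: "bij_betw e {..<d} (SIGMA i:?A. {..<\<mu> i})"
    "\<And>r s. s < r \<Longrightarrow> r < d \<Longrightarrow> fst (e r) = fst (e s) \<Longrightarrow> snd (e s) < snd (e r)"
    using ordered_sigma_enumeration[of ?A \<mu>] unfolding d_def by auto
  have er: "fst (e r) \<in> ?A" "snd (e r) < \<mu> (fst (e r))" if "r < d" for r
  proof -
    have "e r \<in> (SIGMA i:?A. {..<\<mu> i})" using that bij_betw_apply[OF e(1)] by blast
    then show "fst (e r) \<in> ?A" "snd (e r) < \<mu> (fst (e r))" by auto
  qed
  define L where "L r = l (fst (e r)) (snd (e r))" for r
  \<comment> \<open>Rows and columns run over pairs of a point and an index of its local
    functionals; entries between different points are 0 because \<open>l i r (D y)\<close> involves
    only the functionals of the point \<open>i\<close>.\<close>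
  define V where "V = Matrix.mat d d (\<lambda>(r, s). if fst (e r) = fst (e s) then U (fst (e r)) (snd (e r)) (snd (e s)) else 0)"
  have V: "V \<in> carrier_mat d d" by (simp add: V_def)
  have "endo_det Q (\<lambda>v. (t \<odot>\<^bsub>Q\<^esub> v) \<ominus>\<^bsub>Q\<^esub> T v) = Determinant.det V"
  proof (rule Q.endo_det_eq[OF Qd, of D _ L])
    show "D y \<in> S \<and> (t \<odot>\<^bsub>Q\<^esub> (y +o W)) \<ominus>\<^bsub>Q\<^esub> T (y +o W) = D y +o W" if "y \<in> S" for y
      using DS[OF that] DT[OF that] by blast
    show "linear_mod S W (L r)" if "r < d" for r unfolding L_def using l(1) er[OF that] by blast
    show "y \<in> W" if y: "y \<in> S" and z: "\<And>r. r < d \<Longrightarrow> L r y = 0" for y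
    proof -
      have "y \<in> I"
      proof (rule regular_injective[OF reg\<beta> _ all_pts])
        show "y \<in> graded_piece \<beta>" using y by (simp add: S_def)
        show "loc_zero (x i) (\<tau> i) y" if i: "i \<in> ?A" for i
        proof (rule l(2)[OF i y])
          fix r assume "r < \<mu> i"
          then have "(i, r) \<in> e ` {..<d}" using e(1) i by (simp add: bij_betw_def)
          then obtain k where "k < d" "e k = (i, r)" by auto
          then show "l i r y = 0" using z[of k] by (simp add: L_def)
        qed
      qed
      then show ?thesis using y by (simp add: W_def)
    qed
    show "L r (D y) = (\<Sum>s<d. V $$ (r, s) * L s y)" if r: "r < d" and y: "y \<in> S" for r y
    proof -
      let ?i = "fst (e r)"
      define F where "F z = (if ?i = fst z then U ?i (snd (e r)) (snd z) else 0) * l (fst z) (snd z) y" for z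
      have "(\<Sum>s<d. V $$ (r, s) * L s y) = (\<Sum>s<d. F (e s))"
        using r by (intro sum.cong refl) (simp add: V_def L_def F_def)
      also have "\<dots> = (\<Sum>z\<in>(SIGMA i:?A. {..<\<mu> i}). F z)" by (rule sum.reindex_bij_betw[OF e(1)])
      also have "\<dots> = (\<Sum>i\<in>?A. \<Sum>s<\<mu> i. F (i, s))" by (simp add: sum.Sigma)
      also have "\<dots> = (\<Sum>i\<in>?A. if i = ?i then \<Sum>s<\<mu> ?i. U ?i (snd (e r)) s * l ?i s y else 0)"
        by (intro sum.cong refl) (auto simp: F_def)
      also have "\<dots> = (\<Sum>s<\<mu> ?i. U ?i (snd (e r)) s * l ?i s y)" using er(1)[OF r] by (simp only: sum.delta finite_atLeastAtMost if_True)
      also have "\<dots> = L r (D y)" unfolding L_def using lD[OF er[OF r] y] by simp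
      finally show ?thesis by simp
    qed
  qed (rule V)
  also have "\<dots> = prod_list (diag_mat V)"
  proof (rule det_upper_triangular[OF _ V])
    show "upper_triangular V"
    proof (rule upper_triangularI)
      fix r s assume rs: "s < r" "r < dim_row V"
      then have "r < d" "s < d" using V by auto
      \<comment> \<open>Within one point the enumeration respects the order of the indices, so an
        entry below the diagonal of \<open>V\<close> is one below the diagonal of
        \<open>U\<close>.\<close>
      then show "V $$ (r, s) = 0"
        using l(4)[OF er[of r], of "snd (e s)"] e(2)[OF rs(1)] by (auto simp: V_def)
    qed
  qed
  also have "\<dots> = (\<Prod>r<d. V $$ (r, r))"
    using V by (simp add: diag_mat_def prod.list_conv_set_nth lessThan_atLeast0)
  also have "\<dots> = (\<Prod>r<d. t - poly_eval (x (fst (e r))) g / poly_eval (x (fst (e r))) h)"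
    using l(5) er by (intro prod.cong refl) (simp add: V_def)
  also have "\<dots> = (\<Prod>z\<in>(SIGMA i:?A. {..<\<mu> i}). t - poly_eval (x (fst z)) g / poly_eval (x (fst z)) h)"
    by (rule prod.reindex_bij_betw[OF e(1)])
  also have "\<dots> = (\<Prod>i\<in>?A. \<Prod>s<\<mu> i. t - poly_eval (x i) g / poly_eval (x i) h)"
    by (subst prod.Sigma) (auto simp: case_prod_unfold)
  also have "\<dots> = (\<Prod>i = 1..\<delta>. (t - poly_eval (x i) g / poly_eval (x i) h) ^ multiplicity_at \<Sigma> u I (\<zeta> i))"
    by (simp add: \<mu>_def)
  finally show ?thesis .
qed

end

theorem theorem3p1:
  fixes \<Sigma> :: "(real^'n::finite) set set" and u :: "'k::finite \<Rightarrow> int^'n"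
    and I :: "'k cox_poly set"
    and \<delta> :: nat and \<zeta> :: "nat \<Rightarrow> 'n toric_point"
    and \<alpha> \<alpha>\<^sub>0 :: "(int^'k) set"
    and g h\<^sub>0 h :: "'k cox_poly"
    and \<gamma> :: "(real^'n) set \<Rightarrow> (int^'k) set"
    and gs :: "(real^'n) set \<Rightarrow> 'k cox_poly"
    and \<sigma> :: "nat \<Rightarrow> (real^'n) set"
    and t :: complex
  assumes "complete_fan \<Sigma>" and "ray_generators \<Sigma> u"
    and "homogeneous_ideal u I" and "zero_dimensional \<Sigma> u I"
    and "bij_betw \<zeta> {1..\<delta>} (ideal_points \<Sigma> u I)"
    and "regularity_pair \<Sigma> u I \<alpha> \<alpha>\<^sub>0"
    and "g \<in> graded_piece \<alpha>\<^sub>0"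
    and "h\<^sub>0 \<in> graded_piece \<alpha>\<^sub>0" and "ideal_points \<Sigma> u I \<inter> hypersurface \<Sigma> u h\<^sub>0 = {}"
    and "h \<in> graded_piece \<alpha>\<^sub>0" and "ideal_points \<Sigma> u I \<inter> hypersurface \<Sigma> u h = {}"
    and "\<And>\<tau>. \<tau> \<in> maximal_cones \<Sigma> \<Longrightarrow> eta_choice u I \<alpha>\<^sub>0 h \<tau> (\<gamma> \<tau>) (gs \<tau>)"
    and "\<And>i. i \<in> {1..\<delta>} \<Longrightarrow> \<sigma> i \<in> maximal_cones \<Sigma> \<and> \<zeta> i \<in> affine_chart \<Sigma> (\<sigma> i)"
  shows
    "(let Q = graded_quotient I (\<alpha> + \<alpha>\<^sub>0);
          M = mult_map I (\<alpha> + \<alpha>\<^sub>0);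
          T = M g \<circ> inv_into (carrier (graded_quotient I \<alpha>)) (M h\<^sub>0);
          \<eta> = (\<lambda>\<tau>. eta u \<tau> (\<gamma> \<tau>) (gs \<tau>));
          ratio = (\<lambda>i. ev (\<sigma> i) (\<zeta> i) (\<eta> (\<sigma> i) g) / ev (\<sigma> i) (\<zeta> i) (\<eta> (\<sigma> i) h\<^sub>0))
      in endo_det Q (\<lambda>v. (t \<odot>\<^bsub>Q\<^esub> v) \<ominus>\<^bsub>Q\<^esub> T v)
         = (\<Prod>i = 1..\<delta>. (t - ratio i) ^ multiplicity_at \<Sigma> u I (\<zeta> i)))"
proof -
  have "finite (ideal_points \<Sigma> u I)"
    using assms(5) bij_betw_finite by blast
  then interpret toric_ideal \<Sigma> u I
    using assms(1-3) by unfold_locales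
  have pts: "\<zeta> i \<in> ideal_points \<Sigma> u I" if "i \<in> {1..\<delta>}" for i
    using assms(5) that by (auto simp: bij_betw_def)
  have "\<exists>z. i \<in> {1..\<delta>} \<longrightarrow> lifts (fst z) (snd z) \<and> \<zeta> i = point_class (fst z) (snd z)" for i
  proof (cases "i \<in> {1..\<delta>}")
    case True
    then have "\<zeta> i \<in> toric_variety \<Sigma>" using assms(13) by (auto simp: affine_chart_def)
    then obtain x \<tau> where "lifts x \<tau>" "\<zeta> i = point_class x \<tau>" by (rule toric_point_lift)
    then show ?thesis by (intro exI[of _ "(x, \<tau>)"]) auto
  qed auto
  then obtain z where z: "\<And>i. i \<in> {1..\<delta>} \<Longrightarrow> lifts (fst (z i)) (snd (z i)) \<and> \<zeta> i = point_class (fst (z i)) (snd (z i))"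
    by metis
  have hx: "poly_eval (fst (z i)) h\<^sub>0 \<noteq> 0" if i: "i \<in> {1..\<delta>}" for i
    using not_in_hypersurface[of "fst (z i)" "snd (z i)" h\<^sub>0] z[OF i] pts[OF i] assms(9) by auto
  \<comment> \<open>\<open>h\<close> fixes the normalization of \<open>gs\<close>, while
    \<open>h\<^sub>0\<close> defines the map. The ratio in the chart of \<open>\<sigma> i\<close>
    becomes the quotient of the two polynomial values at the lifted point.\<close>
  have ratio: "ev (\<sigma> i) (\<zeta> i) (eta u (\<sigma> i) (\<gamma> (\<sigma> i)) (gs (\<sigma> i)) g) / ev (\<sigma> i) (\<zeta> i) (eta u (\<sigma> i) (\<gamma> (\<sigma> i)) (gs (\<sigma> i)) h\<^sub>0)
      = poly_eval (fst (z i)) g / poly_eval (fst (z i)) h\<^sub>0" if i: "i \<in> {1..\<delta>}" for i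
  proof -
    have \<sigma>: "\<sigma> i \<in> maximal_cones \<Sigma>" "snd (z i) \<subseteq> \<sigma> i"
      using assms(13)[OF i] z[OF i] in_affine_chart_iff by auto
    have "\<alpha>\<^sub>0 \<in> class_group u" using assms(6) by (simp add: regularity_pair_def)
    then show ?thesis
      using eta_ratio[of "fst (z i)" "snd (z i)" "\<sigma> i" \<alpha>\<^sub>0 h "\<gamma> (\<sigma> i)" "gs (\<sigma> i)" g h\<^sub>0]
        z[OF i] pts[OF i] \<sigma> assms(12)[OF \<sigma>(1)] assms(7,8,10) by simp
  qed
  show ?thesis
    unfolding Let_def
    using det_multiplication[OF assms(5,6,7,8) z hx, of t] ratio by simp
qed

end
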